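(* Let $T_{(n)}=\sum_{i=0}^n\mathcal{T}_it^i$ be an order $n$ deformation of a relative Rota--Baxter operator $T:E\to\mathcal{A}$ on a LieRep pair $(\mathcal{A},[\cdot,\cdot]_{\mathcal{A}},a_{\mathcal{A}};\rho)$. Define $$\Theta=\frac12\sum_{\substack{i+j=n+1\\ i,j\ge1}}[\![\mathcal{T}_i,\mathcal{T}_j]\!].$$ Then the $2$-cochain $\Theta\in\mathcal{C}^2(E,\mathcal{A})$ is closed, i.e. $\mathrm{d}_T\Theta=0$. Furthermore, $T_{(n)}$ is extendable if and only if the cohomology class $[\Theta]$ in $\mathcal{H}^2_T(E,\mathcal{A})$ is trivial.
   Context: Vector bundles are smooth real vector bundles over a smooth manifold $M$, and bundle maps cover the identity of $M$. A Lie algebroid $(\mathcal{A},[\cdot,\cdot]_{\mathcal{A}},a_{\mathcal{A}})$ is a vector bundle $\mathcal{A}\to M$ with a Lie bracket on $\Gamma(\mathcal{A})$ and a bundle map $a_{\mathcal{A}}:\mathcal{A}\to TM$ with $[x,fy]_{\mathcal{A}}=f[x,y]_{\mathcal{A}}+a_{\mathcal{A}}(x)(f)y$. A representation of $\mathcal{A}$ on $E$ is a $C^\infty(M)$-linear map $x\mapsto\rho(x)$ from $\Gamma(\mathcal{A})$ to $\mathbb{R}$-linear operators on $\Gamma(E)$ with $\rho(x)(fu)=f\rho(x)u+a_{\mathcal{A}}(x)(f)u$ and $\rho([x,y]_{\mathcal{A}})=\rho(x)\rho(y)-\rho(y)\rho(x)$. A LieRep pair $(\mathcal{A};\rho)$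 is a Lie algebroid with a representation $\rho$ on a vector bundle $E$. A relative Rota--Baxter operator is a bundle map $T:E\to\mathcal{A}$ with $[T(u),T(v)]_{\mathcal{A}}=T(\rho(T(u))(v)-\rho(T(v))(u))$ for all $u,v\in\Gamma(E)$. $\mathcal{C}^k(E,\mathcal{A})=\Gamma(\mathrm{Hom}(\wedge^kE,\mathcal{A}))$, $k\ge0$. For $P\in \mathcal{C}^n(E,\mathcal{A})$, $Q\in \mathcal{C}^m(E,\mathcal{A})$, $$\begin{aligned} [\![P,Q]\!](u_1,\dots,u_{m+n})={}&\sum_{\sigma\in\mathbb{S}_{(m,1,n-1)}} (-1)^\sigma P(\rho(Q(u_{\sigma(1)},\dots,u_{\sigma(m)}))u_{\sigma(m+1)},u_{\sigma(m+2)},\dots,u_{\sigma(m+n)})\\ &-(-1)^{mn}\sum_{\sigma\in\mathbb{S}_{(n,1,m-1)}} (-1)^\sigma Q(\rho(P(u_{\sigma(1)},\dots,u_{\sigma(n)}))u_{\sigma(n+1)},u_{\sigma(n+2)},\dots,u_{\sigma(m+n)})\\ &+(-1)^{mn}\sum_{\sigma\in\mathbb{S}_{(n,m)}} (-1)^\sigma [P(u_{\sigma(1)},\dots,u_{\sigma(n)}),Q(u_{\sigma(n+1)},\dots,u_{\sigma(m+n)})]_{\mathcal{A}}, \end{aligned}$$ where $\mathbb{S}_{(i_1,\dots,i_k)}$ is the set of unshuffles (permutations increasing on consecutive blocks of lengths $i_1,\dots,i_k$) and a sum involving a block of length $-1$ is zero. This is a graded Lie bracket. Put $\mathrm{d}_TP=(-1)^k[\![T,P]\!]$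 for $P\in\mathcal{C}^k(E,\mathcal{A})$; then $\mathrm{d}_T^2=0$, and $\mathcal{H}^k_T(E,\mathcal{A})$ is the $k$-th cohomology group of $(\oplus_{k\ge0}\mathcal{C}^k(E,\mathcal{A}),\mathrm{d}_T)$. Extend all structures $\mathbb{R}[[t]]$-linearly. An order $n$ deformation of $T$ is $T_{(n)}=\sum_{i=0}^n\mathcal{T}_it^i$ with $\mathcal{T}_0=T$ and bundle maps $\mathcal{T}_i:E\to\mathcal{A}$ such that $T_{(n)}$ satisfies the relative Rota--Baxter identity modulo $t^{n+1}$ (i.e. over $\mathbb{R}[[t]]/(t^{n+1})$). It is extendable if there is a bundle map $\mathcal{T}_{n+1}:E\to\mathcal{A}$ such that $T_{(n)}+t^{n+1}\mathcal{T}_{n+1}$ is an order $n+1$ deformation of $T$. *)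

theory Defs
  imports
    "HOL-Analysis.Analysis"
    "HOL-Library.Function_Algebras"
    "HOL-Combinatorics.Permutations"
begin

section \<open>Pointwise vector space structure on function types\<close>

instantiation "fun" :: (type, real_vector) real_vector
begin

definition scaleR_fun :: "real \<Rightarrow> ('a \<Rightarrow> 'b) \<Rightarrow> 'a \<Rightarrow> 'b"
  where "scaleR_fun c f = (\<lambda>x. c *\<^sub>R f x)"

instance
  by standard
    (simp_all add: scaleR_fun_def fun_eq_iff scaleR_add_right scaleR_add_left)

end


section \<open>Smooth manifolds\<close>

text \<open>
  \<open>D [v\<^sub>1, \<dots>, v\<^sub>k]\<close> is the iterated directional derivative of \<open>f\<close> along \<open>v\<^sub>k\<close>, \<dots>, \<open>v\<^sub>1\<close>.
  The predicate is used for relatively open subsets \<open>S\<close> of a linear subspace; there it is the usual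
  notion of a \<open>C\<^sup>\<infinity>\<close> function. Only the values of \<open>f\<close> on \<open>S\<close> matter.
\<close>

definition smooth_on :: "'b::euclidean_space set \<Rightarrow> ('b \<Rightarrow> 'c::real_normed_vector) \<Rightarrow> bool" where
  "smooth_on S f \<longleftrightarrow>
    (\<exists>D :: 'b list \<Rightarrow> 'b \<Rightarrow> 'c.
      (\<forall>x\<in>S. D [] x = f x) \<and>
      (\<forall>vs. \<forall>x\<in>S. (D vs has_derivative (\<lambda>v. D (v # vs) x)) (at x within S)))"

text \<open>
  The manifold is the whole type \<open>'m\<close>. Charts take values in a linear subspace \<open>model\<close> of a
  Euclidean space, so that the dimension of the manifold is \<open>dim model\<close>; using a subspace instead of
  the whole type admits dimension \<open>0\<close> (every type in \<open>euclidean_space\<close> has positive dimension).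
\<close>

record ('m, 'b) manifold =
  model :: "'b set"
  charts :: "('m set \<times> ('m \<Rightarrow> 'b)) set"

definition smooth_manifold ::
    "('m::{t2_space,second_countable_topology}, 'b::euclidean_space) manifold \<Rightarrow> bool" where
  "smooth_manifold M \<longleftrightarrow>
    subspace (model M) \<and>
    (\<Union>(U, \<phi>)\<in>charts M. U) = UNIV \<and>
    (\<forall>(U, \<phi>)\<in>charts M.
        open U \<and> openin (top_of_set (model M)) (\<phi> ` U) \<and>
        homeomorphism U (\<phi> ` U) \<phi> (inv_into U \<phi>)) \<and>
    (\<forall>(U, \<phi>)\<in>charts M. \<forall>(U', \<phi>')\<in>charts M.
        smooth_on (\<phi> ` (U \<inter> U')) (\<phi>' \<circ> inv_into U \<phi>))"

text \<open>Smoothness of \<open>f\<close> on an open subset \<open>W\<close> of the manifold.\<close>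

definition smooth_fun ::
    "('m::{t2_space,second_countable_topology}, 'b::euclidean_space) manifold \<Rightarrow> 'm set
      \<Rightarrow> ('m \<Rightarrow> real) \<Rightarrow> bool" where
  "smooth_fun M W f \<longleftrightarrow>
    (\<forall>(U, \<phi>)\<in>charts M. smooth_on (\<phi> ` (U \<inter> W)) (f \<circ> inv_into U \<phi>))"


section \<open>Smooth vector bundles\<close>

text \<open>
  The fibres of a vector bundle are linear subspaces \<open>fibre E x\<close> of one real vector space \<open>'e\<close>; this is no
  restriction, since the fibres of any bundle embed in their direct sum. No relation between
  different fibres is induced by this embedding.
  A local trivialisation \<open>U \<times> \<real>\<^sup>r \<rightarrow> E|\<^sub>U\<close> is given by its local frame, i.e. by the images
  \<open>b 0 x, \<dots>, b (r - 1) x\<close> of the standard basis over \<open>x \<in> U\<close>; the condition on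
  two trivialisations is smoothness of the transition matrix. These data determine the
  smooth structure of the total space.
\<close>

record ('m, 'e) vbundle =
  fibre :: "'m \<Rightarrow> 'e set"
  rank :: nat
  frames :: "('m set \<times> (nat \<Rightarrow> 'm \<Rightarrow> 'e)) set"

definition smooth_section_on ::
    "('m::{t2_space,second_countable_topology}, 'b::euclidean_space) manifold
      \<Rightarrow> ('m, 'e::real_vector) vbundle \<Rightarrow> 'm set \<Rightarrow> ('m \<Rightarrow> 'e) \<Rightarrow> bool" where
  "smooth_section_on M E W s \<longleftrightarrow>
    (\<forall>x\<in>W. s x \<in> fibre E x) \<and>
    (\<forall>(U, b)\<in>frames E. \<exists>g :: nat \<Rightarrow> 'm \<Rightarrow> real.
        (\<forall>i<rank E. smooth_fun M (U \<inter> W) (g i)) \<and>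
        (\<forall>x\<in>U \<inter> W. s x = (\<Sum>i<rank E. g i x *\<^sub>R b i x)))"

definition vector_bundle ::
    "('m::{t2_space,second_countable_topology}, 'b::euclidean_space) manifold
      \<Rightarrow> ('m, 'e::real_vector) vbundle \<Rightarrow> bool" where
  "vector_bundle M E \<longleftrightarrow>
    (\<Union>(U, b)\<in>frames E. U) = UNIV \<and>
    (\<forall>(U, b)\<in>frames E.
        open U \<and>
        (\<forall>x\<in>U. inj_on (\<lambda>i. b i x) {..<rank E} \<and>
               independent ((\<lambda>i. b i x) ` {..<rank E}) \<and>
               span ((\<lambda>i. b i x) ` {..<rank E}) = fibre E x) \<and>
        (\<forall>j<rank E. smooth_section_on M E U (b j)))"

text \<open>\<open>\<Gamma>(E)\<close>\<close>

definition sections ::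
    "('m::{t2_space,second_countable_topology}, 'b::euclidean_space) manifold
      \<Rightarrow> ('m, 'e::real_vector) vbundle \<Rightarrow> ('m \<Rightarrow> 'e) set" where
  "sections M E = {s. smooth_section_on M E UNIV s}"

definition fmult :: "('m \<Rightarrow> real) \<Rightarrow> ('m \<Rightarrow> 'e::real_vector) \<Rightarrow> 'm \<Rightarrow> 'e" where
  "fmult f s = (\<lambda>x. f x *\<^sub>R s x)"

text \<open>Bundle maps covering the identity. Values outside the fibres are irrelevant.\<close>

definition bundle_map ::
    "('m::{t2_space,second_countable_topology}, 'b::euclidean_space) manifold
      \<Rightarrow> ('m, 'e::real_vector) vbundle \<Rightarrow> ('m, 'a::real_vector) vbundle
      \<Rightarrow> ('m \<Rightarrow> 'e \<Rightarrow> 'a) \<Rightarrow> bool" where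
  "bundle_map M E F T \<longleftrightarrow>
    (\<forall>x. \<forall>e\<in>fibre E x. T x e \<in> fibre F x) \<and>
    (\<forall>x. \<forall>e\<in>fibre E x. \<forall>e'\<in>fibre E x. T x (e + e') = T x e + T x e') \<and>
    (\<forall>x c. \<forall>e\<in>fibre E x. T x (c *\<^sub>R e) = c *\<^sub>R T x e) \<and>
    (\<forall>(U, b)\<in>frames E. \<forall>j<rank E. smooth_section_on M F U (\<lambda>x. T x (b j x)))"

text \<open>The action \<open>u \<mapsto> T(u)\<close> of a bundle map on sections.\<close>

definition app_sect :: "('m \<Rightarrow> 'e \<Rightarrow> 'a) \<Rightarrow> ('m \<Rightarrow> 'e) \<Rightarrow> 'm \<Rightarrow> 'a" where
  "app_sect T u = (\<lambda>x. T x (u x))"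


section \<open>The tangent bundle\<close>

text \<open>
  Tangent vectors at \<open>x\<close> are the derivations of the algebra of germs at \<open>x\<close> of smooth functions.
  They are represented as functionals on all functions, with value \<open>0\<close> on functions that are not
  smooth near \<open>x\<close>.
\<close>

definition smooth_near ::
    "('m::{t2_space,second_countable_topology}, 'b::euclidean_space) manifold \<Rightarrow> 'm
      \<Rightarrow> ('m \<Rightarrow> real) \<Rightarrow> bool" where
  "smooth_near M x f \<longleftrightarrow> (\<exists>W. open W \<and> x \<in> W \<and> smooth_fun M W f)"

definition tangent_space ::
    "('m::{t2_space,second_countable_topology}, 'b::euclidean_space) manifold \<Rightarrow> 'm
      \<Rightarrow> (('m \<Rightarrow> real) \<Rightarrow> real) set" where
  "tangent_space M x =
    {X. (\<forall>f. \<not> smooth_near M x f \<longrightarrow> X f = 0) \<and>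
        (\<forall>f g. smooth_near M x f \<and> smooth_near M x g \<and> (\<forall>\<^sub>F y in nhds x. f y = g y) \<longrightarrow> X f = X g) \<and>
        (\<forall>f g. smooth_near M x f \<and> smooth_near M x g \<longrightarrow>
            X (\<lambda>y. f y + g y) = X f + X g \<and>
            X (\<lambda>y. f y * g y) = f x * X g + X f * g x) \<and>
        (\<forall>c f. smooth_near M x f \<longrightarrow> X (\<lambda>y. c * f y) = c * X f)}"

text \<open>The derivative at \<open>x\<close> along the coordinate direction \<open>v\<close> of the chart \<open>(U, \<phi>)\<close>.\<close>

definition coord_vector ::
    "('m::{t2_space,second_countable_topology}, 'b::euclidean_space) manifold \<Rightarrow> 'm set
      \<Rightarrow> ('m \<Rightarrow> 'b) \<Rightarrow> 'b \<Rightarrow> 'm \<Rightarrow> ('m \<Rightarrow> real) \<Rightarrow> real" where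
  "coord_vector M U \<phi> v x =
    (\<lambda>f. if smooth_near M x f then deriv (\<lambda>h. f (inv_into U \<phi> (\<phi> x + h *\<^sub>R v))) 0 else 0)"

definition tangent_bundle ::
    "('m::{t2_space,second_countable_topology}, 'b::euclidean_space) manifold
      \<Rightarrow> ('m, ('m \<Rightarrow> real) \<Rightarrow> real) vbundle" where
  "tangent_bundle M =
    \<lparr>fibre = tangent_space M,
     rank = dim (model M),
     frames = {(U, \<lambda>i. coord_vector M U \<phi> (v i)) | U \<phi> v.
       (U, \<phi>) \<in> charts M \<and> inj_on v {..<dim (model M)} \<and>
       independent (v ` {..<dim (model M)}) \<and> span (v ` {..<dim (model M)}) = model M}\<rparr>"


section \<open>Lie algebroids and their representations\<close>

text \<open>
  The operations \<open>bracket\<close> and \<open>rho\<close> matter only on smooth sections.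
\<close>

record ('m, 'b, 'a, 'e) lie_rep =
  base :: "('m, 'b) manifold"
  algd :: "('m, 'a) vbundle"
  bracket :: "('m \<Rightarrow> 'a) \<Rightarrow> ('m \<Rightarrow> 'a) \<Rightarrow> 'm \<Rightarrow> 'a"
  anchor :: "'m \<Rightarrow> 'a \<Rightarrow> ('m \<Rightarrow> real) \<Rightarrow> real"
  repb :: "('m, 'e) vbundle"
  rho :: "('m \<Rightarrow> 'a) \<Rightarrow> ('m \<Rightarrow> 'e) \<Rightarrow> 'm \<Rightarrow> 'e"

text \<open>\<open>a(x)(f)\<close> for a section \<open>x\<close> and a function \<open>f\<close>\<close>

definition anchor_deriv :: "('m \<Rightarrow> 'a \<Rightarrow> ('m \<Rightarrow> real) \<Rightarrow> real) \<Rightarrow> ('m \<Rightarrow> 'a) \<Rightarrow> ('m \<Rightarrow> real) \<Rightarrow> 'm \<Rightarrow> real" where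
  "anchor_deriv a x f = (\<lambda>p. a p (x p) f)"

definition lie_algebroid ::
    "('m::{t2_space,second_countable_topology}, 'b::euclidean_space) manifold
      \<Rightarrow> ('m, 'a::real_vector) vbundle
      \<Rightarrow> (('m \<Rightarrow> 'a) \<Rightarrow> ('m \<Rightarrow> 'a) \<Rightarrow> 'm \<Rightarrow> 'a)
      \<Rightarrow> ('m \<Rightarrow> 'a \<Rightarrow> ('m \<Rightarrow> real) \<Rightarrow> real) \<Rightarrow> bool" where
  "lie_algebroid M A br a \<longleftrightarrow>
    vector_bundle M A \<and>
    (\<forall>x\<in>sections M A. \<forall>y\<in>sections M A. br x y \<in> sections M A) \<and>
    (\<forall>x\<in>sections M A. \<forall>y\<in>sections M A. \<forall>z\<in>sections M A. br (x + y) z = br x z + br y z) \<and>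
    (\<forall>c. \<forall>x\<in>sections M A. \<forall>y\<in>sections M A. br (c *\<^sub>R x) y = c *\<^sub>R br x y) \<and>
    (\<forall>x\<in>sections M A. \<forall>y\<in>sections M A. br x y = - br y x) \<and>
    (\<forall>x\<in>sections M A. \<forall>y\<in>sections M A. \<forall>z\<in>sections M A.
        br x (br y z) + br y (br z x) + br z (br x y) = 0) \<and>
    bundle_map M A (tangent_bundle M) a \<and>
    (\<forall>x\<in>sections M A. \<forall>y\<in>sections M A. \<forall>f. smooth_fun M UNIV f \<longrightarrow>
        br x (fmult f y) = fmult f (br x y) + fmult (anchor_deriv a x f) y)"

definition representation_on ::
    "('m::{t2_space,second_countable_topology}, 'b::euclidean_space) manifold
      \<Rightarrow> ('m, 'a::real_vector) vbundle
      \<Rightarrow> (('m \<Rightarrow> 'a) \<Rightarrow> ('m \<Rightarrow> 'a) \<Rightarrow> 'm \<Rightarrow> 'a)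
      \<Rightarrow> ('m \<Rightarrow> 'a \<Rightarrow> ('m \<Rightarrow> real) \<Rightarrow> real)
      \<Rightarrow> ('m, 'e::real_vector) vbundle
      \<Rightarrow> (('m \<Rightarrow> 'a) \<Rightarrow> ('m \<Rightarrow> 'e) \<Rightarrow> 'm \<Rightarrow> 'e) \<Rightarrow> bool" where
  "representation_on M A br a E \<rho> \<longleftrightarrow>
    vector_bundle M E \<and>
    (\<forall>x\<in>sections M A. \<forall>u\<in>sections M E. \<rho> x u \<in> sections M E) \<and>
    (\<forall>x\<in>sections M A. \<forall>u\<in>sections M E. \<forall>v\<in>sections M E. \<rho> x (u + v) = \<rho> x u + \<rho> x v) \<and>
    (\<forall>c. \<forall>x\<in>sections M A. \<forall>u\<in>sections M E. \<rho> x (c *\<^sub>R u) = c *\<^sub>R \<rho> x u) \<and>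
    (\<forall>x\<in>sections M A. \<forall>y\<in>sections M A. \<forall>u\<in>sections M E. \<rho> (x + y) u = \<rho> x u + \<rho> y u) \<and>
    (\<forall>x\<in>sections M A. \<forall>u\<in>sections M E. \<forall>f. smooth_fun M UNIV f \<longrightarrow>
        \<rho> (fmult f x) u = fmult f (\<rho> x u)) \<and>
    (\<forall>x\<in>sections M A. \<forall>u\<in>sections M E. \<forall>f. smooth_fun M UNIV f \<longrightarrow>
        \<rho> x (fmult f u) = fmult f (\<rho> x u) + fmult (anchor_deriv a x f) u) \<and>
    (\<forall>x\<in>sections M A. \<forall>y\<in>sections M A. \<forall>u\<in>sections M E.
        \<rho> (br x y) u = \<rho> x (\<rho> y u) - \<rho> y (\<rho> x u))"

definition lie_rep_pair ::
    "('m::{t2_space,second_countable_topology}, 'b::euclidean_space, 'a::real_vector, 'e::real_vector)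
      lie_rep \<Rightarrow> bool" where
  "lie_rep_pair L \<longleftrightarrow>
    smooth_manifold (base L) \<and>
    lie_algebroid (base L) (algd L) (bracket L) (anchor L) \<and>
    representation_on (base L) (algd L) (bracket L) (anchor L) (repb L) (rho L)"

abbreviation sections_A where "sections_A L \<equiv> sections (base L) (algd L)"
abbreviation sections_E where "sections_E L \<equiv> sections (base L) (repb L)"

definition relative_rota_baxter ::
    "('m::{t2_space,second_countable_topology}, 'b::euclidean_space, 'a::real_vector, 'e::real_vector)
      lie_rep \<Rightarrow> ('m \<Rightarrow> 'e \<Rightarrow> 'a) \<Rightarrow> bool" where
  "relative_rota_baxter L T \<longleftrightarrow>
    bundle_map (base L) (repb L) (algd L) T \<and>
    (\<forall>u\<in>sections_E L. \<forall>v\<in>sections_E L.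
        bracket L (app_sect T u) (app_sect T v) =
        app_sect T (rho L (app_sect T u) v - rho L (app_sect T v) u))"


section \<open>Cochains and the graded Lie bracket\<close>

text \<open>
  Smooth sections of \<open>Hom(\<Lambda>\<^sup>kE, A)\<close>: the value at a point \<open>x\<close> is an alternating
  \<open>k\<close>-linear map \<open>p x\<close> on the fibre of \<open>E\<close>, applied to lists of length \<open>k\<close>.
\<close>

definition hom_sections ::
    "('m::{t2_space,second_countable_topology}, 'b::euclidean_space) manifold
      \<Rightarrow> nat \<Rightarrow> ('m, 'e::real_vector) vbundle \<Rightarrow> ('m, 'a::real_vector) vbundle
      \<Rightarrow> ('m \<Rightarrow> 'e list \<Rightarrow> 'a) set" where
  "hom_sections M k E A =
    {p. (\<forall>x es. length es = k \<and> set es \<subseteq> fibre E x \<longrightarrow>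
          p x es \<in> fibre A x \<and>
          (\<forall>i<k. \<forall>e\<in>fibre E x. \<forall>e'\<in>fibre E x.
             p x (es[i := e + e']) = p x (es[i := e]) + p x (es[i := e'])) \<and>
          (\<forall>i<k. \<forall>c. \<forall>e\<in>fibre E x. p x (es[i := c *\<^sub>R e]) = c *\<^sub>R p x (es[i := e])) \<and>
          (\<forall>i j. i < j \<and> j < k \<and> es ! i = es ! j \<longrightarrow> p x es = 0)) \<and>
        (\<forall>(U, b)\<in>frames E. \<forall>js. length js = k \<and> set js \<subseteq> {..<rank E} \<longrightarrow>
          smooth_section_on M A U (\<lambda>x. p x (map (\<lambda>j. b j x) js)))}"

text \<open>
  A section \<open>p\<close> of \<open>Hom(\<Lambda>\<^sup>kE, A)\<close> as an operation \<open>(u\<^sub>1, \<dots>, u\<^sub>k) \<mapsto> p(u\<^sub>1, \<dots>, u\<^sub>k)\<close>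
  on \<open>k\<close>-tuples of smooth sections of \<open>E\<close>, extended by \<open>0\<close> to all other lists, so that
  equal cochains are equal functions.
\<close>

definition on_sections ::
    "('m::{t2_space,second_countable_topology}, 'b::euclidean_space, 'a::real_vector, 'e::real_vector)
      lie_rep \<Rightarrow> nat \<Rightarrow> ('m \<Rightarrow> 'e list \<Rightarrow> 'a) \<Rightarrow> ('m \<Rightarrow> 'e) list \<Rightarrow> 'm \<Rightarrow> 'a" where
  "on_sections L k p us =
    (if length us = k \<and> set us \<subseteq> sections_E L then (\<lambda>x. p x (map (\<lambda>u. u x) us)) else 0)"

text \<open>\<open>\<C>\<^sup>k(E, A)\<close>\<close>

definition cochains ::
    "('m::{t2_space,second_countable_topology}, 'b::euclidean_space, 'a::real_vector, 'e::real_vector)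
      lie_rep \<Rightarrow> nat \<Rightarrow> (('m \<Rightarrow> 'e) list \<Rightarrow> 'm \<Rightarrow> 'a) set" where
  "cochains L k = on_sections L k ` hom_sections (base L) k (repb L) (algd L)"

text \<open>A bundle map \<open>E \<rightarrow> A\<close> as an element of \<open>\<C>\<^sup>1(E, A)\<close>\<close>

definition cochain1 ::
    "('m::{t2_space,second_countable_topology}, 'b::euclidean_space, 'a::real_vector, 'e::real_vector)
      lie_rep \<Rightarrow> ('m \<Rightarrow> 'e \<Rightarrow> 'a) \<Rightarrow> ('m \<Rightarrow> 'e) list \<Rightarrow> 'm \<Rightarrow> 'a" where
  "cochain1 L T = on_sections L 1 (\<lambda>x es. T x (hd es))"

text \<open>
  \<open>unshuffles [i\<^sub>1, \<dots>, i\<^sub>k]\<close>; permutations act on \<open>{0, \<dots>, i\<^sub>1 + \<dots> + i\<^sub>k - 1}\<close>.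
\<close>

definition unshuffles :: "nat list \<Rightarrow> (nat \<Rightarrow> nat) set" where
  "unshuffles is =
    {\<sigma>. \<sigma> permutes {..<sum_list is} \<and>
        (\<forall>l<length is. strict_mono_on {sum_list (take l is)..<sum_list (take (Suc l) is)} \<sigma>)}"

text \<open>The arguments \<open>u\<^sub>\<sigma>\<^sub>(\<^sub>i\<^sub>)\<close> with \<open>a \<le> i < b\<close>, indices starting at \<open>0\<close>.\<close>

definition pick :: "'u list \<Rightarrow> (nat \<Rightarrow> nat) \<Rightarrow> nat \<Rightarrow> nat \<Rightarrow> 'u list" where
  "pick us \<sigma> a b = map (\<lambda>i. us ! \<sigma> i) [a..<b]"

text \<open>
  \<open>\<lbrakk>P, Q\<rbrakk>\<close> for \<open>P \<in> \<C>\<^sup>n(E, A)\<close> and \<open>Q \<in> \<C>\<^sup>m(E, A)\<close>. The conditionals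
  implement the convention that a sum involving a block of length \<open>-1\<close> is zero.
\<close>

definition gbracket ::
    "('m::{t2_space,second_countable_topology}, 'b::euclidean_space, 'a::real_vector, 'e::real_vector)
      lie_rep \<Rightarrow> nat \<Rightarrow> nat
      \<Rightarrow> (('m \<Rightarrow> 'e) list \<Rightarrow> 'm \<Rightarrow> 'a) \<Rightarrow> (('m \<Rightarrow> 'e) list \<Rightarrow> 'm \<Rightarrow> 'a)
      \<Rightarrow> ('m \<Rightarrow> 'e) list \<Rightarrow> 'm \<Rightarrow> 'a" where
  "gbracket L n m P Q us =
    (if length us = m + n \<and> set us \<subseteq> sections_E L then
      (if n = 0 then 0 else
        (\<Sum>\<sigma>\<in>unshuffles [m, 1, n - 1]. of_int (sign \<sigma>) *\<^sub>R
          P (rho L (Q (pick us \<sigma> 0 m)) (us ! \<sigma> m) # pick us \<sigma> (m + 1) (m + n))))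
      - (-1) ^ (m * n) *\<^sub>R
      (if m = 0 then 0 else
        (\<Sum>\<sigma>\<in>unshuffles [n, 1, m - 1]. of_int (sign \<sigma>) *\<^sub>R
          Q (rho L (P (pick us \<sigma> 0 n)) (us ! \<sigma> n) # pick us \<sigma> (n + 1) (m + n))))
      + (-1) ^ (m * n) *\<^sub>R
        (\<Sum>\<sigma>\<in>unshuffles [n, m]. of_int (sign \<sigma>) *\<^sub>R
          bracket L (P (pick us \<sigma> 0 n)) (Q (pick us \<sigma> n (m + n))))
     else 0)"


section \<open>Cohomology of a relative Rota--Baxter operator\<close>

text \<open>\<open>d\<^sub>T\<close> on \<open>\<C>\<^sup>k(E, A)\<close>\<close>

definition dT ::
    "('m::{t2_space,second_countable_topology}, 'b::euclidean_space, 'a::real_vector, 'e::real_vector)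
      lie_rep \<Rightarrow> ('m \<Rightarrow> 'e \<Rightarrow> 'a) \<Rightarrow> nat
      \<Rightarrow> (('m \<Rightarrow> 'e) list \<Rightarrow> 'm \<Rightarrow> 'a) \<Rightarrow> ('m \<Rightarrow> 'e) list \<Rightarrow> 'm \<Rightarrow> 'a" where
  "dT L T k P = (-1) ^ k *\<^sub>R gbracket L 1 k (cochain1 L T) P"

definition cocycles ::
    "('m::{t2_space,second_countable_topology}, 'b::euclidean_space, 'a::real_vector, 'e::real_vector)
      lie_rep \<Rightarrow> ('m \<Rightarrow> 'e \<Rightarrow> 'a) \<Rightarrow> nat \<Rightarrow> (('m \<Rightarrow> 'e) list \<Rightarrow> 'm \<Rightarrow> 'a) set" where
  "cocycles L T k = {P \<in> cochains L k. dT L T k P = 0}"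

definition coboundaries ::
    "('m::{t2_space,second_countable_topology}, 'b::euclidean_space, 'a::real_vector, 'e::real_vector)
      lie_rep \<Rightarrow> ('m \<Rightarrow> 'e \<Rightarrow> 'a) \<Rightarrow> nat \<Rightarrow> (('m \<Rightarrow> 'e) list \<Rightarrow> 'm \<Rightarrow> 'a) set" where
  "coboundaries L T k = (if k = 0 then {0} else dT L T (k - 1) ` cochains L (k - 1))"

definition coh_class ::
    "('m::{t2_space,second_countable_topology}, 'b::euclidean_space, 'a::real_vector, 'e::real_vector)
      lie_rep \<Rightarrow> ('m \<Rightarrow> 'e \<Rightarrow> 'a) \<Rightarrow> nat
      \<Rightarrow> (('m \<Rightarrow> 'e) list \<Rightarrow> 'm \<Rightarrow> 'a) \<Rightarrow> (('m \<Rightarrow> 'e) list \<Rightarrow> 'm \<Rightarrow> 'a) set" where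
  "coh_class L T k P = {P + B | B. B \<in> coboundaries L T k}"

text \<open>\<open>\<H>\<^sup>k\<^sub>T(E, A)\<close>; its zero element is \<open>coh_class L T k 0\<close>.\<close>

definition cohomology ::
    "('m::{t2_space,second_countable_topology}, 'b::euclidean_space, 'a::real_vector, 'e::real_vector)
      lie_rep \<Rightarrow> ('m \<Rightarrow> 'e \<Rightarrow> 'a) \<Rightarrow> nat \<Rightarrow> (('m \<Rightarrow> 'e) list \<Rightarrow> 'm \<Rightarrow> 'a) set set" where
  "cohomology L T k = coh_class L T k ` cocycles L T k"


section \<open>Formal deformations\<close>

text \<open>
  A formal power series with coefficients in some vector space is the sequence of its coefficients;
  \<open>formal_ext\<close> is the \<open>\<real>[[t]]\<close>-bilinear extension of a bilinear operation. A series of bundle maps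
  acts on a series of sections through the extension of \<open>app_sect\<close>.
\<close>

definition formal_ext ::
    "('x \<Rightarrow> 'y \<Rightarrow> 'z::comm_monoid_add) \<Rightarrow> (nat \<Rightarrow> 'x) \<Rightarrow> (nat \<Rightarrow> 'y) \<Rightarrow> nat \<Rightarrow> 'z" where
  "formal_ext B x y = (\<lambda>k. \<Sum>i\<le>k. B (x i) (y (k - i)))"

text \<open>The polynomial with coefficients \<open>\<T> 0, \<dots>, \<T> n\<close>\<close>

definition trunc :: "nat \<Rightarrow> (nat \<Rightarrow> 'x::zero) \<Rightarrow> nat \<Rightarrow> 'x" where
  "trunc n \<T> = (\<lambda>i. if i \<le> n then \<T> i else 0)"

text \<open>
  \<open>\<Sum>\<^sub>i\<^sub>\<le>\<^sub>n \<T>\<^sub>i t\<^sup>i\<close> is an order \<open>n\<close> deformation of \<open>T\<close>. Equality modulo \<open>t\<^sup>n\<^sup>+\<^sup>1\<close> is equality of the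
  coefficients of \<open>t\<^sup>k\<close> for \<open>k \<le> n\<close>. Values \<open>\<T> i\<close> with \<open>i > n\<close> are ignored.
\<close>

definition deformation ::
    "('m::{t2_space,second_countable_topology}, 'b::euclidean_space, 'a::real_vector, 'e::real_vector)
      lie_rep \<Rightarrow> ('m \<Rightarrow> 'e \<Rightarrow> 'a) \<Rightarrow> nat \<Rightarrow> (nat \<Rightarrow> 'm \<Rightarrow> 'e \<Rightarrow> 'a) \<Rightarrow> bool" where
  "deformation L T n \<T> \<longleftrightarrow>
    \<T> 0 = T \<and>
    (\<forall>i\<le>n. bundle_map (base L) (repb L) (algd L) (\<T> i)) \<and>
    (let Tt = formal_ext app_sect (trunc n \<T>);
         brt = formal_ext (bracket L);
         rhot = formal_ext (rho L)
     in \<forall>u v. (\<forall>j. u j \<in> sections_E L) \<and> (\<forall>j. v j \<in> sections_E L) \<longrightarrow>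
          (\<forall>k\<le>n. brt (Tt u) (Tt v) k = Tt (rhot (Tt u) v - rhot (Tt v) u) k))"

definition extendable ::
    "('m::{t2_space,second_countable_topology}, 'b::euclidean_space, 'a::real_vector, 'e::real_vector)
      lie_rep \<Rightarrow> ('m \<Rightarrow> 'e \<Rightarrow> 'a) \<Rightarrow> nat \<Rightarrow> (nat \<Rightarrow> 'm \<Rightarrow> 'e \<Rightarrow> 'a) \<Rightarrow> bool" where
  "extendable L T n \<T> \<longleftrightarrow>
    (\<exists>S. bundle_map (base L) (repb L) (algd L) S \<and> deformation L T (n + 1) (\<T>(n + 1 := S)))"

end

theory Submission
  imports Defs
begin

text \<open>
  On bundle maps \<open>P\<close>, \<open>Q\<close>, \<open>R\<close> the graded Jacobi identity reads
  \<open>\<lbrakk>P, \<lbrakk>Q, R\<rbrakk>\<rbrakk> + \<lbrakk>Q, \<lbrakk>R, P\<rbrakk>\<rbrakk> + \<lbrakk>R, \<lbrakk>P, Q\<rbrakk>\<rbrakk> = 0\<close>. Comparing coefficients, \<open>\<T>\<close> is an order \<open>n\<close> deformation iff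
  \<open>\<Sum>\<^sub>i\<^sub>+\<^sub>j\<^sub>=\<^sub>m \<lbrakk>\<T>\<^sub>i, \<T>\<^sub>j\<rbrakk> = 0\<close> for all \<open>m \<le> n\<close>. Put \<open>\<T>\<^sub>n\<^sub>+\<^sub>1 = 0\<close>. By the Jacobi identity the sum of
  \<open>\<lbrakk>\<T>\<^sub>i, \<lbrakk>\<T>\<^sub>j, \<T>\<^sub>k\<rbrakk>\<rbrakk>\<close> over \<open>i + j + k = n + 1\<close> vanishes; the terms with \<open>i \<ge> 1\<close> add up to zero, and those with
  \<open>i = 0\<close> give \<open>2 \<lbrakk>T, \<Theta>\<rbrakk>\<close>. Moreover \<open>S\<close> extends the deformation iff \<open>2 \<Theta> + 2 \<lbrakk>T, S\<rbrakk> = 0\<close>, i.e. \<open>\<Theta> = d\<^sub>T S\<close>.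

  That \<open>\<Theta>\<close> is a section of \<open>Hom(\<Lambda>\<^sup>2E, A)\<close> and not just an operation on sections follows from its
  \<open>C\<^sup>\<infinity>(M)\<close>-bilinearity by means of bump functions.
\<close>

section \<open>Smooth functions on Euclidean space\<close>

text \<open>A cochain is by definition induced by a smooth field of alternating maps on the fibres,
  whereas the bracket is given only on global sections. Recovering the field behind
  \<open>\<Theta>\<close> needs enough global sections: local frames have to be cut off, so a bump
  function is built from exp(-1/t), and its smoothness is checked against the derivative families in
  \<open>smooth_on\<close>. Bilinearity over functions holds because the Leibniz terms of bracket
  and representation cancel in the bracket of two bundle maps. The rest uses real linearity only and
  is done for abstract operators. The Rota-Baxter identity of a series is quadratic; its
  coefficients are sums of a polarised defect whose symmetrisation is minus the bracket, whence a
  factor -2 between the two systems of equations. The Jacobi identity is a cyclic sum, so it yields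
  three times the sum over \<open>i + j + k = n + 1\<close>. The sign \<open>(-1)^k\<close> of the
  differential is -1 on 1-cochains and 1 on 2-cochains; this is why \<open>\<Theta>\<close> equals
  the differential of \<open>S\<close> without a sign. Classes are cosets, so triviality also needs
  that coboundaries are closed under sums and negatives.\<close>

lemma smooth_on_derivative:
  assumes "smooth_on S f"
  obtains f' where "\<And>x. x \<in> S \<Longrightarrow> (f has_derivative f' x) (at x within S)"
    and "\<And>v. smooth_on S (\<lambda>x. f' x v)"
proof -
  from assms obtain D where D0: "\<And>x. x \<in> S \<Longrightarrow> D [] x = f x"
    and D: "\<And>vs x. x \<in> S \<Longrightarrow> (D vs has_derivative (\<lambda>v. D (v # vs) x)) (at x within S)"
    unfolding smooth_on_def by blast
  show thesis
  proof
    show "(f has_derivative (\<lambda>v. D [v] x)) (at x within S)" if "x \<in> S" for x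
      by (rule has_derivative_transform[OF that _ D[OF that, of "[]"]]) (simp add: D0)
    \<comment> \<open>The last entry of the list is the direction taken first, so the family of the
      derivative along \<open>v\<close> arises by appending \<open>[v]\<close> at the end.\<close>
    show "smooth_on S (\<lambda>x. D [v] x)" for v
      unfolding smooth_on_def
    proof (intro exI[of _ "\<lambda>vs. D (vs @ [v])"] conjI allI ballI)
      fix vs x assume "x \<in> S"
      then show "(D (vs @ [v]) has_derivative (\<lambda>w. D ((w # vs) @ [v]) x)) (at x within S)"
        using D[of x "vs @ [v]"] by simp
    qed simp
  qed
qed

text \<open>Iterating a choice of derivative never leaves \<open>F\<close>, and recursion over the
  list of directions assembles these choices into the family that \<open>smooth_on\<close> asks for.
  A choice is made because derivatives within \<open>S\<close> need not be unique.\<close>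

lemma smooth_on_coinduct:
  assumes "f \<in> F"
    and step: "\<And>g. g \<in> F \<Longrightarrow> \<exists>g'. (\<forall>x\<in>S. (g has_derivative g' x) (at x within S)) \<and>
      (\<forall>v. (\<lambda>x. g' x v) \<in> F)"
  shows "smooth_on S f"
proof -
  define d where "d g = (SOME g'. (\<forall>x\<in>S. (g has_derivative g' x) (at x within S)) \<and>
      (\<forall>v. (\<lambda>x. g' x v) \<in> F))" for g
  have d: "(\<forall>x\<in>S. (g has_derivative d g x) (at x within S)) \<and> (\<forall>v. (\<lambda>x. d g x v) \<in> F)"
    if "g \<in> F" for g
    unfolding d_def by (rule someI_ex[OF step[OF that]])
  define D where "D = rec_list f (\<lambda>v _ g x. d g x v)"
  have D_simps: "D [] = f" "D (v # vs) = (\<lambda>x. d (D vs) x v)" for v vs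
    by (simp_all add: D_def)
  have DF: "D vs \<in> F" for vs
    by (induction vs) (simp_all add: D_simps assms(1) d)
  show ?thesis
    unfolding smooth_on_def
  proof (intro exI[of _ D] conjI allI ballI)
    fix vs x assume "x \<in> S"
    then show "(D vs has_derivative (\<lambda>v. D (v # vs) x)) (at x within S)"
      using d[of "D vs"] DF[of vs] by (simp add: D_simps)
  qed (simp add: D_simps)
qed

lemma smooth_on_subset:
  assumes "smooth_on S f" "S' \<subseteq> S"
  shows "smooth_on S' f"
proof -
  from assms(1) obtain D where "\<And>x. x \<in> S \<Longrightarrow> D [] x = f x"
    "\<And>vs x. x \<in> S \<Longrightarrow> (D vs has_derivative (\<lambda>v. D (v # vs) x)) (at x within S)"
    unfolding smooth_on_def by blast
  with assms(2) show ?thesis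
    unfolding smooth_on_def by (intro exI[of _ D]) (blast intro: has_derivative_subset)
qed

lemma smooth_on_cong:
  assumes "smooth_on S f" "\<And>x. x \<in> S \<Longrightarrow> f x = g x"
  shows "smooth_on S g"
  using assms unfolding smooth_on_def by metis

lemma smooth_on_const [simp]: "smooth_on S (\<lambda>x. c)"
proof (rule smooth_on_coinduct[of _ "range (\<lambda>c x. c)"])
  fix g :: "'a \<Rightarrow> 'b" assume "g \<in> range (\<lambda>c x. c)"
  then show "\<exists>g'. (\<forall>x\<in>S. (g has_derivative g' x) (at x within S)) \<and>
      (\<forall>v. (\<lambda>x. g' x v) \<in> range (\<lambda>c x. c))"
    by (intro exI[of _ "\<lambda>x v. 0"]) (auto intro: derivative_eq_intros)
qed simp

text \<open>Transition maps are vector valued, while the closure properties below concern real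
  functions; components mediate between the two. Derivatives commute with
  \<open>\<bullet> c\<close>, so the components of smooth functions form a set closed under
  directional derivatives.\<close>

lemma smooth_on_inner_const:
  fixes f :: "'b::euclidean_space \<Rightarrow> 'c::real_inner"
  assumes "smooth_on S f"
  shows "smooth_on S (\<lambda>x. f x \<bullet> c)"
proof (rule smooth_on_coinduct[of _ "{\<lambda>x. f x \<bullet> c | f. smooth_on S f}"])
  fix g :: "'b \<Rightarrow> real" assume "g \<in> {\<lambda>x. (f::'b \<Rightarrow> 'c) x \<bullet> c | f. smooth_on S f}"
  then obtain f :: "'b \<Rightarrow> 'c" where g: "g = (\<lambda>x. f x \<bullet> c)" and "smooth_on S f" by blast
  then obtain f' where f': "\<And>x. x \<in> S \<Longrightarrow> (f has_derivative f' x) (at x within S)"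
    "\<And>v. smooth_on S (\<lambda>x. f' x v)" using smooth_on_derivative by blast
  show "\<exists>g'. (\<forall>x\<in>S. (g has_derivative g' x) (at x within S)) \<and>
      (\<forall>v. (\<lambda>x. g' x v) \<in> {\<lambda>x. (f::'b \<Rightarrow> 'c) x \<bullet> c | f. smooth_on S f})"
    unfolding g using f'
    by (intro exI[of _ "\<lambda>x v. f' x v \<bullet> c"]) (auto intro!: has_derivative_inner_left)
qed (use assms in blast)

text \<open>\<open>flat_exp 0\<close> is the classical flat function exp(-1/t). Powers of 1/t appear
  on differentiation; carrying them along makes the linear span of the family closed under
  derivatives.\<close>

definition flat_exp :: "nat \<Rightarrow> real \<Rightarrow> real" where
  "flat_exp j t = (if t > 0 then inverse t ^ j * exp (- inverse t) else 0)"

lemma flat_exp_pos: "t > 0 \<Longrightarrow> flat_exp j t > 0"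
  by (simp add: flat_exp_def)

lemma flat_exp_nonpos: "t \<le> 0 \<Longrightarrow> flat_exp j t = 0"
  by (simp add: flat_exp_def)

text \<open>With x = 1/t this says that the exponential outgrows every power.\<close>

lemma flat_exp_tendsto_0: "(flat_exp j \<longlongrightarrow> 0) (at_right 0)"
proof -
  have "((\<lambda>x::real. x ^ j / exp x) \<longlongrightarrow> 0) at_top" by (rule tendsto_power_div_exp_0)
  then have "((\<lambda>t::real. inverse t ^ j / exp (inverse t)) \<longlongrightarrow> 0) (at_right 0)"
    by (rule filterlim_compose[OF _ filterlim_inverse_at_top_right])
  moreover have "\<forall>\<^sub>F t in at_right (0::real). inverse t ^ j / exp (inverse t) = flat_exp j t"
    using eventually_at_right_less by eventually_elim (simp add: flat_exp_def exp_minus divide_inverse)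
  ultimately show ?thesis by (rule Lim_transform_eventually)
qed

lemma has_field_derivative_flat_exp [derivative_intros]:
  "(flat_exp j has_field_derivative flat_exp (j + 2) t - j * flat_exp (j + 1) t) (at t)"
proof -
  consider "t > 0" | "t < 0" | "t = 0" by linarith
  then show ?thesis
  proof cases
    case 1
    have "((\<lambda>t. inverse t ^ j * exp (- inverse t)) has_field_derivative
        flat_exp (j + 2) t - j * flat_exp (j + 1) t) (at t)"
    proof (rule DERIV_cong)
      show "((\<lambda>t. inverse t ^ j * exp (- inverse t)) has_field_derivative
          real j * inverse t ^ (j - 1) * - (inverse t * inverse t) * exp (- inverse t) +
          inverse t ^ j * (exp (- inverse t) * (inverse t * inverse t))) (at t)"
        using 1 by (auto intro!: derivative_eq_intros simp: power2_eq_square)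
      show "real j * inverse t ^ (j - 1) * - (inverse t * inverse t) * exp (- inverse t) +
          inverse t ^ j * (exp (- inverse t) * (inverse t * inverse t)) =
          flat_exp (j + 2) t - j * flat_exp (j + 1) t"
        using 1 by (cases j) (simp_all add: flat_exp_def algebra_simps)
    qed
    then show ?thesis
      by (rule has_field_derivative_transform_within_open[of _ _ _ "{0<..}"])
        (use 1 in \<open>auto simp: flat_exp_def\<close>)
  next
    case 2
    have "((\<lambda>t. 0) has_field_derivative flat_exp (j + 2) t - j * flat_exp (j + 1) t) (at t)"
      using 2 by (auto intro!: derivative_eq_intros simp: flat_exp_nonpos)
    then show ?thesis
      by (rule has_field_derivative_transform_within_open[of _ _ _ "{..<0}"])
        (use 2 in \<open>auto simp: flat_exp_def\<close>)
  next
    case 3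
    \<comment> \<open>For h > 0 the difference quotient at 0 is \<open>flat_exp (j + 1) h\<close>,
      which tends to 0; for h < 0 it is 0.\<close>
    have "((\<lambda>h. flat_exp j h / h) \<longlongrightarrow> 0) (at_right 0)"
      by (rule Lim_transform_eventually[OF flat_exp_tendsto_0[of "j + 1"]], 
         use eventually_at_right_less in eventually_elim)
        (simp add: flat_exp_def divide_inverse)
    moreover have "((\<lambda>h. flat_exp j h / h) \<longlongrightarrow> 0) (at_left 0)"
      by (rule Lim_transform_eventually[OF tendsto_const], rule eventually_at_leftI[of "-1"])
        (auto simp: flat_exp_def)
    ultimately have "((\<lambda>h. flat_exp j h / h) \<longlongrightarrow> 0) (at 0)"
      by (simp add: filterlim_split_at)
    then show ?thesis
      using 3 by (simp add: DERIV_def flat_exp_nonpos)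
  qed
qed

text \<open>Closed under directional derivatives, hence all its members are smooth by coinduction.\<close>

inductive smooth_gen :: "'b::euclidean_space set \<Rightarrow> ('b \<Rightarrow> real) \<Rightarrow> bool" for S where
  base: "smooth_on S f \<Longrightarrow> smooth_gen S f"
| add: "smooth_gen S f \<Longrightarrow> smooth_gen S g \<Longrightarrow> smooth_gen S (\<lambda>x. f x + g x)"
| mult: "smooth_gen S f \<Longrightarrow> smooth_gen S g \<Longrightarrow> smooth_gen S (\<lambda>x. f x * g x)"
| inverse: "smooth_gen S f \<Longrightarrow> (\<And>x. x \<in> S \<Longrightarrow> f x \<noteq> 0) \<Longrightarrow> smooth_gen S (\<lambda>x. inverse (f x))"
| flat_exp: "smooth_gen S f \<Longrightarrow> smooth_gen S (\<lambda>x. flat_exp j (f x))"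

lemma smooth_gen_const: "smooth_gen S (\<lambda>x. c)"
  by (rule smooth_gen.base) simp

text \<open>The derivative of a product, an inverse or a composite with \<open>flat_exp\<close>
  mixes several of the operations; closing under all of them at once is what lets the induction go
  through.\<close>

lemma smooth_gen_derivative:
  assumes "smooth_gen S f"
  shows "\<exists>f'. (\<forall>x\<in>S. (f has_derivative f' x) (at x within S)) \<and> (\<forall>v. smooth_gen S (\<lambda>x. f' x v))"
  using assms
proof induction
  case (base f)
  then show ?case using smooth_on_derivative smooth_gen.base by metis
next
  case (add f g)
  then obtain f' g' where "\<forall>x\<in>S. (f has_derivative f' x) (at x within S)" "\<forall>v. smooth_gen S (\<lambda>x. f' x v)"
    "\<forall>x\<in>S. (g has_derivative g' x) (at x within S)" "\<forall>v. smooth_gen S (\<lambda>x. g' x v)" by blast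
  then show ?case
    by (intro exI[of _ "\<lambda>x v. f' x v + g' x v"])
      (auto intro!: has_derivative_add smooth_gen.add)
next
  case (mult f g)
  then obtain f' g' where "\<forall>x\<in>S. (f has_derivative f' x) (at x within S)" "\<forall>v. smooth_gen S (\<lambda>x. f' x v)"
    "\<forall>x\<in>S. (g has_derivative g' x) (at x within S)" "\<forall>v. smooth_gen S (\<lambda>x. g' x v)" by blast
  with mult.hyps show ?case
    by (intro exI[of _ "\<lambda>x v. f x * g' x v + f' x v * g x"])
      (auto intro!: has_derivative_mult smooth_gen.add smooth_gen.mult)
next
  case (inverse f)
  then obtain f' where "\<forall>x\<in>S. (f has_derivative f' x) (at x within S)" "\<forall>v. smooth_gen S (\<lambda>x. f' x v)"
    by blast
  note f' = this
  show ?case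
  \<comment> \<open>\<open>smooth_gen\<close> has no rule for negatives, so the sign is written as a
    constant factor.\<close>
  proof (intro exI[of _ "\<lambda>x v. (-1) * (inverse (f x) * f' x v * inverse (f x))"] conjI ballI allI)
    show "((\<lambda>x. inverse (f x)) has_derivative (\<lambda>v. (-1) * (inverse (f x) * f' x v * inverse (f x))))
        (at x within S)" if "x \<in> S" for x
      using has_derivative_inverse[where f = f and x = x and f' = "f' x" and S = S] f' inverse.hyps that by simp
    show "smooth_gen S (\<lambda>x. (-1) * (inverse (f x) * f' x v * inverse (f x)))" for v
      using f' inverse.hyps
      by (intro smooth_gen.mult[of S "\<lambda>x. -1"] smooth_gen.mult smooth_gen.inverse smooth_gen_const) auto
  qed
next
  case (flat_exp f j)
  then obtain f' where f': "\<forall>x\<in>S. (f has_derivative f' x) (at x within S)" "\<forall>v. smooth_gen S (\<lambda>x. f' x v)"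
    by blast
  have "((\<lambda>x. flat_exp j (f x)) has_derivative
      (\<lambda>v. (flat_exp (j + 2) (f x) + (- real j) * flat_exp (j + 1) (f x)) * f' x v)) (at x within S)"
    if "x \<in> S" for x
  proof -
    have "(f has_derivative f' x) (at x within S)" using f' that by blast
    from has_derivative_compose[OF this has_field_derivative_imp_has_derivative[OF has_field_derivative_flat_exp]]
    show ?thesis by (rule has_derivative_eq_rhs) (simp add: fun_eq_iff algebra_simps)
  qed
  with f' flat_exp.hyps show ?case
    by (intro exI[of _ "\<lambda>x v. (flat_exp (j + 2) (f x) + (- real j) * flat_exp (j + 1) (f x)) * f' x v"]
        conjI ballI allI smooth_gen.mult smooth_gen.add smooth_gen.flat_exp smooth_gen_const) blast+
qed

lemma smooth_gen_imp_smooth_on: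
  assumes "smooth_gen S f"
  shows "smooth_on S f"
proof (rule smooth_on_coinduct)
  show "f \<in> Collect (smooth_gen S)" using assms by simp
  show "\<exists>g'. (\<forall>x\<in>S. (g has_derivative g' x) (at x within S)) \<and>
      (\<forall>v. (\<lambda>x. g' x v) \<in> Collect (smooth_gen S))" if "g \<in> Collect (smooth_gen S)" for g
    using smooth_gen_derivative that by simp
qed

lemma smooth_on_add:
  fixes f g :: "'b::euclidean_space \<Rightarrow> real"
  shows "smooth_on S f \<Longrightarrow> smooth_on S g \<Longrightarrow> smooth_on S (\<lambda>x. f x + g x)"
  by (rule smooth_gen_imp_smooth_on[OF smooth_gen.add[OF smooth_gen.base smooth_gen.base]])

lemma smooth_on_mult:
  fixes f g :: "'b::euclidean_space \<Rightarrow> real"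
  shows "smooth_on S f \<Longrightarrow> smooth_on S g \<Longrightarrow> smooth_on S (\<lambda>x. f x * g x)"
  by (rule smooth_gen_imp_smooth_on[OF smooth_gen.mult[OF smooth_gen.base smooth_gen.base]])

lemma smooth_on_inverse:
  fixes f :: "'b::euclidean_space \<Rightarrow> real"
  shows "smooth_on S f \<Longrightarrow> (\<And>x. x \<in> S \<Longrightarrow> f x \<noteq> 0) \<Longrightarrow> smooth_on S (\<lambda>x. inverse (f x))"
  by (rule smooth_gen_imp_smooth_on[OF smooth_gen.inverse[OF smooth_gen.base]])

lemma smooth_on_flat_exp:
  fixes f :: "'b::euclidean_space \<Rightarrow> real"
  shows "smooth_on S f \<Longrightarrow> smooth_on S (\<lambda>x. flat_exp j (f x))"
  by (rule smooth_gen_imp_smooth_on[OF smooth_gen.flat_exp[OF smooth_gen.base]])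

lemma smooth_on_sum:
  fixes f :: "'i \<Rightarrow> 'b::euclidean_space \<Rightarrow> real"
  shows "(\<And>i. i \<in> I \<Longrightarrow> smooth_on S (f i)) \<Longrightarrow> smooth_on S (\<lambda>x. \<Sum>i\<in>I. f i x)"
  by (induction I rule: infinite_finite_induct) (simp_all add: smooth_on_add)

text \<open>
  Derivatives within a relatively open subset of a subspace \<open>V\<close> are only determined along \<open>V\<close>;
  composing with a linear projection onto \<open>V\<close> makes a canonical choice.
\<close>

lemma ex_projection:
  fixes V :: "'b::euclidean_space set"
  assumes "subspace V"
  obtains p :: "'b \<Rightarrow> 'b" where "linear p" "\<And>v. p v \<in> V" "\<And>v. v \<in> V \<Longrightarrow> p v = v"
proof -
  obtain B where B: "B \<subseteq> V" "independent B" "V \<subseteq> span B"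
    using basis_exists[of V] by metis
  obtain p where p: "range p \<subseteq> span B" "\<forall>x\<in>B. p x = x" "linear p"
    using linear_independent_extend_subspace[OF B(2), of "\<lambda>x. x"]
    by (metis image_ident order_refl)
  have "span B = V" using B assms by (metis span_minimal subset_antisym)
  moreover have "p v = v" if "v \<in> span B" for v
    using linear_eq_on[OF p(3) linear_id[unfolded id_def] that] p(2) by simp
  ultimately show thesis using that p by blast
qed

text \<open>For small t the line x + t v stays in \<open>S\<close>. Along it both derivatives become
  derivatives of one function of a real variable at an interior point, and these are unique.\<close>

lemma has_derivative_along_unique:
  fixes f :: "'b::euclidean_space \<Rightarrow> 'c::real_normed_vector"
  assumes V: "subspace V" "openin (top_of_set V) S" and x: "x \<in> S" and v: "v \<in> V"
    and f: "(f has_derivative f') (at x within S)" "(f has_derivative f'') (at x within S)"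
  shows "f' v = f'' v"
proof -
  obtain e where e: "e > 0" "\<And>y. y \<in> V \<Longrightarrow> dist y x < e \<Longrightarrow> y \<in> S"
    using V(2) x unfolding openin_euclidean_subtopology_iff by blast
  have xV: "x \<in> V" using V(2) x openin_imp_subset by blast
  \<comment> \<open>The summand 1 covers \<open>v = 0\<close> and keeps the distance bound
    strict.\<close>
  define r where "r = e / (norm v + 1)"
  have r: "r > 0" using e by (simp add: r_def add_nonneg_pos)
  have line: "x + t *\<^sub>R v \<in> S" if "t \<in> {-r<..<r}" for t
  proof (rule e(2))
    show "x + t *\<^sub>R v \<in> V" using V(1) xV v by (simp add: subspace_add subspace_scale)
    have "dist (x + t *\<^sub>R v) x = \<bar>t\<bar> * norm v" by (simp add: dist_norm)
    also have "\<dots> \<le> \<bar>t\<bar> * (norm v + 1)" by (simp add: mult_left_mono)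
    also have "\<dots> < r * (norm v + 1)" using that
      by (intro mult_strict_right_mono) (auto simp: add_nonneg_pos)
    also have "\<dots> = e" by (simp add: r_def add_nonneg_eq_0_iff)
    finally show "dist (x + t *\<^sub>R v) x < e" .
  qed
  have *: "((\<lambda>t. f (x + t *\<^sub>R v)) has_derivative (\<lambda>t. g (t *\<^sub>R v))) (at 0)"
    if "(f has_derivative g) (at x within S)" for g
  proof -
    have "((\<lambda>t. x + t *\<^sub>R v) has_derivative (\<lambda>t. t *\<^sub>R v)) (at 0 within {-r<..<r})"
      by (auto intro!: derivative_eq_intros)
    moreover have "(\<lambda>t. x + t *\<^sub>R v) ` {-r<..<r} \<subseteq> S" using line by blast
    then have "(f has_derivative g) (at (x + 0 *\<^sub>R v) within (\<lambda>t. x + t *\<^sub>R v) ` {-r<..<r})"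
      using has_derivative_subset[OF that] by simp
    ultimately have "((\<lambda>t. f (x + t *\<^sub>R v)) has_derivative (\<lambda>t. g (t *\<^sub>R v))) (at 0 within {-r<..<r})"
      using has_derivative_in_compose by blast
    then show ?thesis using r by (simp add: at_within_open[of 0 "{-r<..<r}"])
  qed
  from has_derivative_unique[OF *[OF f(1)] *[OF f(2)]] show ?thesis
    by (metis scaleR_one)
qed


text \<open>Every point brings its own derivative family. Two such families agree on the overlap,
  but only for directions in \<open>V\<close>; with directions projected to \<open>V\<close> they
  can be glued.\<close>

lemma smooth_on_local:
  fixes f :: "'b::euclidean_space \<Rightarrow> 'c::real_normed_vector"
  assumes V: "subspace V" "openin (top_of_set V) S"
    and loc: "\<And>x. x \<in> S \<Longrightarrow> \<exists>N. open N \<and> x \<in> N \<and> smooth_on (S \<inter> N) f"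
  shows "smooth_on S f"
proof -
  from ex_projection[OF V(1)] obtain p where p: "linear p" "\<And>v. p v \<in> V" "\<And>v. v \<in> V \<Longrightarrow> p v = v"
    by blast
  have SV: "S \<subseteq> V" using V(2) openin_imp_subset by blast
  have "\<forall>x\<in>S. \<exists>N. open N \<and> x \<in> N \<and> (\<exists>D. (\<forall>y\<in>S \<inter> N. D [] y = f y) \<and>
      (\<forall>vs. \<forall>y\<in>S \<inter> N. (D vs has_derivative (\<lambda>v. D (v # vs) y)) (at y within S \<inter> N)))"
    using loc unfolding smooth_on_def by blast
  then obtain N where N: "\<forall>x\<in>S. open (N x) \<and> x \<in> N x \<and> (\<exists>D. (\<forall>y\<in>S \<inter> N x. D [] y = f y) \<and>
      (\<forall>vs. \<forall>y\<in>S \<inter> N x. (D vs has_derivative (\<lambda>v. D (v # vs) y)) (at y within S \<inter> N x)))"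
    by (rule bchoice[THEN exE])
  then obtain D where "\<forall>x\<in>S. (\<forall>y\<in>S \<inter> N x. D x [] y = f y) \<and>
      (\<forall>vs. \<forall>y\<in>S \<inter> N x. (D x vs has_derivative (\<lambda>v. D x (v # vs) y)) (at y within S \<inter> N x))"
    using bchoice[of S "\<lambda>x D. (\<forall>y\<in>S \<inter> N x. D [] y = f y) \<and>
      (\<forall>vs. \<forall>y\<in>S \<inter> N x. (D vs has_derivative (\<lambda>v. D (v # vs) y)) (at y within S \<inter> N x))"] by blast
  then have D0: "\<And>x y. x \<in> S \<Longrightarrow> y \<in> S \<Longrightarrow> y \<in> N x \<Longrightarrow> D x [] y = f y"
    and D: "\<And>x y vs. x \<in> S \<Longrightarrow> y \<in> S \<Longrightarrow> y \<in> N x \<Longrightarrow>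
      (D x vs has_derivative (\<lambda>v. D x (v # vs) y)) (at y within S \<inter> N x)"
    by auto
  have N: "open (N x)" "x \<in> N x" if "x \<in> S" for x using N that by blast+
  \<comment> \<open>By induction on the list: functions that agree on the relatively open overlap
    have equal derivatives along \<open>V\<close>.\<close>
  have indep: "D x vs z = D y vs z"
    if "x \<in> S" "y \<in> S" "z \<in> S" "z \<in> N x" "z \<in> N y" "set vs \<subseteq> V" for x y z vs
    using that(3-6)
  proof (induction vs arbitrary: z)
    case Nil
    then show ?case using D0 that by simp
  next
    case (Cons v vs)
    let ?S = "S \<inter> (N x \<inter> N y)"
    have z: "z \<in> ?S" using Cons by simp
    have "openin (top_of_set V) ?S"
      using V(2) N that by (intro openin_Int_open open_Int)
    moreover have "(D x vs has_derivative (\<lambda>v. D x (v # vs) z)) (at z within ?S)"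
      by (rule has_derivative_subset[OF D]) (use that Cons in auto)
    moreover have "(D x vs has_derivative (\<lambda>v. D y (v # vs) z)) (at z within ?S)"
    proof (rule has_derivative_transform[OF z])
      show "(D y vs has_derivative (\<lambda>v. D y (v # vs) z)) (at z within ?S)"
        by (rule has_derivative_subset[OF D]) (use that Cons in auto)
    qed (use Cons in simp)
    ultimately show ?case
      using has_derivative_along_unique[OF V(1) _ z, of v] Cons.prems by simp
  qed
  \<comment> \<open>At the point \<open>x\<close> the glued family is the one chosen for
    \<open>x\<close> itself, applied to the projected directions.\<close>
  show ?thesis
    unfolding smooth_on_def
  proof (intro exI[of _ "\<lambda>vs x. D x (map p vs) x"] conjI ballI allI)
    fix x assume "x \<in> S"
    then show "D x (map p []) x = f x" using D0 N by simp
  next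
    fix vs x assume x: "x \<in> S"
    let ?S = "S \<inter> N x"
    have xS: "x \<in> ?S" using x N by simp
    \<comment> \<open>Composing with \<open>p\<close>, which is the identity on \<open>S\<close>,
      turns the derivative in direction \<open>v\<close> into the one in direction
      \<open>p v\<close>, as the glued family demands.\<close>
    have "((\<lambda>y. D x (map p vs) (p y)) has_derivative (\<lambda>v. D x (p v # map p vs) x)) (at x within ?S)"
    proof (rule has_derivative_in_compose[where f = p and f' = p])
      show "(p has_derivative p) (at x within ?S)"
        using p(1) by (rule linear_imp_has_derivative)
      have "p ` ?S = ?S" "p x = x" using SV p(3) x by force+
      then show "(D x (map p vs) has_derivative (\<lambda>v. D x (v # map p vs) x)) (at (p x) within p ` ?S)"
        using D x xS by simp
    qed
    then have "((\<lambda>y. D y (map p vs) y) has_derivative (\<lambda>v. D x (p v # map p vs) x)) (at x within ?S)"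
    proof (rule has_derivative_transform[OF xS, rotated])
      fix y assume y: "y \<in> ?S"
      then have "p y = y" using SV p(3) by blast
      then show "D y (map p vs) y = D x (map p vs) (p y)"
        using indep[of y x y "map p vs"] y x N p(2) by auto
    qed
    then show "((\<lambda>y. D y (map p vs) y) has_derivative (\<lambda>v. D x (map p (v # vs)) x)) (at x within S)"
      using at_within_nhd[of x "N x" S ?S] N[OF x] by auto
  qed
qed

section \<open>Smooth functions and sections on manifolds\<close>

locale smooth_mfd =
  fixes M :: "('m::{t2_space,second_countable_topology}, 'b::euclidean_space) manifold"
  assumes smooth_manifold: "smooth_manifold M"
begin

lemma subspace_model: "subspace (model M)"
  using smooth_manifold unfolding smooth_manifold_def by blast

lemma ex_chart: obtains U \<phi> where "(U, \<phi>) \<in> charts M" "x \<in> U"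
proof -
  have "x \<in> (\<Union>(U, \<phi>)\<in>charts M. U)"
    using smooth_manifold unfolding smooth_manifold_def by simp
  then show thesis using that by auto
qed

lemma
  assumes "(U, \<phi>) \<in> charts M"
  shows open_chart: "open U"
    and openin_chart_image: "openin (top_of_set (model M)) (\<phi> ` U)"
    and homeomorphism_chart: "homeomorphism U (\<phi> ` U) \<phi> (inv_into U \<phi>)"
  using assms smooth_manifold unfolding smooth_manifold_def by blast+

lemma smooth_on_transition:
  assumes "(U, \<phi>) \<in> charts M" "(U', \<phi>') \<in> charts M"
  shows "smooth_on (\<phi> ` (U \<inter> U')) (\<phi>' \<circ> inv_into U \<phi>)"
  using assms smooth_manifold unfolding smooth_manifold_def by blast

lemma inv_chart: "(U, \<phi>) \<in> charts M \<Longrightarrow> x \<in> U \<Longrightarrow> inv_into U \<phi> (\<phi> x) = x"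
  using homeomorphism_chart homeomorphism_apply1 by fastforce

lemma openin_chart_image_Int:
  assumes "(U, \<phi>) \<in> charts M" "open W"
  shows "openin (top_of_set (model M)) (\<phi> ` (U \<inter> W))"
proof -
  have "openin (top_of_set (\<phi> ` U)) (\<phi> ` (U \<inter> W))"
    using homeomorphism_imp_open_map[OF homeomorphism_chart[OF assms(1)]] assms(2)
    by (simp add: openin_open_Int)
  then show ?thesis using openin_chart_image[OF assms(1)] openin_trans by blast
qed

lemma smooth_funI:
  assumes "\<And>U \<phi>. (U, \<phi>) \<in> charts M \<Longrightarrow> smooth_on (\<phi> ` (U \<inter> W)) (\<lambda>y. f (inv_into U \<phi> y))"
  shows "smooth_fun M W f"
  using assms unfolding smooth_fun_def comp_def by blast

lemma smooth_funD:
  assumes "smooth_fun M W f" "(U, \<phi>) \<in> charts M"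
  shows "smooth_on (\<phi> ` (U \<inter> W)) (\<lambda>y. f (inv_into U \<phi> y))"
  using assms unfolding smooth_fun_def comp_def by blast

lemma smooth_fun_subset: "smooth_fun M W f \<Longrightarrow> W' \<subseteq> W \<Longrightarrow> smooth_fun M W' f"
  by (rule smooth_funI, rule smooth_on_subset[OF smooth_funD]) blast+

lemma smooth_fun_cong:
  assumes "smooth_fun M W f" "\<And>x. x \<in> W \<Longrightarrow> f x = g x"
  shows "smooth_fun M W g"
proof (rule smooth_funI)
  fix U \<phi> assume c: "(U, \<phi>) \<in> charts M"
  show "smooth_on (\<phi> ` (U \<inter> W)) (\<lambda>y. g (inv_into U \<phi> y))"
    by (rule smooth_on_cong[OF smooth_funD[OF assms(1) c]]) (auto simp: inv_chart[OF c] assms(2))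
qed

lemma smooth_fun_const [simp]: "smooth_fun M W (\<lambda>x. c)"
  by (rule smooth_funI) simp

lemma smooth_fun_add:
  "smooth_fun M W f \<Longrightarrow> smooth_fun M W g \<Longrightarrow> smooth_fun M W (\<lambda>x. f x + g x)"
  by (rule smooth_funI) (simp add: smooth_on_add smooth_funD)

lemma smooth_fun_mult:
  "smooth_fun M W f \<Longrightarrow> smooth_fun M W g \<Longrightarrow> smooth_fun M W (\<lambda>x. f x * g x)"
  by (rule smooth_funI) (simp add: smooth_on_mult smooth_funD)

lemma smooth_fun_inverse:
  assumes "smooth_fun M W f" "\<And>x. x \<in> W \<Longrightarrow> f x \<noteq> 0"
  shows "smooth_fun M W (\<lambda>x. inverse (f x))"
proof (rule smooth_funI)
  fix U \<phi> assume c: "(U, \<phi>) \<in> charts M"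
  show "smooth_on (\<phi> ` (U \<inter> W)) (\<lambda>y. inverse (f (inv_into U \<phi> y)))"
    by (rule smooth_on_inverse[OF smooth_funD[OF assms(1) c]]) (auto simp: inv_chart[OF c] assms(2))
qed

lemma smooth_fun_local:
  assumes "open W" and loc: "\<And>x. x \<in> W \<Longrightarrow> \<exists>N. open N \<and> x \<in> N \<and> smooth_fun M (W \<inter> N) f"
  shows "smooth_fun M W f"
proof (rule smooth_funI)
  fix U \<phi> assume c: "(U, \<phi>) \<in> charts M"
  have oW: "openin (top_of_set (model M)) (\<phi> ` (U \<inter> W))"
    by (rule openin_chart_image_Int[OF c assms(1)])
  show "smooth_on (\<phi> ` (U \<inter> W)) (\<lambda>y. f (inv_into U \<phi> y))"
  proof (rule smooth_on_local[OF subspace_model oW])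
    fix y assume "y \<in> \<phi> ` (U \<inter> W)"
    then obtain x where x: "x \<in> U" "x \<in> W" "y = \<phi> x" by blast
    obtain N where N: "open N" "x \<in> N" "smooth_fun M (W \<inter> N) f" using loc x by blast
    \<comment> \<open>\<open>smooth_on_local\<close> localises by open sets of the ambient space, so
      the relatively open image of \<open>W \<inter> N\<close> is written as the trace of such a
      set.\<close>
    obtain O' where O': "open O'" "\<phi> ` (U \<inter> (W \<inter> N)) = model M \<inter> O'"
      using openin_chart_image_Int[OF c open_Int[OF assms(1) N(1)]] unfolding openin_open by blast
    have "\<phi> ` (U \<inter> W) \<inter> O' \<subseteq> \<phi> ` (U \<inter> (W \<inter> N))"
      using O' openin_imp_subset[OF oW] by blast
    then have "smooth_on (\<phi> ` (U \<inter> W) \<inter> O') (\<lambda>y. f (inv_into U \<phi> y))"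
      by (rule smooth_on_subset[OF smooth_funD[OF N(3) c]])
    moreover have "y \<in> O'" using O'(2) x N(2) by blast
    ultimately show "\<exists>N. open N \<and> y \<in> N \<and>
        smooth_on (\<phi> ` (U \<inter> W) \<inter> N) (\<lambda>y. f (inv_into U \<phi> y))"
      using O'(1) by blast
  qed
qed

text \<open>In a chart, \<open>\<beta>\<close> is \<open>flat_exp 0\<close> of r^2 minus the squared
  distance from \<open>\<phi> x\<close>; off the chart it is 0. The later arguments divide by
  \<open>\<beta>\<close>, so non-vanishing on \<open>N\<close> serves as well as the value 1, and
  the closed set \<open>K\<close> permits extension by zero.\<close>

lemma ex_bump:
  assumes "open W" "x \<in> W"
  obtains \<beta> K N where "smooth_fun M UNIV \<beta>" "closed K" "K \<subseteq> W" "\<forall>y. y \<notin> K \<longrightarrow> \<beta> y = 0"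
    "open N" "x \<in> N" "\<forall>y\<in>N. \<beta> y \<noteq> 0"
proof -
  obtain U \<phi> where c: "(U, \<phi>) \<in> charts M" and xU: "x \<in> U" by (rule ex_chart)
  have hom: "homeomorphism U (\<phi> ` U) \<phi> (inv_into U \<phi>)" by (rule homeomorphism_chart[OF c])
  note openin_chart_image_Int[OF c assms(1)]
  then obtain e where e: "e > 0" "\<And>y. y \<in> model M \<Longrightarrow> dist y (\<phi> x) < e \<Longrightarrow> y \<in> \<phi> ` (U \<inter> W)"
    unfolding openin_euclidean_subtopology_iff using xU assms(2) by blast
  \<comment> \<open>Half of \<open>e\<close>, so that also the closed ball of radius
    \<open>r\<close> meets the model space inside the chart image of \<open>W\<close>.\<close>
  define r where "r = e / 2"
  define C where "C = cball (\<phi> x) r \<inter> model M"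
  define \<beta> where "\<beta> y = (if y \<in> U then flat_exp 0 (r * r - (norm (\<phi> y - \<phi> x))\<^sup>2) else 0)" for y
  define N where "N = U \<inter> \<phi> -` ball (\<phi> x) r"
  have r: "r > 0" "r < e" using e(1) by (simp_all add: r_def)
  have C: "C \<subseteq> \<phi> ` (U \<inter> W)"
    using e(2) r by (auto simp: C_def dist_commute)
  have "compact C"
    unfolding C_def using closed_subspace[OF subspace_model] by (intro compact_Int_closed compact_cball)
  moreover have "continuous_on C (inv_into U \<phi>)"
    using homeomorphism_cont2[OF hom] C by (rule continuous_on_subset[OF _ order_trans]) blast
  \<comment> \<open>Compact sets are closed because the manifold is Hausdorff.\<close>
  ultimately have K: "closed (inv_into U \<phi> ` C)"
    by (intro compact_imp_closed compact_continuous_image)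
  have KW: "inv_into U \<phi> ` C \<subseteq> U \<inter> W" using C inv_chart[OF c] by fastforce
  have model: "\<phi> y \<in> model M" if "y \<in> U" for y
    using openin_imp_subset[OF openin_chart_image[OF c]] that by blast
  have zero: "\<beta> y = 0" if "y \<notin> inv_into U \<phi> ` C" for y
  proof (cases "y \<in> U")
    case True
    with that model inv_chart[OF c True] have "\<phi> y \<notin> C" by (metis image_eqI)
    with model True have "r < norm (\<phi> y - \<phi> x)" by (simp add: C_def dist_norm norm_minus_commute)
    then have "r * r \<le> (norm (\<phi> y - \<phi> x))\<^sup>2"
      using r by (simp add: power2_eq_square mult_mono)
    then show ?thesis by (simp add: \<beta>_def flat_exp_nonpos)
  qed (simp add: \<beta>_def)
  \<comment> \<open>As a polynomial in the coordinates the squared norm is covered by the rules for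
    sums and products.\<close>
  have norm_sq: "(norm w)\<^sup>2 = (\<Sum>i\<in>Basis. (w \<bullet> i) * (w \<bullet> i))" for w :: 'b
    unfolding power2_norm_eq_inner by (rule euclidean_inner)
  show thesis
  proof (rule that[of \<beta> "inv_into U \<phi> ` C" N])
    show "smooth_fun M UNIV \<beta>"
    proof (rule smooth_fun_local)
      fix y :: 'm
      \<comment> \<open>The chart domain and the complement of the compact set cover the manifold;
        \<open>\<beta>\<close> is a composite of smooth maps on the first and 0 on the
        second.\<close>
      show "\<exists>N. open N \<and> y \<in> N \<and> smooth_fun M (UNIV \<inter> N) \<beta>"
      proof (cases "y \<in> U")
        case True
        have "smooth_fun M U \<beta>"
        proof (rule smooth_funI)
          fix U' \<phi>' assume c': "(U', \<phi>') \<in> charts M"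
          let ?g = "\<lambda>z. (\<phi> \<circ> inv_into U' \<phi>') z"
          have g: "smooth_on (\<phi>' ` (U' \<inter> U)) (\<lambda>z. ?g z \<bullet> i)" for i
            by (rule smooth_on_inner_const[OF smooth_on_transition[OF c' c]])
          have "smooth_on (\<phi>' ` (U' \<inter> U)) (\<lambda>z. flat_exp 0
              (r * r + (-1) * (\<Sum>i\<in>Basis. (?g z \<bullet> i + (- (\<phi> x \<bullet> i))) * (?g z \<bullet> i + (- (\<phi> x \<bullet> i))))))"
            by (intro smooth_on_flat_exp smooth_on_add smooth_on_mult[of _ "\<lambda>_. -1"]
              smooth_on_sum smooth_on_mult[of _ "\<lambda>z. ?g z \<bullet> i + c" for i c] g smooth_on_const)
          then show "smooth_on (\<phi>' ` (U' \<inter> U)) (\<lambda>z. \<beta> (inv_into U' \<phi>' z))"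
          proof (rule smooth_on_cong)
            fix z assume "z \<in> \<phi>' ` (U' \<inter> U)"
            then have "inv_into U' \<phi>' z \<in> U" using inv_chart[OF c'] by auto
            then show "flat_exp 0 (r * r + (-1) * (\<Sum>i\<in>Basis.
                (?g z \<bullet> i + (- (\<phi> x \<bullet> i))) * (?g z \<bullet> i + (- (\<phi> x \<bullet> i))))) = \<beta> (inv_into U' \<phi>' z)"
              using norm_sq[of "\<phi> (inv_into U' \<phi>' z) - \<phi> x"]
              by (simp add: \<beta>_def inner_diff_left)
          qed
        qed
        with True open_chart[OF c] show ?thesis by (intro exI[of _ U]) simp
      next
        case False
        with KW have "y \<in> - inv_into U \<phi> ` C" by blast
        moreover have "smooth_fun M (- inv_into U \<phi> ` C) \<beta>"
          by (rule smooth_fun_cong[OF smooth_fun_const[of _ 0]]) (simp add: zero)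
        ultimately show ?thesis using K by (intro exI[of _ "- inv_into U \<phi> ` C"]) (simp add: open_Compl)
      qed
    qed simp
    show "open N"
      unfolding N_def
      by (rule continuous_open_preimage[OF homeomorphism_cont1[OF hom] open_chart[OF c] open_ball])
    show "\<forall>y\<in>N. \<beta> y \<noteq> 0"
    proof
      fix y assume that: "y \<in> N"
      have "norm (\<phi> y - \<phi> x) < r" "y \<in> U" using that by (auto simp: N_def dist_norm norm_minus_commute)
      then have "(norm (\<phi> y - \<phi> x))\<^sup>2 < r * r"
        unfolding power2_eq_square using r(1) by (intro mult_strict_mono) auto
      with \<open>y \<in> U\<close> show "\<beta> y \<noteq> 0"
        using flat_exp_pos[of "r * r - (norm (\<phi> y - \<phi> x))\<^sup>2" 0] by (simp add: \<beta>_def)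
    qed
  qed (use K KW zero xU r in \<open>auto simp: N_def\<close>)
qed

end

section \<open>Local frames, sections and bundle maps\<close>

lemma sum_frame_unique:
  fixes b :: "nat \<Rightarrow> 'e::real_vector"
  assumes "inj_on b {..<r}" "independent (b ` {..<r})"
    and eq: "(\<Sum>i<r. g i *\<^sub>R b i) = (\<Sum>i<r. h i *\<^sub>R b i)" and i: "i < r"
  shows "g i = h i"
proof -
  let ?k = "\<lambda>v. g (inv_into {..<r} b v) - h (inv_into {..<r} b v)"
  have "(\<Sum>v\<in>b ` {..<r}. ?k v *\<^sub>R v) = (\<Sum>i<r. (g i - h i) *\<^sub>R b i)"
    using assms(1) by (simp add: sum.reindex)
  also have "\<dots> = 0" using eq by (simp add: scaleR_diff_left sum_subtractf)
  finally have "?k (b i) = 0"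
    using i by (intro independentD[OF assms(2)]) auto
  with assms(1) i show ?thesis by simp
qed

lemma sum_frame_exists:
  fixes b :: "nat \<Rightarrow> 'e::real_vector"
  assumes "inj_on b {..<r}" "v \<in> span (b ` {..<r})"
  obtains g where "v = (\<Sum>i<r. g i *\<^sub>R b i)"
proof -
  obtain u where "v = (\<Sum>w\<in>b ` {..<r}. u w *\<^sub>R w)"
    using assms(2) by (auto simp: span_finite)
  then show thesis using that[of "\<lambda>i. u (b i)"] assms(1) by (simp add: sum.reindex)
qed

lemma
  assumes "vector_bundle M E" "(U, b) \<in> frames E"
  shows open_frame: "open U"
    and inj_frame: "x \<in> U \<Longrightarrow> inj_on (\<lambda>i. b i x) {..<rank E}"
    and independent_frame: "x \<in> U \<Longrightarrow> independent ((\<lambda>i. b i x) ` {..<rank E})"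
    and span_frame: "x \<in> U \<Longrightarrow> span ((\<lambda>i. b i x) ` {..<rank E}) = fibre E x"
    and smooth_frame: "j < rank E \<Longrightarrow> smooth_section_on M E U (b j)"
  using assms unfolding vector_bundle_def by (auto 0 3)

lemma ex_frame:
  assumes "vector_bundle M E"
  obtains U b where "(U, b) \<in> frames E" "x \<in> U"
proof -
  have "x \<in> (\<Union>(U, b)\<in>frames E. U)"
    using assms unfolding vector_bundle_def by simp
  then show thesis using that by auto
qed

lemma subspace_fibre:
  assumes "vector_bundle M E"
  shows "subspace (fibre E x)"
proof -
  obtain U b where "(U, b) \<in> frames E" "x \<in> U" using ex_frame[OF assms] by blast
  from span_frame[OF assms this] show ?thesis by (metis subspace_span)
qed

lemma frame_in_fibre:
  assumes "vector_bundle M E" "(U, b) \<in> frames E" "x \<in> U" "i < rank E"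
  shows "b i x \<in> fibre E x"
proof -
  have "b i x \<in> span ((\<lambda>i. b i x) ` {..<rank E})"
    using assms(4) by (intro span_base) simp
  then show ?thesis using span_frame[OF assms(1-3)] by simp
qed

lemma smooth_section_onD_frame:
  assumes "smooth_section_on M E W s" "(U, b) \<in> frames E"
  obtains g where "\<And>i. i < rank E \<Longrightarrow> smooth_fun M (U \<inter> W) (g i)"
    "\<And>x. x \<in> U \<Longrightarrow> x \<in> W \<Longrightarrow> s x = (\<Sum>i<rank E. g i x *\<^sub>R b i x)"
  using assms unfolding smooth_section_on_def by blast

lemma smooth_section_on_fibre: "smooth_section_on M E W s \<Longrightarrow> x \<in> W \<Longrightarrow> s x \<in> fibre E x"
  unfolding smooth_section_on_def by blast

lemma smooth_section_onI:
  assumes "\<And>x. x \<in> W \<Longrightarrow> s x \<in> fibre E x"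
    and "\<And>U b. (U, b) \<in> frames E \<Longrightarrow> \<exists>g. (\<forall>i<rank E. smooth_fun M (U \<inter> W) (g i)) \<and>
      (\<forall>x\<in>U \<inter> W. s x = (\<Sum>i<rank E. g i x *\<^sub>R b i x))"
  shows "smooth_section_on M E W s"
  using assms unfolding smooth_section_on_def by blast

lemma smooth_section_on_cong:
  assumes "smooth_section_on M E W s" "\<And>x. x \<in> W \<Longrightarrow> s x = t x"
  shows "smooth_section_on M E W t"
proof (rule smooth_section_onI)
  show "t x \<in> fibre E x" if "x \<in> W" for x
    using smooth_section_on_fibre[OF assms(1) that] assms(2)[OF that] by simp
  fix U b assume "(U, b) \<in> frames E"
  then obtain g where "\<And>i. i < rank E \<Longrightarrow> smooth_fun M (U \<inter> W) (g i)"
    "\<And>x. x \<in> U \<Longrightarrow> x \<in> W \<Longrightarrow> s x = (\<Sum>i<rank E. g i x *\<^sub>R b i x)"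
    using smooth_section_onD_frame[OF assms(1)] by blast
  then show "\<exists>g. (\<forall>i<rank E. smooth_fun M (U \<inter> W) (g i)) \<and>
      (\<forall>x\<in>U \<inter> W. t x = (\<Sum>i<rank E. g i x *\<^sub>R b i x))"
    using assms(2) by (intro exI[of _ g]) auto
qed

context smooth_mfd
begin

lemma smooth_section_on_subset:
  assumes "smooth_section_on M E W s" "W' \<subseteq> W"
  shows "smooth_section_on M E W' s"
proof (rule smooth_section_onI)
  show "s x \<in> fibre E x" if "x \<in> W'" for x
    using assms that smooth_section_on_fibre by blast
  fix U b assume "(U, b) \<in> frames E"
  then obtain g where "\<And>i. i < rank E \<Longrightarrow> smooth_fun M (U \<inter> W) (g i)"
    "\<And>x. x \<in> U \<Longrightarrow> x \<in> W \<Longrightarrow> s x = (\<Sum>i<rank E. g i x *\<^sub>R b i x)"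
    using smooth_section_onD_frame[OF assms(1)] by blast
  then show "\<exists>g. (\<forall>i<rank E. smooth_fun M (U \<inter> W') (g i)) \<and>
      (\<forall>x\<in>U \<inter> W'. s x = (\<Sum>i<rank E. g i x *\<^sub>R b i x))"
    using assms(2) by (intro exI[of _ g]) (auto intro: smooth_fun_subset)
qed

lemma smooth_section_on_zero:
  assumes "vector_bundle M E"
  shows "smooth_section_on M E W (\<lambda>x. 0)"
  by (rule smooth_section_onI)
    (auto simp: subspace_0[OF subspace_fibre[OF assms]] intro!: exI[of _ "\<lambda>_ _. 0"])

lemma smooth_section_on_add:
  assumes E: "vector_bundle M E" and s: "smooth_section_on M E W s" and t: "smooth_section_on M E W t"
  shows "smooth_section_on M E W (\<lambda>x. s x + t x)"
proof (rule smooth_section_onI)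
  show "s x + t x \<in> fibre E x" if "x \<in> W" for x
    using subspace_fibre[OF E] s t that smooth_section_on_fibre by (blast intro: subspace_add)
  fix U b assume f: "(U, b) \<in> frames E"
  obtain g where "\<And>i. i < rank E \<Longrightarrow> smooth_fun M (U \<inter> W) (g i)"
    "\<And>x. x \<in> U \<Longrightarrow> x \<in> W \<Longrightarrow> s x = (\<Sum>i<rank E. g i x *\<^sub>R b i x)"
    using smooth_section_onD_frame[OF s f] by blast
  moreover obtain h where "\<And>i. i < rank E \<Longrightarrow> smooth_fun M (U \<inter> W) (h i)"
    "\<And>x. x \<in> U \<Longrightarrow> x \<in> W \<Longrightarrow> t x = (\<Sum>i<rank E. h i x *\<^sub>R b i x)"
    using smooth_section_onD_frame[OF t f] by blast
  ultimately show "\<exists>g. (\<forall>i<rank E. smooth_fun M (U \<inter> W) (g i)) \<and>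
      (\<forall>x\<in>U \<inter> W. s x + t x = (\<Sum>i<rank E. g i x *\<^sub>R b i x))"
    by (intro exI[of _ "\<lambda>i x. g i x + h i x"])
      (simp add: smooth_fun_add scaleR_add_left sum.distrib)
qed

lemma smooth_section_on_fmult:
  assumes E: "vector_bundle M E" and f: "smooth_fun M W f" and s: "smooth_section_on M E W s"
  shows "smooth_section_on M E W (\<lambda>x. f x *\<^sub>R s x)"
proof (rule smooth_section_onI)
  show "f x *\<^sub>R s x \<in> fibre E x" if "x \<in> W" for x
    using subspace_fibre[OF E] s that smooth_section_on_fibre by (blast intro: subspace_scale)
  fix U b assume fr: "(U, b) \<in> frames E"
  obtain g where "\<And>i. i < rank E \<Longrightarrow> smooth_fun M (U \<inter> W) (g i)"
    "\<And>x. x \<in> U \<Longrightarrow> x \<in> W \<Longrightarrow> s x = (\<Sum>i<rank E. g i x *\<^sub>R b i x)"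
    using smooth_section_onD_frame[OF s fr] by blast
  with smooth_fun_subset[OF f, of "U \<inter> W"]
  show "\<exists>g. (\<forall>i<rank E. smooth_fun M (U \<inter> W) (g i)) \<and>
      (\<forall>x\<in>U \<inter> W. f x *\<^sub>R s x = (\<Sum>i<rank E. g i x *\<^sub>R b i x))"
    by (intro exI[of _ "\<lambda>i x. f x * g i x"])
      (simp add: smooth_fun_mult scaleR_sum_right)
qed

lemma smooth_section_on_sum:
  assumes "vector_bundle M E" "\<And>i. i \<in> I \<Longrightarrow> smooth_section_on M E W (s i)"
  shows "smooth_section_on M E W (\<lambda>x. \<Sum>i\<in>I. s i x)"
  using assms(2)
  by (induction I rule: infinite_finite_induct)
    (simp_all add: smooth_section_on_zero[OF assms(1)] smooth_section_on_add[OF assms(1)])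

text \<open>Spanning gives frame coefficients at each point separately, and independence identifies
  them with the coefficients of any local expansion. Their smoothness is therefore a local question
  about functions.\<close>

lemma smooth_section_on_local:
  assumes E: "vector_bundle M E" and "open W"
    and loc: "\<And>x. x \<in> W \<Longrightarrow> \<exists>N. open N \<and> x \<in> N \<and> smooth_section_on M E (W \<inter> N) s"
  shows "smooth_section_on M E W s"
proof (rule smooth_section_onI)
  show fib: "s x \<in> fibre E x" if "x \<in> W" for x
    using loc[OF that] that smooth_section_on_fibre by blast
  fix U b assume fr: "(U, b) \<in> frames E"
  note frame_simps = inj_frame[OF E fr] independent_frame[OF E fr] span_frame[OF E fr]
  have "\<exists>c. s x = (\<Sum>i<rank E. c i *\<^sub>R b i x)" if "x \<in> U \<inter> W" for x
  proof -
    have "s x \<in> span ((\<lambda>i. b i x) ` {..<rank E})" using frame_simps(3)[of x] fib that by simp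
    with frame_simps(1)[of x] that show ?thesis
      using sum_frame_exists[of "\<lambda>i. b i x" "rank E" "s x"] by blast
  qed
  then obtain c where c: "\<And>x. x \<in> U \<inter> W \<Longrightarrow> s x = (\<Sum>i<rank E. c x i *\<^sub>R b i x)"
    by metis
  have "smooth_fun M (U \<inter> W) (\<lambda>x. c x i)" if i: "i < rank E" for i
  proof (rule smooth_fun_local)
    show "open (U \<inter> W)" using open_frame[OF E fr] \<open>open W\<close> by blast
    fix x assume x: "x \<in> U \<inter> W"
    obtain N where N: "open N" "x \<in> N" "smooth_section_on M E (W \<inter> N) s" using loc x by blast
    obtain g where g: "\<And>i. i < rank E \<Longrightarrow> smooth_fun M (U \<inter> (W \<inter> N)) (g i)"
      "\<And>x. x \<in> U \<Longrightarrow> x \<in> W \<inter> N \<Longrightarrow> s x = (\<Sum>i<rank E. g i x *\<^sub>R b i x)"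
      using smooth_section_onD_frame[OF N(3) fr] by blast
    have "smooth_fun M (U \<inter> (W \<inter> N)) (\<lambda>x. c x i)"
    proof (rule smooth_fun_cong[OF g(1)[OF i]])
      fix y assume y: "y \<in> U \<inter> (W \<inter> N)"
      then show "g i y = c y i"
        using sum_frame_unique[of "\<lambda>i. b i y" "rank E" "\<lambda>i. g i y" "c y" i] frame_simps c[of y] g(2)[of y] i
        by auto
    qed
    with N show "\<exists>N. open N \<and> x \<in> N \<and> smooth_fun M (U \<inter> W \<inter> N) (\<lambda>x. c x i)"
      by (intro exI[of _ N]) (simp add: Int_assoc)
  qed
  with c show "\<exists>g. (\<forall>i<rank E. smooth_fun M (U \<inter> W) (g i)) \<and>
      (\<forall>x\<in>U \<inter> W. s x = (\<Sum>i<rank E. g i x *\<^sub>R b i x))"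
    by (intro exI[of _ "\<lambda>i x. c x i"]) simp
qed

text \<open>Extension by zero: the product is smooth on \<open>U\<close> and on the complement of
  \<open>K\<close>, and these open sets cover the manifold. \<open>bump_section\<close> repeats this
  for sections.\<close>

lemma bump_smooth_fun:
  assumes "smooth_fun M UNIV \<beta>" "closed K" "K \<subseteq> U" "\<forall>y. y \<notin> K \<longrightarrow> \<beta> y = 0"
    and "open U" "smooth_fun M U g"
  shows "smooth_fun M UNIV (\<lambda>x. \<beta> x * g x)"
proof (rule smooth_fun_local)
  fix x :: 'm
  have "smooth_fun M U (\<lambda>x. \<beta> x * g x)"
    using assms by (intro smooth_fun_mult) (auto intro: smooth_fun_subset)
  moreover have "smooth_fun M (- K) (\<lambda>x. \<beta> x * g x)"
    by (rule smooth_fun_cong[OF smooth_fun_const[of _ 0]]) (simp add: assms(4))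
  moreover have "x \<in> U \<or> x \<in> - K" using assms(3) by blast
  ultimately show "\<exists>N. open N \<and> x \<in> N \<and> smooth_fun M (UNIV \<inter> N) (\<lambda>x. \<beta> x * g x)"
    using assms(2,5) open_Compl by (metis inf_top_left)
qed simp

lemma bump_section:
  assumes "smooth_fun M UNIV \<beta>" "closed K" "K \<subseteq> U" "\<forall>y. y \<notin> K \<longrightarrow> \<beta> y = 0"
    and E: "vector_bundle M E" and "open U" "smooth_section_on M E U s"
  shows "fmult \<beta> s \<in> sections M E"
  unfolding sections_def fmult_def mem_Collect_eq
proof (rule smooth_section_on_local[OF E])
  fix x :: 'm
  have "smooth_section_on M E U (\<lambda>x. \<beta> x *\<^sub>R s x)"
    using assms by (intro smooth_section_on_fmult) (auto intro: smooth_fun_subset)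
  moreover have "smooth_section_on M E (- K) (\<lambda>x. \<beta> x *\<^sub>R s x)"
    by (rule smooth_section_on_cong[OF smooth_section_on_zero[OF E]]) (simp add: assms(4))
  moreover have "x \<in> U \<or> x \<in> - K" using assms(3) by blast
  ultimately show "\<exists>N. open N \<and> x \<in> N \<and> smooth_section_on M E (UNIV \<inter> N) (\<lambda>x. \<beta> x *\<^sub>R s x)"
    using assms(2,6) open_Compl by (metis inf_top_left)
qed simp

end

lemma sum_fun_apply: "(\<Sum>i\<in>I. f i) x = (\<Sum>i\<in>I. f i x)"
  by (induction I rule: infinite_finite_induct) simp_all

context smooth_mfd
begin

lemma sections_fibre: "s \<in> sections M E \<Longrightarrow> s x \<in> fibre E x"
  unfolding sections_def using smooth_section_on_fibre by blast

lemma sections_smooth_section_on: "s \<in> sections M E \<Longrightarrow> smooth_section_on M E W s"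
  unfolding sections_def using smooth_section_on_subset by blast

lemma sections_fmult:
  "vector_bundle M E \<Longrightarrow> smooth_fun M UNIV f \<Longrightarrow> s \<in> sections M E \<Longrightarrow> fmult f s \<in> sections M E"
  unfolding sections_def fmult_def by (simp add: smooth_section_on_fmult)

lemma subspace_sections:
  assumes "vector_bundle M E"
  shows "subspace (sections M E)"
proof (rule subspaceI)
  show "0 \<in> sections M E"
    using smooth_section_on_zero[OF assms] by (simp add: sections_def zero_fun_def)
  show "s + t \<in> sections M E" if "s \<in> sections M E" "t \<in> sections M E" for s t
    using smooth_section_on_add[OF assms] that by (simp add: sections_def plus_fun_def)
  show "c *\<^sub>R s \<in> sections M E" if "s \<in> sections M E" for c s
    using smooth_section_on_fmult[OF assms smooth_fun_const] that
    by (simp add: sections_def scaleR_fun_def)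
qed

lemma ex_local_frame:
  assumes E: "vector_bundle M E"
  obtains U b \<beta> K N where "(U, b) \<in> frames E" "x \<in> U" "open U"
    "smooth_fun M UNIV \<beta>" "closed K" "K \<subseteq> U" "\<forall>y. y \<notin> K \<longrightarrow> \<beta> y = 0"
    "open N" "x \<in> N" "\<forall>y\<in>N. \<beta> y \<noteq> 0"
proof -
  obtain U b where f: "(U, b) \<in> frames E" "x \<in> U" using ex_frame[OF E] by blast
  obtain \<beta> K N where "smooth_fun M UNIV \<beta>" "closed K" "K \<subseteq> U" "\<forall>y. y \<notin> K \<longrightarrow> \<beta> y = 0"
    "open N" "x \<in> N" "\<forall>y\<in>N. \<beta> y \<noteq> 0"
    by (rule ex_bump[OF open_frame[OF E f(1)] f(2)])
  with f open_frame[OF E f(1)] show thesis by (intro that)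
qed

text \<open>Global sections reach every vector of every fibre, which allows identities between
  sections to be read off fibrewise.\<close>

lemma ex_section_through:
  assumes E: "vector_bundle M E" and e: "e \<in> fibre E x"
  obtains s where "s \<in> sections M E" "s x = e"
proof -
  obtain U b \<beta> K N where f: "(U, b) \<in> frames E" "x \<in> U" "open U"
    and \<beta>: "smooth_fun M UNIV \<beta>" "closed K" "K \<subseteq> U" "\<forall>y. y \<notin> K \<longrightarrow> \<beta> y = 0"
    and N: "open N" "x \<in> N" "\<forall>y\<in>N. \<beta> y \<noteq> 0"
    by (rule ex_local_frame[OF E, where x = x])
  have "e \<in> span ((\<lambda>i. b i x) ` {..<rank E})" using span_frame[OF E f(1,2)] e by simp
  then obtain c where c: "e = (\<Sum>i<rank E. c i *\<^sub>R b i x)"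
    using sum_frame_exists[OF inj_frame[OF E f(1,2)]] by blast
  \<comment> \<open>The factor \<open>1 / \<beta> x\<close> undoes the cut-off at the single point
    \<open>x\<close>.\<close>
  let ?s = "\<lambda>y. \<Sum>i<rank E. (c i / \<beta> x) *\<^sub>R b i y"
  have "smooth_section_on M E U ?s"
    using smooth_frame[OF E f(1)]
    by (intro smooth_section_on_sum[OF E] smooth_section_on_fmult[OF E]) auto
  from bump_section[OF \<beta> E f(3) this] have "fmult \<beta> ?s \<in> sections M E" .
  moreover have "fmult \<beta> ?s x = e"
    using N by (simp add: fmult_def c scaleR_sum_right)
  ultimately show thesis by (rule that)
qed

end

lemma bundle_map_sum:
  assumes P: "bundle_map M E F P" and E: "vector_bundle M E" and F: "vector_bundle M F"
    and e: "\<And>i. i \<in> I \<Longrightarrow> e i \<in> fibre E x"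
  shows "P x (\<Sum>i\<in>I. c i *\<^sub>R e i) = (\<Sum>i\<in>I. c i *\<^sub>R P x (e i))"
proof -
  have zero: "P x 0 = 0"
  proof -
    have "P x (0 *\<^sub>R 0) = 0 *\<^sub>R P x 0"
      using P subspace_0[OF subspace_fibre[OF E]] unfolding bundle_map_def by metis
    then show ?thesis by simp
  qed
  show ?thesis
    using e
  proof (induction I rule: infinite_finite_induct)
    case (insert i I)
    have "c i *\<^sub>R e i \<in> fibre E x" "(\<Sum>i\<in>I. c i *\<^sub>R e i) \<in> fibre E x"
      using insert.prems subspace_fibre[OF E]
      by (auto intro!: subspace_sum subspace_scale)
    then have "P x (c i *\<^sub>R e i + (\<Sum>i\<in>I. c i *\<^sub>R e i)) = P x (c i *\<^sub>R e i) + P x (\<Sum>i\<in>I. c i *\<^sub>R e i)"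
      using P unfolding bundle_map_def by blast
    moreover have "P x (c i *\<^sub>R e i) = c i *\<^sub>R P x (e i)"
      using P insert.prems unfolding bundle_map_def by blast
    ultimately show ?case using insert by simp
  qed (simp_all add: zero)
qed

context smooth_mfd
begin

text \<open>Smoothness of a bundle map is imposed on frames only. Over a frame the image of
  \<open>u\<close> combines the images of the frame with the smooth coefficients of
  \<open>u\<close>.\<close>

lemma app_sect_section:
  assumes P: "bundle_map M E F P" and E: "vector_bundle M E" and F: "vector_bundle M F"
    and u: "u \<in> sections M E"
  shows "app_sect P u \<in> sections M F"
  unfolding sections_def mem_Collect_eq
proof (rule smooth_section_on_local[OF F])
  fix x
  obtain U b where f: "(U, b) \<in> frames E" "x \<in> U" using ex_frame[OF E] by blast
  obtain g where g: "\<And>i. i < rank E \<Longrightarrow> smooth_fun M (U \<inter> UNIV) (g i)"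
    "\<And>x. x \<in> U \<Longrightarrow> x \<in> UNIV \<Longrightarrow> u x = (\<Sum>i<rank E. g i x *\<^sub>R b i x)"
    using smooth_section_onD_frame[OF sections_smooth_section_on[OF u] f(1)] by blast
  have Pb: "smooth_section_on M F U (\<lambda>y. P y (b i y))" if "i < rank E" for i
    using P f(1) that unfolding bundle_map_def by fast
  have "smooth_section_on M F U (\<lambda>y. \<Sum>i<rank E. g i y *\<^sub>R P y (b i y))"
    using g(1) Pb by (intro smooth_section_on_sum[OF F] smooth_section_on_fmult[OF F]) simp_all
  then have "smooth_section_on M F U (app_sect P u)"
  proof (rule smooth_section_on_cong)
    fix y assume "y \<in> U"
    then show "(\<Sum>i<rank E. g i y *\<^sub>R P y (b i y)) = app_sect P u y"
      using bundle_map_sum[OF P E F, of "{..<rank E}" "\<lambda>i. b i y" y "\<lambda>i. g i y"]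
        frame_in_fibre[OF E f(1)] g(2) by (simp add: app_sect_def)
  qed
  with f open_frame[OF E f(1)] show "\<exists>N. open N \<and> x \<in> N \<and> smooth_section_on M F (UNIV \<inter> N) (app_sect P u)"
    by (intro exI[of _ U]) simp
qed simp

end

section \<open>Operations on sections that are induced by fields on the fibres\<close>

definition tensorial2 ::
    "('m::{t2_space,second_countable_topology}, 'b::euclidean_space) manifold
      \<Rightarrow> ('m, 'e::real_vector) vbundle \<Rightarrow> ('m, 'a::real_vector) vbundle
      \<Rightarrow> (('m \<Rightarrow> 'e) \<Rightarrow> ('m \<Rightarrow> 'e) \<Rightarrow> 'm \<Rightarrow> 'a) \<Rightarrow> bool" where
  "tensorial2 M E F B \<longleftrightarrow>
    (\<forall>u\<in>sections M E. \<forall>v\<in>sections M E.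
      B u v \<in> sections M F \<and> B u v = - B v u \<and>
      (\<forall>u'\<in>sections M E. B (u + u') v = B u v + B u' v) \<and>
      (\<forall>f. smooth_fun M UNIV f \<longrightarrow> B (fmult f u) v = fmult f (B u v)))"

locale alternating_form = smooth_mfd M
  for M :: "('m::{t2_space,second_countable_topology}, 'b::euclidean_space) manifold"
    and E :: "('m, 'e::real_vector) vbundle" and F :: "('m, 'a::real_vector) vbundle"
    and B :: "('m \<Rightarrow> 'e) \<Rightarrow> ('m \<Rightarrow> 'e) \<Rightarrow> 'm \<Rightarrow> 'a" +
  assumes E: "vector_bundle M E" and F: "vector_bundle M F"
    and tensorial2: "tensorial2 M E F B"
begin

lemma
  assumes "u \<in> sections M E" "v \<in> sections M E"
  shows B_section: "B u v \<in> sections M F"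
    and B_swap: "B u v = - B v u"
    and B_add: "u' \<in> sections M E \<Longrightarrow> B (u + u') v = B u v + B u' v"
    and B_fmult: "smooth_fun M UNIV f \<Longrightarrow> B (fmult f u) v = fmult f (B u v)"
  using assms tensorial2 unfolding tensorial2_def by blast+

text \<open>Real scalars are constant functions, which is why \<open>tensorial2\<close> has no
  separate clause for them.\<close>

lemma B_scaleR:
  assumes "u \<in> sections M E" "v \<in> sections M E"
  shows "B (c *\<^sub>R u) v = c *\<^sub>R B u v"
  using B_fmult[OF assms smooth_fun_const, of c] by (simp add: fmult_def scaleR_fun_def)

lemma B_sum:
  assumes "v \<in> sections M E" "\<And>i. i \<in> I \<Longrightarrow> u i \<in> sections M E"
  shows "B (\<Sum>i\<in>I. u i) v = (\<Sum>i\<in>I. B (u i) v)"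
proof -
  have zero: "B 0 v = 0"
    using B_scaleR[OF subspace_0[OF subspace_sections[OF E]] assms(1), of 0] by simp
  show ?thesis
    using assms(2)
  proof (induction I rule: infinite_finite_induct)
    case (insert i I)
    have "B (u i + sum u I) v = B (u i) v + B (sum u I) v"
      using insert.prems by (intro B_add assms(1) subspace_sum[OF subspace_sections[OF E]]) auto
    moreover have "B (sum u I) v = (\<Sum>i\<in>I. B (u i) v)"
      using insert.prems by (intro insert.IH) auto
    ultimately show ?case by (simp only: sum.insert[OF insert.hyps])
  qed (simp_all add: zero)
qed

text \<open>
  With \<open>u = \<Sum>\<^sub>i g\<^sub>i b\<^sub>i\<close> near \<open>x\<close> and a bump function \<open>\<beta>\<close>, the global identity
  \<open>\<beta>\<^sup>2 u = \<Sum>\<^sub>i (\<beta> g\<^sub>i) (\<beta> b\<^sub>i)\<close> expresses \<open>\<beta>\<^sup>2 B(u, v)\<close> through the coefficients \<open>g\<^sub>i\<close>, which vanish at \<open>x\<close>.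
\<close>

lemma B_eq_0:
  assumes u: "u \<in> sections M E" and v: "v \<in> sections M E" and "u x = 0"
  shows "B u v x = 0"
proof -
  obtain U b \<beta> K N where f: "(U, b) \<in> frames E" "x \<in> U" "open U"
    and \<beta>: "smooth_fun M UNIV \<beta>" "closed K" "K \<subseteq> U" "\<forall>y. y \<notin> K \<longrightarrow> \<beta> y = 0"
    and N: "open N" "x \<in> N" "\<forall>y\<in>N. \<beta> y \<noteq> 0"
    by (rule ex_local_frame[OF E, where x = x])
  obtain g where g: "\<And>i. i < rank E \<Longrightarrow> smooth_fun M U (g i)"
    "\<And>y. y \<in> U \<Longrightarrow> u y = (\<Sum>i<rank E. g i y *\<^sub>R b i y)"
    using smooth_section_onD_frame[OF sections_smooth_section_on[OF u, of UNIV] f(1)] by auto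
  have g0: "g i x = 0" if "i < rank E" for i
    using sum_frame_unique[OF inj_frame[OF E f(1,2)] independent_frame[OF E f(1,2)],
      of "\<lambda>i. g i x" "\<lambda>_. 0" i] that g(2)[OF f(2)] assms(3) by simp
  have bb: "fmult \<beta> (b i) \<in> sections M E" if "i < rank E" for i
    by (rule bump_section[OF \<beta> E f(3) smooth_frame[OF E f(1) that]])
  have gg: "smooth_fun M UNIV (\<lambda>y. \<beta> y * g i y)" if "i < rank E" for i
    by (rule bump_smooth_fun[OF \<beta> f(3) g(1)[OF that]])
  have "fmult (\<lambda>y. \<beta> y * \<beta> y) u = (\<Sum>i<rank E. fmult (\<lambda>y. \<beta> y * g i y) (fmult \<beta> (b i)))"
  proof
    fix y
    show "fmult (\<lambda>y. \<beta> y * \<beta> y) u y = (\<Sum>i<rank E. fmult (\<lambda>y. \<beta> y * g i y) (fmult \<beta> (b i))) y"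
      using \<beta>(3,4) g(2)[of y]
      by (cases "y \<in> K") (auto simp: fmult_def sum_fun_apply scaleR_sum_right mult_ac)
  qed
  then have "fmult (\<lambda>y. \<beta> y * \<beta> y) (B u v) =
      (\<Sum>i<rank E. fmult (\<lambda>y. \<beta> y * g i y) (B (fmult \<beta> (b i)) v))"
    using B_fmult[OF u v smooth_fun_mult[OF \<beta>(1) \<beta>(1)]] B_fmult[OF bb v gg]
      B_sum[OF v, of "{..<rank E}" "\<lambda>i. fmult (\<lambda>y. \<beta> y * g i y) (fmult \<beta> (b i))"]
      sections_fmult[OF E gg bb] by simp
  from fun_cong[OF this, of x] have "(\<beta> x * \<beta> x) *\<^sub>R B u v x = 0"
    using g0 by (simp add: fmult_def sum_fun_apply)
  then show ?thesis using N by simp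
qed

text \<open>One argument is replaced at a time: the first by \<open>B_eq_0\<close> applied to a
  difference, the second after exchanging the arguments by skew-symmetry.\<close>

lemma B_cong:
  assumes "u \<in> sections M E" "u' \<in> sections M E" "v \<in> sections M E" "v' \<in> sections M E"
    and "u x = u' x" "v x = v' x"
  shows "B u v x = B u' v' x"
proof -
  have *: "B u v x = B u' v x"
    if u: "u \<in> sections M E" "u' \<in> sections M E" "v \<in> sections M E" "u x = u' x" for u u' v
  proof -
    have neg: "(-1) *\<^sub>R u' \<in> sections M E"
      by (rule subspace_scale[OF subspace_sections[OF E] u(2)])
    have "B (u + (-1) *\<^sub>R u') v = B u v + (-1) *\<^sub>R B u' v"
      using B_add[OF u(1,3) neg] B_scaleR[OF u(2,3), of "-1"] by simp
    moreover have "B (u + (-1) *\<^sub>R u') v x = 0"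
      using subspace_add[OF subspace_sections[OF E] u(1) neg] u(3,4)
      by (intro B_eq_0) (simp_all add: scaleR_fun_def)
    ultimately show ?thesis by (simp add: scaleR_fun_def)
  qed
  have "B u v x = B u' v x" using * assms by blast
  also have "\<dots> = - B v u' x" using B_swap[of u' v] assms by simp
  also have "B v u' x = B v' u' x" using * assms by blast
  also have "- B v' u' x = B u' v' x" using B_swap[of u' v'] assms by simp
  finally show ?thesis .
qed

definition extension :: "'m \<Rightarrow> 'e \<Rightarrow> 'm \<Rightarrow> 'e" where
  "extension x e = (SOME s. s \<in> sections M E \<and> s x = e)"

lemma extension:
  assumes "e \<in> fibre E x"
  shows "extension x e \<in> sections M E" "extension x e x = e"
proof -
  have "\<exists>s. s \<in> sections M E \<and> s x = e"
    by (rule ex_section_through[OF E assms]) blast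
  then have "extension x e \<in> sections M E \<and> extension x e x = e"
    unfolding extension_def by (rule someI_ex)
  then show "extension x e \<in> sections M E" "extension x e x = e" by blast+
qed

text \<open>By \<open>B_cong\<close> the chosen extensions do not influence the value, so this is
  the field that induces \<open>B\<close>.\<close>

definition pointwise :: "'m \<Rightarrow> 'e list \<Rightarrow> 'a" where
  "pointwise x es = B (extension x (es ! 0)) (extension x (es ! 1)) x"

lemma pointwise_eq:
  assumes "u \<in> sections M E" "v \<in> sections M E"
  shows "pointwise x [u x, v x] = B u v x"
  unfolding pointwise_def by (intro B_cong) (simp_all add: assms extension sections_fibre)

text \<open>The algebraic laws pass from \<open>B\<close> to the fibres by lifting vectors to global
  sections. Frame sections are not global, so for smoothness they are cut off first and the bump
  factors are divided out again.\<close>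

lemma pointwise_in_hom_sections: "pointwise \<in> hom_sections M 2 E F"
  unfolding hom_sections_def mem_Collect_eq
proof (rule conjI, goal_cases)
  case 1
  show ?case
  proof (intro allI impI, goal_cases)
    case (1 x es)
    then obtain e1 e2 where es: "es = [e1, e2]" and e: "e1 \<in> fibre E x" "e2 \<in> fibre E x"
      by (auto simp: length_Suc_conv numeral_2_eq_2)
    obtain u v where u: "u \<in> sections M E" "u x = e1" and v: "v \<in> sections M E" "v x = e2"
      using ex_section_through[OF E e(1)] ex_section_through[OF E e(2)] by metis
    have eq: "pointwise x [p x, q x] = B p q x" if "p \<in> sections M E" "q \<in> sections M E" for p q
      using pointwise_eq that by blast
    have swap: "pointwise x [p, q] = - pointwise x [q, p]"
      if pq: "p \<in> fibre E x" "q \<in> fibre E x" for p q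
    proof -
      obtain s t where "s \<in> sections M E" "s x = p" "t \<in> sections M E" "t x = q"
        using ex_section_through[OF E pq(1)] ex_section_through[OF E pq(2)] by metis
      then show ?thesis using eq[of s t] eq[of t s] B_swap[of s t] by simp
    qed
    have add: "pointwise x [p + p', q] = pointwise x [p, q] + pointwise x [p', q]"
      if pq: "p \<in> fibre E x" "p' \<in> fibre E x" "q \<in> fibre E x" for p p' q
    proof -
      obtain s s' t where "s \<in> sections M E" "s x = p" "s' \<in> sections M E" "s' x = p'"
        "t \<in> sections M E" "t x = q"
        using ex_section_through[OF E pq(1)] ex_section_through[OF E pq(2)] ex_section_through[OF E pq(3)]
        by metis
      then show ?thesis
        using eq[of s t] eq[of s' t] eq[of "s + s'" t] B_add[of s t s']
          subspace_add[OF subspace_sections[OF E], of s s'] by simp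
    qed
    have scale: "pointwise x [c *\<^sub>R p, q] = c *\<^sub>R pointwise x [p, q]"
      if pq: "p \<in> fibre E x" "q \<in> fibre E x" for c p q
    proof -
      obtain s t where "s \<in> sections M E" "s x = p" "t \<in> sections M E" "t x = q"
        using ex_section_through[OF E pq(1)] ex_section_through[OF E pq(2)] by metis
      then show ?thesis
        using eq[of s t] eq[of "c *\<^sub>R s" t] B_scaleR[of s t c]
          subspace_scale[OF subspace_sections[OF E], of s c] by (simp add: scaleR_fun_def)
    qed
    have fib: "p + q \<in> fibre E x" "c *\<^sub>R p \<in> fibre E x" if "p \<in> fibre E x" "q \<in> fibre E x" for p q c
      using that subspace_fibre[OF E] by (auto intro: subspace_add subspace_scale)
    have "pointwise x es \<in> fibre F x"
      using eq[OF u(1) v(1)] u v sections_fibre[OF B_section[OF u(1) v(1)]] by (simp add: es)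
    moreover have "pointwise x (es[i := p + q]) = pointwise x (es[i := p]) + pointwise x (es[i := q])"
      if "i < 2" "p \<in> fibre E x" "q \<in> fibre E x" for i p q
    proof (cases "i = 0")
      case True
      with that e show ?thesis by (simp add: es add)
    next
      case False
      with that have "i = 1" by simp
      with that e show ?thesis
        using swap[of e1 "p + q"] swap[of e1 p] swap[of e1 q] by (simp add: es add fib)
    qed
    moreover have "pointwise x (es[i := c *\<^sub>R p]) = c *\<^sub>R pointwise x (es[i := p])"
      if "i < 2" "p \<in> fibre E x" for i c p
    proof (cases "i = 0")
      case True
      with that e show ?thesis by (simp add: es scale)
    next
      case False
      with that have "i = 1" by simp
      with that e show ?thesis
        using swap[of e1 "c *\<^sub>R p"] swap[of e1 p] by (simp add: es scale fib)
    qed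
    moreover have "pointwise x es = 0" if "i < j" "j < 2" "es ! i = es ! j" for i j
    proof -
      have "i = 0" "j = 1" using that by auto
      with that have "e1 = e2" by (simp add: es)
      then have "pointwise x es = - pointwise x es" using swap[of e1 e1] e by (simp add: es)
      then have "(2::real) *\<^sub>R pointwise x es = 0" by (simp add: scaleR_2 eq_neg_iff_add_eq_0)
      then show ?thesis by simp
    qed
    ultimately show ?case by blast
  qed
next
  case 2
  show ?case
  proof (intro ballI, clarify)
    fix U b js assume f: "(U, b) \<in> frames E" and js: "length js = 2" "set js \<subseteq> {..<rank E}"
    then obtain j k where jk: "js = [j, k]" "j < rank E" "k < rank E"
      by (auto simp: length_Suc_conv numeral_2_eq_2)
    show "smooth_section_on M F U (\<lambda>x. pointwise x (map (\<lambda>j. b j x) js))"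
    proof (rule smooth_section_on_local[OF F open_frame[OF E f]])
      fix x assume x: "x \<in> U"
      obtain \<beta> K N where \<beta>: "smooth_fun M UNIV \<beta>" "closed K" "K \<subseteq> U" "\<forall>y. y \<notin> K \<longrightarrow> \<beta> y = 0"
        and N: "open N" "x \<in> N" "\<forall>y\<in>N. \<beta> y \<noteq> 0"
        by (rule ex_bump[OF open_frame[OF E f] x])
      have bb: "fmult \<beta> (b i) \<in> sections M E" if "i < rank E" for i
        by (rule bump_section[OF \<beta> E open_frame[OF E f] smooth_frame[OF E f that]])
      \<comment> \<open>Each of the two frame sections has received a factor \<open>\<beta>\<close>,
        hence the division by its square.\<close>
      have "smooth_section_on M F (U \<inter> N)
          (\<lambda>y. inverse (\<beta> y * \<beta> y) *\<^sub>R B (fmult \<beta> (b j)) (fmult \<beta> (b k)) y)"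
        using N(3) smooth_fun_subset[OF \<beta>(1)]
        by (intro smooth_section_on_fmult[OF F] smooth_fun_inverse smooth_fun_mult
          sections_smooth_section_on B_section bb jk) auto
      then have "smooth_section_on M F (U \<inter> N) (\<lambda>y. pointwise y (map (\<lambda>j. b j y) js))"
      proof (rule smooth_section_on_cong)
        fix y assume y: "y \<in> U \<inter> N"
        \<comment> \<open>The point \<open>y\<close> is fixed here: a constant multiple of the
          global section \<open>fmult \<beta> (b i)\<close> takes the value of the frame at
          \<open>y\<close>.\<close>
        have s: "(1 / \<beta> y) *\<^sub>R fmult \<beta> (b i) \<in> sections M E"
          "((1 / \<beta> y) *\<^sub>R fmult \<beta> (b i)) y = b i y" if "i < rank E" for i
          by (rule subspace_scale[OF subspace_sections[OF E] bb[OF that]])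
            (use N(3) y in \<open>simp add: scaleR_fun_def fmult_def\<close>)
        have "pointwise y (map (\<lambda>j. b j y) js) =
            B ((1 / \<beta> y) *\<^sub>R fmult \<beta> (b j)) ((1 / \<beta> y) *\<^sub>R fmult \<beta> (b k)) y"
          using pointwise_eq[OF s(1) s(1), of j k y] s(2) jk by simp
        also have "\<dots> = (1 / \<beta> y) *\<^sub>R B (fmult \<beta> (b j)) ((1 / \<beta> y) *\<^sub>R fmult \<beta> (b k)) y"
          using B_scaleR[OF bb s(1)] jk by (simp add: scaleR_fun_def)
        also have "B (fmult \<beta> (b j)) ((1 / \<beta> y) *\<^sub>R fmult \<beta> (b k)) y =
            (1 / \<beta> y) *\<^sub>R B (fmult \<beta> (b j)) (fmult \<beta> (b k)) y"
          using B_scaleR[OF bb bb, of k j] B_swap[OF bb s(1), of j k] B_swap[OF bb bb, of j k] jk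
          by (simp add: scaleR_fun_def)
        finally show "inverse (\<beta> y * \<beta> y) *\<^sub>R B (fmult \<beta> (b j)) (fmult \<beta> (b k)) y =
            pointwise y (map (\<lambda>j. b j y) js)"
          by (simp add: divide_inverse)
      qed
      with N show "\<exists>N. open N \<and> x \<in> N \<and>
          smooth_section_on M F (U \<inter> N) (\<lambda>x. pointwise x (map (\<lambda>j. b j x) js))" by blast
    qed
  qed
qed

end

lemma tensorial2_cochain:
  assumes "smooth_manifold (base L)" "vector_bundle (base L) (repb L)" "vector_bundle (base L) (algd L)"
    and "tensorial2 (base L) (repb L) (algd L) B"
    and "\<And>us. \<Theta> us = (if length us = 2 \<and> set us \<subseteq> sections_E L then B (us ! 0) (us ! 1) else 0)"
  shows "\<Theta> \<in> cochains L 2"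
proof -
  interpret alternating_form "base L" "repb L" "algd L" B
    using assms(1-4) by unfold_locales
  have "\<Theta> = on_sections L 2 pointwise"
  proof
    fix us
    show "\<Theta> us = on_sections L 2 pointwise us"
    proof (cases "length us = 2 \<and> set us \<subseteq> sections_E L")
      case True
      then obtain u v where "us = [u, v]" "u \<in> sections_E L" "v \<in> sections_E L"
        by (auto simp: length_Suc_conv numeral_2_eq_2)
      then show ?thesis using pointwise_eq by (auto simp: assms(5) on_sections_def)
    qed (auto simp: assms(5) on_sections_def)
  qed
  then show ?thesis unfolding cochains_def using pointwise_in_hom_sections by blast
qed

section \<open>The graded bracket in low degrees\<close>

text \<open>\<open>A\<close> and \<open>E\<close> stand for the smooth sections inside spaces of
  arbitrary maps, where bracket and representation are unspecified; hence all laws are relative to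
  carriers. Multiplication by functions does not occur at this level.\<close>

locale lie_rep_algebra =
  fixes A :: "'x::real_vector set" and E :: "'y::real_vector set"
    and br :: "'x \<Rightarrow> 'x \<Rightarrow> 'x" and \<rho> :: "'x \<Rightarrow> 'y \<Rightarrow> 'y"
  assumes A: "subspace A" and E: "subspace E"
    and br_in [simp]: "x \<in> A \<Longrightarrow> y \<in> A \<Longrightarrow> br x y \<in> A"
    and br_add_left: "x \<in> A \<Longrightarrow> y \<in> A \<Longrightarrow> z \<in> A \<Longrightarrow> br (x + y) z = br x z + br y z"
    and br_scaleR_left: "x \<in> A \<Longrightarrow> y \<in> A \<Longrightarrow> br (c *\<^sub>R x) y = c *\<^sub>R br x y"
    and br_skew: "x \<in> A \<Longrightarrow> y \<in> A \<Longrightarrow> br x y = - br y x"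
    and br_jacobi: "x \<in> A \<Longrightarrow> y \<in> A \<Longrightarrow> z \<in> A \<Longrightarrow> br x (br y z) + br y (br z x) + br z (br x y) = 0"
    and rho_in [simp]: "x \<in> A \<Longrightarrow> u \<in> E \<Longrightarrow> \<rho> x u \<in> E"
    and rho_add_right: "x \<in> A \<Longrightarrow> u \<in> E \<Longrightarrow> v \<in> E \<Longrightarrow> \<rho> x (u + v) = \<rho> x u + \<rho> x v"
    and rho_scaleR_right: "x \<in> A \<Longrightarrow> u \<in> E \<Longrightarrow> \<rho> x (c *\<^sub>R u) = c *\<^sub>R \<rho> x u"
    and rho_add_left: "x \<in> A \<Longrightarrow> y \<in> A \<Longrightarrow> u \<in> E \<Longrightarrow> \<rho> (x + y) u = \<rho> x u + \<rho> y u"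
    and rho_scaleR_left: "x \<in> A \<Longrightarrow> u \<in> E \<Longrightarrow> \<rho> (c *\<^sub>R x) u = c *\<^sub>R \<rho> x u"
    and rho_br: "x \<in> A \<Longrightarrow> y \<in> A \<Longrightarrow> u \<in> E \<Longrightarrow> \<rho> (br x y) u = \<rho> x (\<rho> y u) - \<rho> y (\<rho> x u)"
begin

definition linear_op :: "('y \<Rightarrow> 'x) \<Rightarrow> bool" where
  "linear_op P \<longleftrightarrow> (\<forall>u\<in>E. P u \<in> A) \<and> (\<forall>u\<in>E. \<forall>v\<in>E. P (u + v) = P u + P v) \<and>
    (\<forall>c. \<forall>u\<in>E. P (c *\<^sub>R u) = c *\<^sub>R P u)"

lemma closed_simps [simp]:
  "0 \<in> A" "x \<in> A \<Longrightarrow> y \<in> A \<Longrightarrow> x + y \<in> A" "x \<in> A \<Longrightarrow> y \<in> A \<Longrightarrow> x - y \<in> A"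
  "x \<in> A \<Longrightarrow> - x \<in> A" "x \<in> A \<Longrightarrow> c *\<^sub>R x \<in> A"
  "0 \<in> E" "u \<in> E \<Longrightarrow> v \<in> E \<Longrightarrow> u + v \<in> E" "u \<in> E \<Longrightarrow> v \<in> E \<Longrightarrow> u - v \<in> E"
  "u \<in> E \<Longrightarrow> - u \<in> E" "u \<in> E \<Longrightarrow> c *\<^sub>R u \<in> E"
  using A E by (simp_all add: subspace_0 subspace_add subspace_diff subspace_neg subspace_scale)

lemma br_add_right: "x \<in> A \<Longrightarrow> y \<in> A \<Longrightarrow> z \<in> A \<Longrightarrow> br z (x + y) = br z x + br z y"
  using br_skew[of z "x + y"] br_skew[of z x] br_skew[of z y] by (simp add: br_add_left)

lemma br_minus_left: "x \<in> A \<Longrightarrow> y \<in> A \<Longrightarrow> br (- x) y = - br x y"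
  using br_scaleR_left[of x y "-1"] by simp

lemma br_minus_right: "x \<in> A \<Longrightarrow> y \<in> A \<Longrightarrow> br y (- x) = - br y x"
  using br_skew[of y "- x"] br_skew[of y x] by (simp add: br_minus_left)

lemma br_diff_left: "x \<in> A \<Longrightarrow> y \<in> A \<Longrightarrow> z \<in> A \<Longrightarrow> br (x - y) z = br x z - br y z"
  using br_add_left[of x "- y" z] by (simp add: br_minus_left)

lemma br_diff_right: "x \<in> A \<Longrightarrow> y \<in> A \<Longrightarrow> z \<in> A \<Longrightarrow> br z (x - y) = br z x - br z y"
  using br_add_right[of x "- y" z] by (simp add: br_minus_right)

lemma br_scaleR_right: "x \<in> A \<Longrightarrow> y \<in> A \<Longrightarrow> br y (c *\<^sub>R x) = c *\<^sub>R br y x"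
  using br_skew[of y "c *\<^sub>R x"] br_skew[of y x] by (simp add: br_scaleR_left)

lemma rho_minus_right: "x \<in> A \<Longrightarrow> u \<in> E \<Longrightarrow> \<rho> x (- u) = - \<rho> x u"
  using rho_scaleR_right[of x u "-1"] by simp

lemma rho_minus_left: "x \<in> A \<Longrightarrow> u \<in> E \<Longrightarrow> \<rho> (- x) u = - \<rho> x u"
  using rho_scaleR_left[of x u "-1"] by simp

lemma rho_diff_right: "x \<in> A \<Longrightarrow> u \<in> E \<Longrightarrow> v \<in> E \<Longrightarrow> \<rho> x (u - v) = \<rho> x u - \<rho> x v"
  using rho_add_right[of x u "- v"] by (simp add: rho_minus_right)

lemma rho_diff_left: "x \<in> A \<Longrightarrow> y \<in> A \<Longrightarrow> u \<in> E \<Longrightarrow> \<rho> (x - y) u = \<rho> x u - \<rho> y u"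
  using rho_add_left[of x "- y" u] by (simp add: rho_minus_left)

lemma linear_op_simps:
  assumes "linear_op P"
  shows "u \<in> E \<Longrightarrow> P u \<in> A"
    and "u \<in> E \<Longrightarrow> v \<in> E \<Longrightarrow> P (u + v) = P u + P v"
    and "u \<in> E \<Longrightarrow> P (c *\<^sub>R u) = c *\<^sub>R P u"
    and "u \<in> E \<Longrightarrow> P (- u) = - P u"
    and "u \<in> E \<Longrightarrow> v \<in> E \<Longrightarrow> P (u - v) = P u - P v"
proof -
  show *: "u \<in> E \<Longrightarrow> P u \<in> A" "u \<in> E \<Longrightarrow> v \<in> E \<Longrightarrow> P (u + v) = P u + P v"
    "u \<in> E \<Longrightarrow> P (c *\<^sub>R u) = c *\<^sub>R P u" for u v c
    using assms unfolding linear_op_def by blast+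
  show minus: "u \<in> E \<Longrightarrow> P (- u) = - P u" for u using *(3)[of u "-1"] by simp
  show "u \<in> E \<Longrightarrow> v \<in> E \<Longrightarrow> P (u - v) = P u - P v" using *(2)[of u "- v"] by (simp add: minus)
qed

lemmas bilinear_simps = br_add_left br_add_right br_minus_left br_minus_right br_diff_left br_diff_right
  br_scaleR_left br_scaleR_right rho_add_left rho_add_right rho_minus_left rho_minus_right
  rho_diff_left rho_diff_right rho_scaleR_left rho_scaleR_right

text \<open>
  \<open>\<lbrakk>P, Q\<rbrakk>\<close> and \<open>\<lbrakk>P, R\<rbrakk>\<close> for \<open>P\<close>, \<open>Q\<close> of degree \<open>1\<close> and \<open>R\<close> of degree \<open>2\<close>, with the unshuffles listed.
\<close>

definition bracket11 :: "('y \<Rightarrow> 'x) \<Rightarrow> ('y \<Rightarrow> 'x) \<Rightarrow> 'y \<Rightarrow> 'y \<Rightarrow> 'x" where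
  "bracket11 P Q u v = P (\<rho> (Q u) v) - P (\<rho> (Q v) u) + (Q (\<rho> (P u) v) - Q (\<rho> (P v) u))
    - (br (P u) (Q v) - br (P v) (Q u))"

definition bracket12 :: "('y \<Rightarrow> 'x) \<Rightarrow> ('y \<Rightarrow> 'y \<Rightarrow> 'x) \<Rightarrow> 'y \<Rightarrow> 'y \<Rightarrow> 'y \<Rightarrow> 'x" where
  "bracket12 P R u v w =
    P (\<rho> (R u v) w) - P (\<rho> (R u w) v) + P (\<rho> (R v w) u)
    - (R (\<rho> (P u) v) w - R (\<rho> (P u) w) v - R (\<rho> (P v) u) w
      + R (\<rho> (P v) w) u + R (\<rho> (P w) u) v - R (\<rho> (P w) v) u)
    + (br (P u) (R v w) - br (P v) (R u w) + br (P w) (R u v))"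

text \<open>Nested terms such as P(rho(Q(rho(R u) v)) w) cancel between the three summands, actions
  of brackets are resolved by \<open>rho_br\<close>, and double brackets by
  \<open>br_jacobi\<close>. The auxiliary facts only choose normal forms.\<close>

lemma bracket11_jacobi:
  assumes P: "linear_op P" and Q: "linear_op Q" and R: "linear_op R"
    and [simp]: "u \<in> E" "v \<in> E" "w \<in> E"
  shows "bracket12 P (bracket11 Q R) u v w + bracket12 Q (bracket11 R P) u v w + bracket12 R (bracket11 P Q) u v w = 0"
proof -
  note [simp] = linear_op_simps[OF P] linear_op_simps[OF Q] linear_op_simps[OF R]
  \<comment> \<open>Eliminates double brackets with \<open>P\<close> outermost. Together with
    \<open>S\<close>, which puts the inner pair into the cyclic order P, Q, R, this gives each
    double bracket one normal form.\<close>
  have J: "br (P a) (br (Q b) (R c)) = - br (Q b) (br (R c) (P a)) - br (R c) (br (P a) (Q b))"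
    if "a \<in> E" "b \<in> E" "c \<in> E" for a b c
    using br_jacobi[of "P a" "Q b" "R c"] that by (simp add: eq_neg_iff_add_eq_0 algebra_simps)
  have S: "br x (br (Q a) (P b)) = - br x (br (P b) (Q a))"
    "br x (br (R a) (Q b)) = - br x (br (Q b) (R a))"
    "br x (br (P a) (R b)) = - br x (br (R b) (P a))" if "x \<in> A" "a \<in> E" "b \<in> E" for x a b
    using br_skew[of "Q a" "P b"] br_skew[of "R a" "Q b"] br_skew[of "P a" "R b"] that
    by (simp_all add: br_minus_right)
  \<comment> \<open>Brackets with one action inside are oriented so that the action stands on the
    right.\<close>
  have sk: "br (P (\<rho> x a)) (Q b) = - br (Q b) (P (\<rho> x a))"
     "br (P (\<rho> x a)) (R b) = - br (R b) (P (\<rho> x a))"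
     "br (Q (\<rho> x a)) (P b) = - br (P b) (Q (\<rho> x a))"
     "br (Q (\<rho> x a)) (R b) = - br (R b) (Q (\<rho> x a))"
     "br (R (\<rho> x a)) (P b) = - br (P b) (R (\<rho> x a))"
     "br (R (\<rho> x a)) (Q b) = - br (Q b) (R (\<rho> x a))" if "x \<in> A" "a \<in> E" "b \<in> E" for x a b
    using that by (auto intro!: br_skew)
  show ?thesis
    unfolding bracket12_def bracket11_def
    by (simp add: bilinear_simps rho_br J S sk)
qed

section \<open>Linearity of the brackets in arguments and operators\<close>

lemma sum_closed [simp]:
  "(\<And>i. i \<in> I \<Longrightarrow> x i \<in> A) \<Longrightarrow> sum x I \<in> A" "(\<And>i. i \<in> I \<Longrightarrow> u i \<in> E) \<Longrightarrow> sum u I \<in> E"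
  by (rule subspace_sum[OF A], simp) (rule subspace_sum[OF E], simp)

lemma br_zero [simp]: "x \<in> A \<Longrightarrow> br 0 x = 0" "x \<in> A \<Longrightarrow> br x 0 = 0"
  using br_scaleR_left[of x x 0] br_scaleR_right[of x x 0] by simp_all

lemma rho_zero [simp]: "u \<in> E \<Longrightarrow> \<rho> 0 u = 0" "x \<in> A \<Longrightarrow> \<rho> x 0 = 0"
  using rho_scaleR_left[of 0 u 0] rho_scaleR_right[of x 0 0] by simp_all

lemma linear_op_zero: "linear_op P \<Longrightarrow> P 0 = 0"
  using linear_op_simps(3)[of P 0 0] by simp

lemma br_sum_left: "(\<And>i. i \<in> I \<Longrightarrow> x i \<in> A) \<Longrightarrow> y \<in> A \<Longrightarrow> br (\<Sum>i\<in>I. x i) y = (\<Sum>i\<in>I. br (x i) y)"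
  by (induction I rule: infinite_finite_induct) (simp_all add: br_add_left)

lemma br_sum_right: "(\<And>i. i \<in> I \<Longrightarrow> x i \<in> A) \<Longrightarrow> y \<in> A \<Longrightarrow> br y (\<Sum>i\<in>I. x i) = (\<Sum>i\<in>I. br y (x i))"
  by (induction I rule: infinite_finite_induct) (simp_all add: br_add_right)

lemma rho_sum_left: "(\<And>i. i \<in> I \<Longrightarrow> x i \<in> A) \<Longrightarrow> u \<in> E \<Longrightarrow> \<rho> (\<Sum>i\<in>I. x i) u = (\<Sum>i\<in>I. \<rho> (x i) u)"
  by (induction I rule: infinite_finite_induct) (simp_all add: rho_add_left)

lemma linear_op_sum:
  assumes P: "linear_op P" and u: "\<And>i. i \<in> I \<Longrightarrow> u i \<in> E"
  shows "P (\<Sum>i\<in>I. u i) = (\<Sum>i\<in>I. P (u i))"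
  using u
  by (induction I rule: infinite_finite_induct) (simp_all add: linear_op_zero[OF P] linear_op_simps[OF P])

lemma bracket11_closed:
  "linear_op P \<Longrightarrow> linear_op Q \<Longrightarrow> u \<in> E \<Longrightarrow> v \<in> E \<Longrightarrow> bracket11 P Q u v \<in> A"
  by (simp add: bracket11_def linear_op_simps(1))

lemma bracket11_swap: "bracket11 P Q u v = - bracket11 P Q v u"
  by (simp add: bracket11_def)

text \<open>In degree (1, 1) graded skew-symmetry amounts to symmetry.\<close>

lemma bracket11_sym:
  "linear_op P \<Longrightarrow> linear_op Q \<Longrightarrow> u \<in> E \<Longrightarrow> v \<in> E \<Longrightarrow> bracket11 P Q u v = bracket11 Q P u v"
  using br_skew[of "P u" "Q v"] br_skew[of "P v" "Q u"] by (simp add: bracket11_def linear_op_simps(1))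

lemma bracket11_zero_op:
  assumes P: "linear_op P" and "u \<in> E" "v \<in> E"
  shows "bracket11 P (\<lambda>u. 0) u v = 0" "bracket11 (\<lambda>u. 0) P u v = 0"
  using assms(2-) by (simp_all add: bracket11_def linear_op_zero[OF P] linear_op_simps(1)[OF P])

lemma bracket11_add_arg:
  assumes P: "linear_op P" and Q: "linear_op Q" and "u \<in> E" "u' \<in> E" "v \<in> E"
  shows "bracket11 P Q (u + u') v = bracket11 P Q u v + bracket11 P Q u' v"
  using assms(3-) by (simp add: bracket11_def bilinear_simps linear_op_simps[OF P] linear_op_simps[OF Q])

lemma bracket11_add_op:
  assumes P: "linear_op P" and Q: "linear_op Q" and R: "linear_op R" and "u \<in> E" "v \<in> E"
  shows "bracket11 P (\<lambda>u. Q u + R u) u v = bracket11 P Q u v + bracket11 P R u v"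
  using assms(4-)
  by (simp add: bracket11_def bilinear_simps linear_op_simps[OF P] linear_op_simps[OF Q] linear_op_simps[OF R])

lemma bracket11_minus_op:
  assumes P: "linear_op P" and Q: "linear_op Q" and "u \<in> E" "v \<in> E"
  shows "bracket11 P (\<lambda>u. - Q u) u v = - bracket11 P Q u v"
  using assms(3-) by (simp add: bracket11_def bilinear_simps linear_op_simps[OF P] linear_op_simps[OF Q])

lemma bracket12_add:
  assumes P: "linear_op P" and R: "\<And>u v. u \<in> E \<Longrightarrow> v \<in> E \<Longrightarrow> R u v \<in> A"
    and S: "\<And>u v. u \<in> E \<Longrightarrow> v \<in> E \<Longrightarrow> S u v \<in> A" and "u \<in> E" "v \<in> E" "w \<in> E"
  shows "bracket12 P (\<lambda>u v. R u v + S u v) u v w = bracket12 P R u v w + bracket12 P S u v w"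
  using assms(4-) by (simp add: bracket12_def bilinear_simps linear_op_simps[OF P] R S)

lemma bracket12_scaleR:
  assumes P: "linear_op P" and R: "\<And>u v. u \<in> E \<Longrightarrow> v \<in> E \<Longrightarrow> R u v \<in> A"
    and "u \<in> E" "v \<in> E" "w \<in> E"
  shows "bracket12 P (\<lambda>u v. c *\<^sub>R R u v) u v w = c *\<^sub>R bracket12 P R u v w"
  using assms(3-) by (simp add: bracket12_def bilinear_simps linear_op_simps[OF P] R algebra_simps)

lemma bracket12_cong:
  assumes P: "linear_op P" and R: "\<And>u v. u \<in> E \<Longrightarrow> v \<in> E \<Longrightarrow> R u v = S u v"
    and "u \<in> E" "v \<in> E" "w \<in> E"
  shows "bracket12 P R u v w = bracket12 P S u v w"
  using assms(3-) by (simp add: bracket12_def R linear_op_simps(1)[OF P])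

lemma bracket12_zero:
  assumes P: "linear_op P" and "u \<in> E" "v \<in> E" "w \<in> E"
  shows "bracket12 P (\<lambda>u v. 0) u v w = 0"
  using assms(2-) by (simp add: bracket12_def linear_op_zero[OF P] linear_op_simps(1)[OF P])

lemma bracket12_sum:
  assumes P: "linear_op P" and R: "\<And>i u v. i \<in> I \<Longrightarrow> u \<in> E \<Longrightarrow> v \<in> E \<Longrightarrow> R i u v \<in> A"
    and "u \<in> E" "v \<in> E" "w \<in> E"
  shows "bracket12 P (\<lambda>u v. \<Sum>i\<in>I. R i u v) u v w = (\<Sum>i\<in>I. bracket12 P (R i) u v w)"
  using R
proof (induction I rule: infinite_finite_induct)
  case (insert i I)
  then show ?case using assms(3-) by (simp add: bracket12_add[OF P])
qed (simp_all add: bracket12_zero[OF P assms(3-)])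

lemma bracket12_bracket11_sum_eq_0:
  fixes T :: "nat \<Rightarrow> 'y \<Rightarrow> 'x" and N :: nat
  assumes T: "\<And>i. linear_op (T i)"
    and low: "\<And>m u v. m < N \<Longrightarrow> u \<in> E \<Longrightarrow> v \<in> E \<Longrightarrow> (\<Sum>i\<le>m. bracket11 (T i) (T (m - i)) u v) = 0"
    and uvw: "u \<in> E" "v \<in> E" "w \<in> E"
  shows "bracket12 (T 0) (\<lambda>u v. \<Sum>i\<le>N. bracket11 (T i) (T (N - i)) u v) u v w = 0"
proof -
  define G where "G = (\<lambda>(i, j, k). bracket12 (T i) (bracket11 (T j) (T k)) u v w)"
  define X where "X = {(i, j, k). i + j + k = N}"
  \<comment> \<open>\<open>F i\<close> collects all terms with outer index \<open>i\<close>. For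
    \<open>i \<ge> 1\<close> its inner sum has order \<open>N - i < N\<close> and vanishes by
    \<open>low\<close>, so \<open>F 0\<close> alone equals the full triple sum.\<close>
  define F where "F i = bracket12 (T i) (\<lambda>u v. \<Sum>j\<le>N - i. bracket11 (T j) (T (N - i - j)) u v) u v w" for i
  have "F i = 0" if "i \<in> {..N} - {0}" for i
    unfolding F_def
    using bracket12_cong[OF T, of "\<lambda>u v. \<Sum>j\<le>N - i. bracket11 (T j) (T (N - i - j)) u v" "\<lambda>_ _. 0" u v w i]
      bracket12_zero[OF T uvw] low[of "N - i"] that uvw by simp
  then have "sum F {0} = (\<Sum>i\<le>N. F i)"
    by (intro sum.mono_neutral_left) auto
  also have "\<dots> = (\<Sum>i\<le>N. \<Sum>j\<le>N - i. G (i, j, N - i - j))"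
  proof (rule sum.cong[OF refl])
    show "F i = (\<Sum>j\<le>N - i. G (i, j, N - i - j))" for i
      using bracket12_sum[OF T _ uvw, of "{..N - i}" "\<lambda>j. bracket11 (T j) (T (N - i - j))" i] bracket11_closed[OF T T]
      by (simp add: F_def G_def)
  qed
  also have "\<dots> = sum G X"
    unfolding X_def
    by (simp add: sum.Sigma, rule sum.reindex_bij_witness[of _ "\<lambda>(i, j, k). (i, j)" "\<lambda>(i, j). (i, j, N - i - j)"]) auto
  finally have eq: "bracket12 (T 0) (\<lambda>u v. \<Sum>i\<le>N. bracket11 (T i) (T (N - i)) u v) u v w = sum G X"
    by (simp add: F_def)
  \<comment> \<open>Rotating the indices preserves \<open>X\<close>, so the triple sum can be
    written in three ways. Added together they contain a complete cyclic Jacobi expression for each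
    index triple, which is why three times the sum is computed.\<close>
  have rot: "sum G X = (\<Sum>(i, j, k)\<in>X. G (j, k, i))" "sum G X = (\<Sum>(i, j, k)\<in>X. G (k, i, j))"
    unfolding X_def
    by (rule sum.reindex_bij_witness[of _ "\<lambda>(i, j, k). (j, k, i)" "\<lambda>(i, j, k). (k, i, j)"]; auto)
      (rule sum.reindex_bij_witness[of _ "\<lambda>(i, j, k). (k, i, j)" "\<lambda>(i, j, k). (j, k, i)"]; auto)
  have "3 *\<^sub>R sum G X = sum G X + (\<Sum>(i, j, k)\<in>X. G (j, k, i)) + (\<Sum>(i, j, k)\<in>X. G (k, i, j))"
    unfolding rot[symmetric] by (simp add: scaleR_add_left[of 1 2, simplified] scaleR_2)
  also have "\<dots> = (\<Sum>(i, j, k)\<in>X. G (i, j, k) + G (j, k, i) + G (k, i, j))"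
    by (simp add: sum.distrib case_prod_unfold)
  also have "\<dots> = 0"
    using bracket11_jacobi[OF T T T uvw] by (auto simp: G_def intro!: sum.neutral)
  finally show ?thesis using eq by simp
qed

section \<open>The Rota-Baxter identity for formal series\<close>

definition rb_defect :: "('y \<Rightarrow> 'x) \<Rightarrow> ('y \<Rightarrow> 'x) \<Rightarrow> 'y \<Rightarrow> 'y \<Rightarrow> 'x" where
  "rb_defect P Q u v = br (P u) (Q v) - (P (\<rho> (Q u) v) - P (\<rho> (Q v) u))"

text \<open>\<open>rb_defect\<close> is the failure of the Rota-Baxter identity, polarised in the
  two operators. The bracket is minus its symmetrisation.\<close>

lemma bracket11_eq_rb_defect:
  "linear_op P \<Longrightarrow> linear_op Q \<Longrightarrow> u \<in> E \<Longrightarrow> v \<in> E \<Longrightarrow>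
    bracket11 P Q u v = - rb_defect P Q u v - rb_defect Q P u v"
  using br_skew[of "P v" "Q u"] by (simp add: bracket11_def rb_defect_def linear_op_simps(1))

text \<open>The reflection \<open>i \<mapsto> m - i\<close> identifies the two halves of the
  symmetrised sum, whence the factor -2.\<close>

lemma sum_bracket11_eq_rb_defect:
  fixes T :: "nat \<Rightarrow> 'y \<Rightarrow> 'x" and m :: nat
  assumes T: "\<And>i. linear_op (T i)" and "u \<in> E" "v \<in> E"
  shows "(\<Sum>i\<le>m. bracket11 (T i) (T (m - i)) u v) = (-2) *\<^sub>R (\<Sum>i\<le>m. rb_defect (T i) (T (m - i)) u v)"
proof -
  have "(\<Sum>i\<le>m. rb_defect (T (m - i)) (T i) u v) = (\<Sum>i\<le>m. rb_defect (T i) (T (m - i)) u v)"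
    by (rule sum.reindex_bij_witness[of _ "\<lambda>i. m - i" "\<lambda>i. m - i"]) auto
  then show ?thesis
    using assms by (simp add: bracket11_eq_rb_defect sum_subtractf sum_negf scaleR_2)
qed

lemma rb_defect_zero:
  assumes "linear_op P" "linear_op Q" "u \<in> E"
  shows "rb_defect P Q 0 u = 0" "rb_defect P Q u 0 = 0"
  using assms by (simp_all add: rb_defect_def linear_op_zero linear_op_simps(1))

text \<open>Counterpart of \<open>formal_ext app_sect\<close> for coefficients that already act on
  sections.\<close>

definition formal_app :: "(nat \<Rightarrow> 'y \<Rightarrow> 'x) \<Rightarrow> (nat \<Rightarrow> 'y) \<Rightarrow> nat \<Rightarrow> 'x" where
  "formal_app T u k = (\<Sum>i\<le>k. T i (u (k - i)))"

text \<open>Both sides are sums over quadruples \<open>a + b + c + d = k\<close>, with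
  \<open>a\<close>, \<open>b\<close> indexing operators and \<open>c\<close>, \<open>d\<close>
  indexing arguments. Grouping by \<open>(c, d)\<close> leaves the convolution of order
  \<open>k - c - d\<close> at fixed sections.\<close>

lemma formal_rota_baxter_defect:
  fixes T :: "nat \<Rightarrow> 'y \<Rightarrow> 'x" and k :: nat
  assumes T: "\<And>i. linear_op (T i)" and u: "\<And>j. u j \<in> E" and v: "\<And>j. v j \<in> E"
  shows "formal_ext br (formal_app T u) (formal_app T v) k
      - formal_app T (\<lambda>j. formal_ext \<rho> (formal_app T u) v j - formal_ext \<rho> (formal_app T v) u j) k
    = (\<Sum>c\<le>k. \<Sum>d\<le>k - c. \<Sum>a\<le>k - c - d. rb_defect (T a) (T (k - c - d - a)) (u c) (v d))"
proof -
  define Y where "Y = {(a, b, c, d). a + b + c + d = k}"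
  note [simp] = linear_op_simps(1)[OF T] u v
  have "formal_ext br (formal_app T u) (formal_app T v) k =
      (\<Sum>i\<le>k. \<Sum>a\<le>i. \<Sum>b\<le>k - i. br (T a (u (i - a))) (T b (v (k - i - b))))"
  proof -
    have "formal_app T v j \<in> A" for j by (simp add: formal_app_def)
    then have "formal_ext br (formal_app T u) (formal_app T v) k =
        (\<Sum>i\<le>k. \<Sum>a\<le>i. br (T a (u (i - a))) (formal_app T v (k - i)))"
      by (simp add: formal_ext_def formal_app_def[of T u] br_sum_left)
    then show ?thesis by (simp add: formal_app_def br_sum_right)
  qed
  also have "\<dots> = (\<Sum>(a, b, c, d)\<in>Y. br (T a (u c)) (T b (v d)))"
    unfolding Y_def
    by (simp add: sum.Sigma, rule sum.reindex_bij_witness[of _ "\<lambda>(a, b, c, d). (a + c, a, b)"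
      "\<lambda>(i, a, b). (a, b, i - a, k - i - b)"]) auto
  finally have 1: "formal_ext br (formal_app T u) (formal_app T v) k =
    (\<Sum>(a, b, c, d)\<in>Y. br (T a (u c)) (T b (v d)))" .
  have 2: "(\<Sum>a\<le>k. T a (formal_ext \<rho> (formal_app T p) q (k - a))) =
      (\<Sum>a\<le>k. \<Sum>i\<le>k - a. \<Sum>b\<le>i. T a (\<rho> (T b (p (i - b))) (q (k - a - i))))"
    if "\<And>j. p j \<in> E" "\<And>j. q j \<in> E" for p q
    using that by (simp add: formal_ext_def formal_app_def rho_sum_left linear_op_sum[OF T])
  have 3: "(\<Sum>a\<le>k. \<Sum>i\<le>k - a. \<Sum>b\<le>i. T a (\<rho> (T b (u (i - b))) (v (k - a - i)))) =
      (\<Sum>(a, b, c, d)\<in>Y. T a (\<rho> (T b (u c)) (v d)))"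
    unfolding Y_def
    by (simp add: sum.Sigma, rule sum.reindex_bij_witness[of _ "\<lambda>(a, b, c, d). (a, b + c, b)"
      "\<lambda>(a, i, b). (a, b, i - b, k - a - i)"]) auto
  \<comment> \<open>In the second action \<open>u\<close> and \<open>v\<close> exchange roles, so
    the inner application now accounts for \<open>b + d\<close> in place of
    \<open>b + c\<close>.\<close>
  have 4: "(\<Sum>a\<le>k. \<Sum>i\<le>k - a. \<Sum>b\<le>i. T a (\<rho> (T b (v (i - b))) (u (k - a - i)))) =
      (\<Sum>(a, b, c, d)\<in>Y. T a (\<rho> (T b (v d)) (u c)))"
    unfolding Y_def
    by (simp add: sum.Sigma, rule sum.reindex_bij_witness[of _ "\<lambda>(a, b, c, d). (a, b + d, b)"
      "\<lambda>(a, i, b). (a, b, k - a - i, i - b)"]) auto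
  have 5: "(\<Sum>c\<le>k. \<Sum>d\<le>k - c. \<Sum>a\<le>k - c - d. rb_defect (T a) (T (k - c - d - a)) (u c) (v d)) =
      (\<Sum>(a, b, c, d)\<in>Y. rb_defect (T a) (T b) (u c) (v d))"
    unfolding Y_def
    by (simp add: sum.Sigma, rule sum.reindex_bij_witness[of _ "\<lambda>(a, b, c, d). (c, d, a)"
      "\<lambda>(c, d, a). (a, k - c - d - a, c, d)"]) auto
  have in_E: "formal_ext \<rho> (formal_app T p) q j \<in> E"
    if "\<And>j. p j \<in> E" "\<And>j. q j \<in> E" for p q j
    using that by (simp add: formal_ext_def formal_app_def)
  have "formal_app T (\<lambda>j. formal_ext \<rho> (formal_app T u) v j - formal_ext \<rho> (formal_app T v) u j) k =
      (\<Sum>a\<le>k. T a (formal_ext \<rho> (formal_app T u) v (k - a))) -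
      (\<Sum>a\<le>k. T a (formal_ext \<rho> (formal_app T v) u (k - a)))"
    unfolding formal_app_def[of T "\<lambda>j. _ j - _ j"]
    by (simp add: linear_op_simps(5)[OF T] in_E sum_subtractf)
  then show ?thesis
    unfolding 1 2[OF u v] 2[OF v u] 3 4 5
    by (simp add: rb_defect_def sum_subtractf case_prod_unfold)
qed

text \<open>One direction tests with constant series. In the other, every inner convolution of
  \<open>formal_rota_baxter_defect\<close> has order \<open>k - c - d \<le> n\<close> and is
  zero.\<close>

lemma formal_rota_baxter_iff:
  fixes T :: "nat \<Rightarrow> 'y \<Rightarrow> 'x" and n :: nat
  assumes T: "\<And>i. linear_op (T i)"
  shows "(\<forall>u v. (\<forall>j. u j \<in> E) \<and> (\<forall>j. v j \<in> E) \<longrightarrow>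
      (\<forall>k\<le>n. formal_ext br (formal_app T u) (formal_app T v) k =
        formal_app T (\<lambda>j. formal_ext \<rho> (formal_app T u) v j - formal_ext \<rho> (formal_app T v) u j) k))
    \<longleftrightarrow> (\<forall>m\<le>n. \<forall>u\<in>E. \<forall>v\<in>E. (\<Sum>i\<le>m. bracket11 (T i) (T (m - i)) u v) = 0)" (is "?L \<longleftrightarrow> ?R")
proof
  assume L: ?L
  show ?R
  proof (intro allI ballI impI)
    fix m u v assume m: "m \<le> n" and uv: "u \<in> E" "v \<in> E"
    \<comment> \<open>Constant series isolate the equation of order \<open>m\<close>: only
      \<open>c = d = 0\<close> contributes.\<close>
    define u' where "u' j = (if j = 0 then u else 0)" for j :: nat
    define v' where "v' j = (if j = 0 then v else 0)" for j :: nat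
    have E': "u' j \<in> E" "v' j \<in> E" for j using uv by (simp_all add: u'_def v'_def)
    have "0 = (\<Sum>c\<le>m. \<Sum>d\<le>m - c. \<Sum>a\<le>m - c - d. rb_defect (T a) (T (m - c - d - a)) (u' c) (v' d))"
      using formal_rota_baxter_defect[of T u' v' m, OF T E'] L E' m by simp
    also have "\<dots> = (\<Sum>c\<le>m. \<Sum>d\<le>m - c. if d = 0 then if c = 0 then
        \<Sum>a\<le>m. rb_defect (T a) (T (m - a)) u v else 0 else 0)"
      using uv by (intro sum.cong refl) (auto simp: u'_def v'_def rb_defect_zero T)
    also have "\<dots> = (\<Sum>a\<le>m. rb_defect (T a) (T (m - a)) u v)"
      by (simp add: sum.delta)
    finally show "(\<Sum>i\<le>m. bracket11 (T i) (T (m - i)) u v) = 0"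
      using sum_bracket11_eq_rb_defect[of T u v m, OF T uv] by simp
  qed
next
  assume R: ?R
  have zero: "(\<Sum>a\<le>m. rb_defect (T a) (T (m - a)) u v) = 0" if "m \<le> n" "u \<in> E" "v \<in> E" for m u v
    using sum_bracket11_eq_rb_defect[of T u v m, OF T] R that by simp
  show ?L
  proof (intro allI impI)
    fix u v :: "nat \<Rightarrow> 'y" and k
    assume uv: "(\<forall>j. u j \<in> E) \<and> (\<forall>j. v j \<in> E)" and k: "k \<le> n"
    have "(\<Sum>c\<le>k. \<Sum>d\<le>k - c. \<Sum>a\<le>k - c - d. rb_defect (T a) (T (k - c - d - a)) (u c) (v d)) = 0"
      using uv k by (intro sum.neutral ballI zero) auto
    then show "formal_ext br (formal_app T u) (formal_app T v) k =
        formal_app T (\<lambda>j. formal_ext \<rho> (formal_app T u) v j - formal_ext \<rho> (formal_app T v) u j) k"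
      using formal_rota_baxter_defect[of T u v k, OF T] uv by simp
  qed
qed

end

section \<open>Unshuffles of two and three arguments\<close>

lemma sum_unshuffles:
  "(\<Sum>\<sigma>\<in>unshuffles is. f \<sigma>) = (\<Sum>\<sigma> | \<sigma> permutes {..<sum_list is}.
    if \<forall>l<length is. strict_mono_on {sum_list (take l is)..<sum_list (take (Suc l) is)} \<sigma>
    then f \<sigma> else 0)"
  unfolding unshuffles_def by (subst sum.inter_filter[symmetric]) (simp_all add: finite_permutations)

lemma strict_mono_on_short:
  fixes \<sigma> :: "nat \<Rightarrow> nat"
  shows "strict_mono_on {a..<a} \<sigma>" "strict_mono_on {a} \<sigma>"
    "strict_mono_on {a..<Suc (Suc a)} \<sigma> \<longleftrightarrow> \<sigma> a < \<sigma> (Suc a)"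
  by (auto simp: strict_mono_on_def less_Suc_eq)

text \<open>The summand depends on the permutation through its sign and values only; building
  permutations by inserting one point after another then leaves an explicit list.\<close>

lemma sum_permutes_2:
  fixes F :: "int \<Rightarrow> nat \<Rightarrow> nat \<Rightarrow> 'c::comm_monoid_add"
  shows "(\<Sum>\<sigma> | \<sigma> permutes {..<2}. F (sign \<sigma>) (\<sigma> 0) (\<sigma> 1)) = F 1 0 1 + F (-1) 1 0"
proof -
  have "{..<2::nat} = insert 0 (insert 1 {})" by auto
  then show ?thesis
    by (simp add: sum_over_permutations_insert sign_compose sign_swap_id permutation_swap_id
      permutation_compose transpose_def)
qed

lemma sum_permutes_3:
  fixes F :: "int \<Rightarrow> nat \<Rightarrow> nat \<Rightarrow> nat \<Rightarrow> 'c::comm_monoid_add"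
  shows "(\<Sum>\<sigma> | \<sigma> permutes {..<3}. F (sign \<sigma>) (\<sigma> 0) (\<sigma> 1) (\<sigma> 2)) =
    F 1 0 1 2 + F (-1) 0 2 1 + F (-1) 1 0 2 + F 1 1 2 0 + F 1 2 0 1 + F (-1) 2 1 0"
proof -
  have "{..<3::nat} = insert 0 (insert 1 (insert 2 {}))" by auto
  then show ?thesis
    by (simp add: sum_over_permutations_insert sign_compose sign_swap_id permutation_swap_id
      permutation_compose transpose_def add_ac)
qed

text \<open>Blocks of length 0 or 1 impose no order. Only a block of length 2 filters the
  permutations, by one inequality between neighbouring values.\<close>

lemma sum_unshuffles_small:
  fixes g :: "nat \<Rightarrow> nat \<Rightarrow> 'c::real_vector" and h :: "nat \<Rightarrow> nat \<Rightarrow> nat \<Rightarrow> 'c"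
  shows "(\<Sum>\<sigma>\<in>unshuffles [1, 1]. of_int (sign \<sigma>) *\<^sub>R g (\<sigma> 0) (\<sigma> 1)) = g 0 1 - g 1 0"
    and "(\<Sum>\<sigma>\<in>unshuffles [1, 1, 0]. of_int (sign \<sigma>) *\<^sub>R g (\<sigma> 0) (\<sigma> 1)) = g 0 1 - g 1 0"
    and "(\<Sum>\<sigma>\<in>unshuffles [2, 1, 0]. of_int (sign \<sigma>) *\<^sub>R h (\<sigma> 0) (\<sigma> 1) (\<sigma> 2)) =
      h 0 1 2 - h 0 2 1 + h 1 2 0"
    and "(\<Sum>\<sigma>\<in>unshuffles [1, 2]. of_int (sign \<sigma>) *\<^sub>R h (\<sigma> 0) (\<sigma> 1) (\<sigma> 2)) =
      h 0 1 2 - h 1 0 2 + h 2 0 1"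
    and "(\<Sum>\<sigma>\<in>unshuffles [1, 1, 1]. of_int (sign \<sigma>) *\<^sub>R h (\<sigma> 0) (\<sigma> 1) (\<sigma> 2)) =
      h 0 1 2 - h 0 2 1 - h 1 0 2 + h 1 2 0 + h 2 0 1 - h 2 1 0"
proof -
  note simps = sum_unshuffles All_less_Suc numeral_2_eq_2 numeral_3_eq_3 strict_mono_on_short
  show "(\<Sum>\<sigma>\<in>unshuffles [1, 1]. of_int (sign \<sigma>) *\<^sub>R g (\<sigma> 0) (\<sigma> 1)) = g 0 1 - g 1 0"
    using sum_permutes_2[of "\<lambda>s a b. of_int s *\<^sub>R g a b"] by (simp add: simps)
  show "(\<Sum>\<sigma>\<in>unshuffles [1, 1, 0]. of_int (sign \<sigma>) *\<^sub>R g (\<sigma> 0) (\<sigma> 1)) = g 0 1 - g 1 0"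
    using sum_permutes_2[of "\<lambda>s a b. of_int s *\<^sub>R g a b"] by (simp add: simps)
  show "(\<Sum>\<sigma>\<in>unshuffles [2, 1, 0]. of_int (sign \<sigma>) *\<^sub>R h (\<sigma> 0) (\<sigma> 1) (\<sigma> 2)) =
      h 0 1 2 - h 0 2 1 + h 1 2 0"
    using sum_permutes_3[of "\<lambda>s a b c. if a < b then of_int s *\<^sub>R h a b c else 0"] by (simp add: simps cong: if_cong)
  show "(\<Sum>\<sigma>\<in>unshuffles [1, 2]. of_int (sign \<sigma>) *\<^sub>R h (\<sigma> 0) (\<sigma> 1) (\<sigma> 2)) =
      h 0 1 2 - h 1 0 2 + h 2 0 1"
    using sum_permutes_3[of "\<lambda>s a b c. if b < c then of_int s *\<^sub>R h a b c else 0"] by (simp add: simps cong: if_cong)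
  show "(\<Sum>\<sigma>\<in>unshuffles [1, 1, 1]. of_int (sign \<sigma>) *\<^sub>R h (\<sigma> 0) (\<sigma> 1) (\<sigma> 2)) =
      h 0 1 2 - h 0 2 1 - h 1 0 2 + h 1 2 0 + h 2 0 1 - h 2 1 0"
    using sum_permutes_3[of "\<lambda>s a b c. of_int s *\<^sub>R h a b c"] by (simp add: simps)
qed

text \<open>Here \<open>(-1) ^ (m * n)\<close> is -1, which makes the second sum positive and the
  bracket terms negative.\<close>

lemma gbracket_1_1:
  assumes "u \<in> sections_E L" "v \<in> sections_E L"
  shows "gbracket L 1 1 P Q [u, v] =
    P [rho L (Q [u]) v] - P [rho L (Q [v]) u] + (Q [rho L (P [u]) v] - Q [rho L (P [v]) u])
    - (bracket L (P [u]) (Q [v]) - bracket L (P [v]) (Q [u]))"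
proof -
  note s = sum_unshuffles_small(1,2)
  show ?thesis
    using assms
      s(1)[of "\<lambda>a b. bracket L (P [[u, v] ! a]) (Q [[u, v] ! b])"]
      s(2)[of "\<lambda>a b. P [rho L (Q [[u, v] ! a]) ([u, v] ! b)]"]
      s(2)[of "\<lambda>a b. Q [rho L (P [[u, v] ! a]) ([u, v] ! b)]"]
    by (simp add: gbracket_def pick_def)
qed

text \<open>Here \<open>(-1) ^ (m * n)\<close> is 1; the three sums run over unshuffles of types (2,
  1, 0), (1, 1, 1) and (1, 2).\<close>

lemma gbracket_1_2:
  assumes "u \<in> sections_E L" "v \<in> sections_E L" "w \<in> sections_E L"
  shows "gbracket L 1 2 P Q [u, v, w] =
    P [rho L (Q [u, v]) w] - P [rho L (Q [u, w]) v] + P [rho L (Q [v, w]) u]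
    - (Q [rho L (P [u]) v, w] - Q [rho L (P [u]) w, v] - Q [rho L (P [v]) u, w]
      + Q [rho L (P [v]) w, u] + Q [rho L (P [w]) u, v] - Q [rho L (P [w]) v, u])
    + (bracket L (P [u]) (Q [v, w]) - bracket L (P [v]) (Q [u, w]) + bracket L (P [w]) (Q [u, v]))"
proof -
  let ?us = "[u, v, w]"
  have p: "pick ?us \<sigma> 0 2 = [?us ! \<sigma> 0, ?us ! \<sigma> 1]" "pick ?us \<sigma> 1 3 = [?us ! \<sigma> 1, ?us ! \<sigma> 2]"
    "pick ?us \<sigma> 0 1 = [?us ! \<sigma> 0]" "pick ?us \<sigma> 2 3 = [?us ! \<sigma> 2]" "pick ?us \<sigma> 3 3 = []" for \<sigma>
    by (simp_all add: pick_def upt_rec numeral_2_eq_2 numeral_3_eq_3)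
  note s = sum_unshuffles_small(3,4,5)
  have "gbracket L 1 2 P Q ?us =
      (\<Sum>\<sigma>\<in>unshuffles [2, 1, 0]. of_int (sign \<sigma>) *\<^sub>R
        P [rho L (Q [?us ! \<sigma> 0, ?us ! \<sigma> 1]) (?us ! \<sigma> 2)]) -
      (\<Sum>\<sigma>\<in>unshuffles [1, 1, 1]. of_int (sign \<sigma>) *\<^sub>R
        Q [rho L (P [?us ! \<sigma> 0]) (?us ! \<sigma> 1), ?us ! \<sigma> 2]) +
      (\<Sum>\<sigma>\<in>unshuffles [1, 2]. of_int (sign \<sigma>) *\<^sub>R
        bracket L (P [?us ! \<sigma> 0]) (Q [?us ! \<sigma> 1, ?us ! \<sigma> 2]))"
    using assms by (simp add: gbracket_def p One_nat_def[symmetric] del: nth_Cons_0 nth_Cons_Suc One_nat_def)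
  then show ?thesis
    unfolding s(1)[of "\<lambda>a b c. P [rho L (Q [?us ! a, ?us ! b]) (?us ! c)]"]
      s(2)[of "\<lambda>a b c. bracket L (P [?us ! a]) (Q [?us ! b, ?us ! c])"]
      s(3)[of "\<lambda>a b c. Q [rho L (P [?us ! a]) (?us ! b), ?us ! c]"]
    by (simp add: numeral_2_eq_2)
qed

section \<open>Deformations of relative Rota--Baxter operators\<close>

lemma fmult_simps:
  "fmult f (s + t) = fmult f s + fmult f t" "fmult f (s - t) = fmult f s - fmult f t"
  "fmult f (- s) = - fmult f s" "fmult f (c *\<^sub>R s) = c *\<^sub>R fmult f s"
  "fmult f 0 = 0"
  by (simp_all add: fmult_def fun_eq_iff scaleR_add_right scaleR_diff_right scaleR_fun_def)

lemma scaleR_fun_apply: "(c *\<^sub>R f) x = c *\<^sub>R f x"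
  by (simp add: scaleR_fun_def)

locale lie_rep_bundles =
  fixes L :: "('m::{t2_space,second_countable_topology}, 'b::euclidean_space,
               'a::real_vector, 'e::real_vector) lie_rep"
  assumes pair: "lie_rep_pair L"
begin

abbreviation "M \<equiv> base L"
abbreviation "A \<equiv> algd L"
abbreviation "E \<equiv> repb L"
abbreviation "br \<equiv> bracket L"
abbreviation "\<rho> \<equiv> rho L"

lemma algebroid: "lie_algebroid M A br (anchor L)"
  and representation: "representation_on M A br (anchor L) E \<rho>"
  using pair unfolding lie_rep_pair_def by blast+

lemma vector_bundle_A: "vector_bundle M A"
  using algebroid unfolding lie_algebroid_def by blast

lemma vector_bundle_E: "vector_bundle M E"
  using representation unfolding representation_on_def by blast

sublocale smooth_mfd M
  using pair by unfold_locales (simp add: lie_rep_pair_def)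

sublocale alg: lie_rep_algebra "sections_A L" "sections_E L" br \<rho>
proof (unfold_locales, goal_cases)
  case 1 show ?case by (rule subspace_sections[OF vector_bundle_A])
next
  case 2 show ?case by (rule subspace_sections[OF vector_bundle_E])
next
  \<comment> \<open>Homogeneity of the representation in its first argument is linearity over
    functions, taken at a constant function.\<close>
  case (12 x u c)
  have "\<rho> (fmult (\<lambda>_. c) x) u = fmult (\<lambda>_. c) (\<rho> x u)"
    using representation 12 smooth_fun_const[of UNIV c] unfolding representation_on_def by blast
  then show ?case by (simp add: fmult_def scaleR_fun_def)
next
  case 3 then show ?case using algebroid unfolding lie_algebroid_def by blast
next
  case 4 then show ?case using algebroid unfolding lie_algebroid_def by blast
next
  case 5 then show ?case using algebroid unfolding lie_algebroid_def by blast
next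
  case 6 then show ?case using algebroid unfolding lie_algebroid_def by blast
next
  case 7 then show ?case using algebroid unfolding lie_algebroid_def by blast
next
  case 8 then show ?case using representation unfolding representation_on_def by blast
next
  case 9 then show ?case using representation unfolding representation_on_def by blast
next
  case 10 then show ?case using representation unfolding representation_on_def by blast
next
  case 11 then show ?case using representation unfolding representation_on_def by blast
next
  case 13 then show ?case using representation unfolding representation_on_def by blast
qed

section \<open>Leibniz rules and the tensoriality of the bracket of bundle maps\<close>

lemma rho_fmult_left:
  "x \<in> sections_A L \<Longrightarrow> u \<in> sections_E L \<Longrightarrow> smooth_fun M UNIV f \<Longrightarrow> \<rho> (fmult f x) u = fmult f (\<rho> x u)"
  using representation unfolding representation_on_def by blast

lemma rho_fmult_right:
  "x \<in> sections_A L \<Longrightarrow> u \<in> sections_E L \<Longrightarrow> smooth_fun M UNIV f \<Longrightarrow>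
    \<rho> x (fmult f u) = fmult f (\<rho> x u) + fmult (anchor_deriv (anchor L) x f) u"
  using representation unfolding representation_on_def by blast

lemma br_fmult_right:
  "x \<in> sections_A L \<Longrightarrow> y \<in> sections_A L \<Longrightarrow> smooth_fun M UNIV f \<Longrightarrow>
    br x (fmult f y) = fmult f (br x y) + fmult (anchor_deriv (anchor L) x f) y"
  using algebroid unfolding lie_algebroid_def by blast

lemma br_fmult_left:
  assumes "x \<in> sections_A L" "y \<in> sections_A L" "smooth_fun M UNIV f"
  shows "br (fmult f x) y = fmult f (br x y) - fmult (anchor_deriv (anchor L) y f) x"
proof -
  have "br (fmult f x) y = - br y (fmult f x)"
    using assms sections_fmult[OF vector_bundle_A] by (intro alg.br_skew) auto
  then show ?thesis
    using alg.br_skew[of x y] assms by (simp add: br_fmult_right fmult_simps)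
qed

lemma
  assumes "bundle_map M E A P"
  shows bundle_map_add: "e \<in> fibre E x \<Longrightarrow> e' \<in> fibre E x \<Longrightarrow> P x (e + e') = P x e + P x e'"
    and bundle_map_scaleR: "e \<in> fibre E x \<Longrightarrow> P x (c *\<^sub>R e) = c *\<^sub>R P x e"
    and bundle_map_fibre: "e \<in> fibre E x \<Longrightarrow> P x e \<in> fibre A x"
    and bundle_map_smooth: "(U, b) \<in> frames E \<Longrightarrow> j < rank E \<Longrightarrow> smooth_section_on M A U (\<lambda>x. P x (b j x))"
  using assms unfolding bundle_map_def by (blast, blast, blast, fast)

lemma app_sect_fmult:
  "bundle_map M E A P \<Longrightarrow> u \<in> sections_E L \<Longrightarrow> app_sect P (fmult f u) = fmult f (app_sect P u)"
  by (auto simp: app_sect_def fmult_def bundle_map_scaleR sections_fibre)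

text \<open>The argument has the shape that the Leibniz rule gives to
  \<open>\<rho> x (fmult f u)\<close>, through which a bundle map has to pass.\<close>

lemma app_sect_fmult_add:
  assumes "bundle_map M E A P" "u \<in> sections_E L" "v \<in> sections_E L"
  shows "app_sect P (fmult f u + fmult g v) = fmult f (app_sect P u) + fmult g (app_sect P v)"
  using subspace_scale[OF subspace_fibre[OF vector_bundle_E]] assms
  by (auto simp: app_sect_def fmult_def fun_eq_iff bundle_map_scaleR bundle_map_add sections_fibre)

lemma linear_op_app_sect:
  assumes P: "bundle_map M E A P"
  shows "alg.linear_op (app_sect P)"
  unfolding alg.linear_op_def
proof (intro conjI ballI allI)
  show "app_sect P u \<in> sections_A L" if "u \<in> sections_E L" for u
    by (rule app_sect_section[OF P vector_bundle_E vector_bundle_A that])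
  show "app_sect P (u + v) = app_sect P u + app_sect P v" if "u \<in> sections_E L" "v \<in> sections_E L" for u v
    using that by (auto simp: app_sect_def fun_eq_iff bundle_map_add[OF P] sections_fibre)
  show "app_sect P (c *\<^sub>R u) = c *\<^sub>R app_sect P u" if "u \<in> sections_E L" for c u
    using that by (auto simp: app_sect_def fun_eq_iff scaleR_fun_def bundle_map_scaleR[OF P] sections_fibre)
qed

lemma bundle_map_zero: "bundle_map M E A 0"
  unfolding bundle_map_def using subspace_0[OF subspace_fibre[OF vector_bundle_A]]
  by (auto simp: smooth_section_on_zero[OF vector_bundle_A])

lemma bundle_map_plus:
  assumes P: "bundle_map M E A P" and Q: "bundle_map M E A Q"
  shows "bundle_map M E A (\<lambda>x e. P x e + Q x e)"
  unfolding bundle_map_def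
proof (intro conjI allI ballI)
  show "P x e + Q x e \<in> fibre A x" if "e \<in> fibre E x" for x e
    using that bundle_map_fibre[OF P] bundle_map_fibre[OF Q]
    by (intro subspace_add[OF subspace_fibre[OF vector_bundle_A]])
  show "case f of (U, b) \<Rightarrow> \<forall>j<rank E. smooth_section_on M A U (\<lambda>x. P x (b j x) + Q x (b j x))"
    if "f \<in> frames E" for f
    using that bundle_map_smooth[OF P] bundle_map_smooth[OF Q]
    by (cases f) (auto intro!: smooth_section_on_add[OF vector_bundle_A])
qed (simp_all add: bundle_map_add[OF P] bundle_map_add[OF Q] bundle_map_scaleR[OF P]
  bundle_map_scaleR[OF Q] scaleR_add_right)

lemma bundle_map_uminus:
  assumes P: "bundle_map M E A P"
  shows "bundle_map M E A (\<lambda>x e. - P x e)"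
  unfolding bundle_map_def
proof (intro conjI allI ballI)
  show "- P x e \<in> fibre A x" if "e \<in> fibre E x" for x e
    using that bundle_map_fibre[OF P] by (intro subspace_neg[OF subspace_fibre[OF vector_bundle_A]])
  show "case f of (U, b) \<Rightarrow> \<forall>j<rank E. smooth_section_on M A U (\<lambda>x. - P x (b j x))"
    if "f \<in> frames E" for f
    using that bundle_map_smooth[OF P]
      smooth_section_on_fmult[OF vector_bundle_A smooth_fun_const, of _ _ "-1"]
    by (cases f) auto
qed (simp_all add: bundle_map_add[OF P] bundle_map_scaleR[OF P])

text \<open>Replacing u by f u produces derivatives of f along Q v and along P v. The former occur
  in P(rho(Q v)(f u)) and [P(f u), Q v], the latter in Q(rho(P v)(f u)) and [P v, Q(f u)], and each
  pair cancels.\<close>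

lemma tensorial_bracket11:
  assumes P: "bundle_map M E A P" and Q: "bundle_map M E A Q"
  shows "tensorial2 M E A (alg.bracket11 (app_sect P) (app_sect Q))"
  unfolding tensorial2_def
proof (intro ballI conjI allI impI)
  note lin = linear_op_app_sect[OF P] linear_op_app_sect[OF Q]
  fix u v assume uv: "u \<in> sections_E L" "v \<in> sections_E L"
  show "alg.bracket11 (app_sect P) (app_sect Q) u v \<in> sections_A L"
    by (rule alg.bracket11_closed[OF lin uv])
  show "alg.bracket11 (app_sect P) (app_sect Q) u v = - alg.bracket11 (app_sect P) (app_sect Q) v u"
    by (rule alg.bracket11_swap)
  show "alg.bracket11 (app_sect P) (app_sect Q) (u + u') v =
      alg.bracket11 (app_sect P) (app_sect Q) u v + alg.bracket11 (app_sect P) (app_sect Q) u' v"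
    if "u' \<in> sections_E L" for u'
    by (rule alg.bracket11_add_arg[OF lin uv(1) that uv(2)])
  show "alg.bracket11 (app_sect P) (app_sect Q) (fmult f u) v = fmult f (alg.bracket11 (app_sect P) (app_sect Q) u v)"
    if f: "smooth_fun M UNIV f" for f
    using uv f
    by (simp add: alg.bracket11_def app_sect_fmult[OF P] app_sect_fmult[OF Q] app_sect_fmult_add[OF P]
      app_sect_fmult_add[OF Q] alg.linear_op_simps(1)[OF lin(1)] alg.linear_op_simps(1)[OF lin(2)]
      rho_fmult_left rho_fmult_right br_fmult_left br_fmult_right fmult_simps algebra_simps)
qed

lemma tensorial2_sum:
  assumes "\<And>i. i \<in> I \<Longrightarrow> tensorial2 M E A (B i)"
  shows "tensorial2 M E A (\<lambda>u v. c *\<^sub>R (\<Sum>i\<in>I. B i u v))"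
proof -
  have fmult_sum: "fmult f (\<Sum>i\<in>I. s i) = (\<Sum>i\<in>I. fmult f (s i))" for f and s :: "_ \<Rightarrow> 'm \<Rightarrow> 'a"
    by (induction I rule: infinite_finite_induct)
      (simp_all only: sum.infinite sum.empty sum.insert fmult_simps not_False_eq_True)
  have B: "B i u v \<in> sections_A L" "B i u v = - B i v u"
    "u' \<in> sections_E L \<Longrightarrow> B i (u + u') v = B i u v + B i u' v"
    "smooth_fun M UNIV f \<Longrightarrow> B i (fmult f u) v = fmult f (B i u v)"
    if "i \<in> I" "u \<in> sections_E L" "v \<in> sections_E L" for i u u' v f
    using assms[OF that(1)] that(2,3) unfolding tensorial2_def by blast+
  show ?thesis
    unfolding tensorial2_def
  proof (intro ballI conjI allI impI)
    fix u v assume uv: "u \<in> sections_E L" "v \<in> sections_E L"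
    show "c *\<^sub>R (\<Sum>i\<in>I. B i u v) \<in> sections_A L"
      by (intro alg.closed_simps(5) alg.sum_closed B uv)
    have "(\<Sum>i\<in>I. B i u v) = (\<Sum>i\<in>I. - B i v u)"
      by (rule sum.cong[OF refl]) (rule B(2)[OF _ uv])
    then show "c *\<^sub>R (\<Sum>i\<in>I. B i u v) = - (c *\<^sub>R (\<Sum>i\<in>I. B i v u))"
      by (simp only: sum_negf scaleR_minus_right)
    show "c *\<^sub>R (\<Sum>i\<in>I. B i (u + u') v) = c *\<^sub>R (\<Sum>i\<in>I. B i u v) + c *\<^sub>R (\<Sum>i\<in>I. B i u' v)"
      if "u' \<in> sections_E L" for u'
    proof -
      have "(\<Sum>i\<in>I. B i (u + u') v) = (\<Sum>i\<in>I. B i u v + B i u' v)"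
        by (rule sum.cong[OF refl]) (rule B(3)[OF _ uv that])
      then show ?thesis by (simp only: sum.distrib scaleR_add_right)
    qed
    show "c *\<^sub>R (\<Sum>i\<in>I. B i (fmult f u) v) = fmult f (c *\<^sub>R (\<Sum>i\<in>I. B i u v))"
      if "smooth_fun M UNIV f" for f
    proof -
      have "(\<Sum>i\<in>I. B i (fmult f u) v) = (\<Sum>i\<in>I. fmult f (B i u v))"
        by (rule sum.cong[OF refl]) (rule B(4)[OF _ uv that])
      then show ?thesis by (simp only: fmult_sum fmult_simps)
    qed
  qed
qed

section \<open>Bundle maps as 1-cochains and the differential in low degrees\<close>

lemma cochain1_apply: "u \<in> sections_E L \<Longrightarrow> cochain1 L P [u] = app_sect P u"
  by (simp add: cochain1_def on_sections_def app_sect_def)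

text \<open>Thus the coboundaries of degree 2 are the differentials of exactly those maps that may
  serve as the next coefficient of a deformation. For one argument the alternation condition is
  void.\<close>

lemma cochains_1: "cochains L 1 = cochain1 L ` {P. bundle_map M E A P}"
proof (intro subset_antisym subsetI)
  fix C assume "C \<in> cochains L 1"
  then obtain p where C: "C = on_sections L 1 p" and p: "p \<in> hom_sections M 1 E A"
    unfolding cochains_def by blast
  have p1: "p x es \<in> fibre A x"
    "\<And>i e e'. i < 1 \<Longrightarrow> e \<in> fibre E x \<Longrightarrow> e' \<in> fibre E x \<Longrightarrow>
      p x (es[i := e + e']) = p x (es[i := e]) + p x (es[i := e'])"
    "\<And>i c e. i < 1 \<Longrightarrow> e \<in> fibre E x \<Longrightarrow> p x (es[i := c *\<^sub>R e]) = c *\<^sub>R p x (es[i := e])"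
    if "length es = 1" "set es \<subseteq> fibre E x" for x es
  proof -
    note q = p[unfolded hom_sections_def mem_Collect_eq, THEN conjunct1, THEN spec, THEN spec,
      THEN mp, OF conjI, OF that]
    show "p x es \<in> fibre A x" using q by (rule conjunct1)
    show "p x (es[i := e + e']) = p x (es[i := e]) + p x (es[i := e'])"
      if "i < 1" "e \<in> fibre E x" "e' \<in> fibre E x" for i e e'
      using q[THEN conjunct2, THEN conjunct1] that by blast
    show "p x (es[i := c *\<^sub>R e]) = c *\<^sub>R p x (es[i := e])" if "i < 1" "e \<in> fibre E x" for i c e
      using q[THEN conjunct2, THEN conjunct2, THEN conjunct1] that by blast
  qed
  have p2: "smooth_section_on M A U (\<lambda>x. p x (map (\<lambda>j. b j x) js))"
    if "(U, b) \<in> frames E" "length js = 1" "set js \<subseteq> {..<rank E}" for U b js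
    using p[unfolded hom_sections_def mem_Collect_eq, THEN conjunct2] that by fast
  have "bundle_map M E A (\<lambda>x e. p x [e])"
    unfolding bundle_map_def
  proof (intro conjI allI ballI)
    show "p x [e] \<in> fibre A x" if "e \<in> fibre E x" for x e
      using that by (intro p1) auto
    show "p x [e + e'] = p x [e] + p x [e']" if "e \<in> fibre E x" "e' \<in> fibre E x" for x e e'
      using p1(2)[of "[e]" x 0 e e'] that by simp
    show "p x [c *\<^sub>R e] = c *\<^sub>R p x [e]" if "e \<in> fibre E x" for x c e
      using p1(3)[of "[e]" x 0 e c] that by simp
    show "case f of (U, b) \<Rightarrow> \<forall>j<rank E. smooth_section_on M A U (\<lambda>x. p x [b j x])"
      if "f \<in> frames E" for f
      using that p2[of _ _ "[_]"] by (cases f) auto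
  qed
  moreover have "C = cochain1 L (\<lambda>x e. p x [e])"
  proof
    fix us :: "('m \<Rightarrow> 'e) list"
    show "C us = cochain1 L (\<lambda>x e. p x [e]) us"
      unfolding C cochain1_def on_sections_def by (cases us) auto
  qed
  ultimately show "C \<in> cochain1 L ` {P. bundle_map M E A P}" by blast
next
  fix C assume "C \<in> cochain1 L ` {P. bundle_map M E A P}"
  then obtain P where C: "C = on_sections L 1 (\<lambda>x es. P x (hd es))" and P: "bundle_map M E A P"
    unfolding cochain1_def by blast
  have "(\<lambda>x es. P x (hd es)) \<in> hom_sections M 1 E A"
    unfolding hom_sections_def mem_Collect_eq
  proof (intro conjI, goal_cases)
    case 1
    show ?case
    proof (intro allI impI, elim conjE)
      fix x and es :: "'e list" assume "length es = 1" "set es \<subseteq> fibre E x"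
      then obtain e where "es = [e]" "e \<in> fibre E x" by (cases es) auto
      then show "P x (hd es) \<in> fibre A x \<and>
          (\<forall>i<1. \<forall>e\<in>fibre E x. \<forall>e'\<in>fibre E x.
             P x (hd (es[i := e + e'])) = P x (hd (es[i := e])) + P x (hd (es[i := e']))) \<and>
          (\<forall>i<1. \<forall>c. \<forall>e\<in>fibre E x. P x (hd (es[i := c *\<^sub>R e])) = c *\<^sub>R P x (hd (es[i := e]))) \<and>
          (\<forall>i j. i < j \<and> j < 1 \<and> es ! i = es ! j \<longrightarrow> P x (hd es) = 0)"
        by (simp add: bundle_map_add[OF P] bundle_map_scaleR[OF P] bundle_map_fibre[OF P])
    qed
  next
    case 2
    show ?case
    proof (intro ballI, clarify)
      fix U b and js :: "nat list" assume f: "(U, b) \<in> frames E" and js: "length js = 1" "set js \<subseteq> {..<rank E}"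
      then obtain j where "js = [j]" "j < rank E" by (cases js) auto
      then show "smooth_section_on M A U (\<lambda>x. P x (hd (map (\<lambda>j. b j x) js)))"
        using bundle_map_smooth[OF P f] by simp
    qed
  qed
  then show "C \<in> cochains L 1" unfolding C cochains_def by blast
qed

lemma gbracket_cochain1:
  assumes "bundle_map M E A P" "bundle_map M E A Q"
  shows "gbracket L 1 1 (cochain1 L P) (cochain1 L Q) us =
    (if length us = 2 \<and> set us \<subseteq> sections_E L
     then alg.bracket11 (app_sect P) (app_sect Q) (us ! 0) (us ! 1) else 0)"
proof (cases "length us = 2 \<and> set us \<subseteq> sections_E L")
  case True
  then obtain u v where us: "us = [u, v]" "u \<in> sections_E L" "v \<in> sections_E L"
    by (auto simp: length_Suc_conv numeral_2_eq_2)
  then show ?thesis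
    using alg.linear_op_simps(1)[OF linear_op_app_sect[OF assms(1)]]
      alg.linear_op_simps(1)[OF linear_op_app_sect[OF assms(2)]]
    by (simp only: gbracket_1_1[OF us(2,3)]) (simp add: cochain1_apply alg.bracket11_def)
qed (auto simp: gbracket_def numeral_2_eq_2)

text \<open>The minus sign is the factor \<open>(-1) ^ k\<close> at \<open>k = 1\<close>.\<close>

lemma dT_cochain1:
  assumes "bundle_map M E A P" "bundle_map M E A Q"
  shows "dT L P 1 (cochain1 L Q) us =
    (if length us = 2 \<and> set us \<subseteq> sections_E L
     then - alg.bracket11 (app_sect P) (app_sect Q) (us ! 0) (us ! 1) else 0)"
proof -
  have "dT L P 1 (cochain1 L Q) us = - gbracket L 1 1 (cochain1 L P) (cochain1 L Q) us"
    by (simp only: dT_def scaleR_fun_apply power_one_right scaleR_minus1_left uminus_apply)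
  then show ?thesis
    by (simp only: gbracket_cochain1[OF assms] if_distrib[of uminus] minus_zero)
qed

lemma dT_2:
  assumes P: "bundle_map M E A P"
    and B: "\<And>u v. u \<in> sections_E L \<Longrightarrow> v \<in> sections_E L \<Longrightarrow> B [u, v] = B' u v"
    and B': "\<And>u v. u \<in> sections_E L \<Longrightarrow> v \<in> sections_E L \<Longrightarrow> B' u v \<in> sections_A L"
    and "u \<in> sections_E L" "v \<in> sections_E L" "w \<in> sections_E L"
  shows "dT L P 2 B [u, v, w] = alg.bracket12 (app_sect P) B' u v w"
proof -
  have "dT L P 2 B [u, v, w] = gbracket L 1 2 (cochain1 L P) B [u, v, w]"
    unfolding dT_def scaleR_fun_apply by simp
  then show ?thesis
    unfolding gbracket_1_2[OF assms(4-)] using assms(4-)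
    by (simp add: cochain1_apply alg.bracket12_def B B' alg.linear_op_simps(1)[OF linear_op_app_sect[OF P]])
qed

text \<open>A coefficient of order at most \<open>n\<close> involves no index above
  \<open>n\<close>, so truncating the series leaves the convolutions unchanged and
  \<open>formal_rota_baxter_iff\<close> applies.\<close>

lemma deformation_iff:
  "deformation L T n \<T> \<longleftrightarrow> \<T> 0 = T \<and> (\<forall>i\<le>n. bundle_map M E A (\<T> i)) \<and>
    (\<forall>m\<le>n. \<forall>u\<in>sections_E L. \<forall>v\<in>sections_E L.
      (\<Sum>i\<le>m. alg.bracket11 (app_sect (\<T> i)) (app_sect (\<T> (m - i))) u v) = 0)"
proof (cases "\<forall>i\<le>n. bundle_map M E A (\<T> i)")
  case True
  \<comment> \<open>The algebraic criterion asks for a linear operator at every index; truncation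
    supplies them, since the zero map is a bundle map.\<close>
  define T' where "T' i = app_sect (trunc n \<T> i)" for i
  have lin: "alg.linear_op (T' i)" for i
    using True bundle_map_zero by (simp add: T'_def trunc_def linear_op_app_sect)
  have app: "formal_ext app_sect (trunc n \<T>) u = alg.formal_app T' u" for u
    by (simp add: fun_eq_iff formal_ext_def alg.formal_app_def T'_def)
  have "(\<Sum>i\<le>m. alg.bracket11 (T' i) (T' (m - i)) u v) =
      (\<Sum>i\<le>m. alg.bracket11 (app_sect (\<T> i)) (app_sect (\<T> (m - i))) u v)" if "m \<le> n" for m u v
    using that by (intro sum.cong) (auto simp: T'_def trunc_def)
  with alg.formal_rota_baxter_iff[of T' n, OF lin] True show ?thesis
    by (simp add: deformation_def Let_def app fun_diff_def)
next
  case False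
  then show ?thesis unfolding deformation_def by blast
qed

section \<open>Coboundaries and classes in degree 2\<close>

lemma coboundaries_2: "coboundaries L T 2 = (\<lambda>P. dT L T 1 (cochain1 L P)) ` {P. bundle_map M E A P}"
  using cochains_1 by (simp add: coboundaries_def image_image)

text \<open>Two cosets of a subgroup agree iff the difference lies in it. The subgroup property
  comes from additivity of the differential on bundle maps, whose sums and negatives are again
  bundle maps.\<close>

lemma coh_class_eq_zero_iff:
  assumes T: "bundle_map M E A T"
  shows "coh_class L T 2 \<Theta> = coh_class L T 2 0 \<longleftrightarrow> \<Theta> \<in> coboundaries L T 2"
proof -
  note lin = linear_op_app_sect[OF T] linear_op_app_sect
  have eq: "dT L T 1 (cochain1 L (\<lambda>x e. P x e + Q x e)) = dT L T 1 (cochain1 L P) + dT L T 1 (cochain1 L Q)"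
    "dT L T 1 (cochain1 L (\<lambda>x e. - P x e)) = - dT L T 1 (cochain1 L P)"
    if P: "bundle_map M E A P" and Q: "bundle_map M E A Q" for P Q
  proof -
    let ?valid = "\<lambda>us. length us = 2 \<and> set us \<subseteq> sections_E L"
    have nth_in: "us ! 0 \<in> sections_E L" "us ! 1 \<in> sections_E L" if "?valid us" for us
      using that by (auto simp: subset_iff)
    have app: "app_sect (\<lambda>x e. P x e + Q x e) = (\<lambda>u. app_sect P u + app_sect Q u)"
      "app_sect (\<lambda>x e. - P x e) = (\<lambda>u. - app_sect P u)"
      by (simp_all add: fun_eq_iff app_sect_def)
    show "dT L T 1 (cochain1 L (\<lambda>x e. P x e + Q x e)) = dT L T 1 (cochain1 L P) + dT L T 1 (cochain1 L Q)"
    proof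
      fix us
      have "dT L T 1 (cochain1 L (\<lambda>x e. P x e + Q x e)) us =
          dT L T 1 (cochain1 L P) us + dT L T 1 (cochain1 L Q) us"
      proof (cases "?valid us")
        case True
        show ?thesis
          unfolding dT_cochain1[OF T P] dT_cochain1[OF T Q] dT_cochain1[OF T bundle_map_plus[OF P Q]]
            if_P[OF True] app(1) alg.bracket11_add_op[OF lin(1) lin(2)[OF P] lin(2)[OF Q] nth_in[OF True]]
          by (rule minus_add_distrib)
      next
        case False
        show ?thesis
          unfolding dT_cochain1[OF T P] dT_cochain1[OF T Q] dT_cochain1[OF T bundle_map_plus[OF P Q]]
            if_not_P[OF False] by (rule add_0[symmetric])
      qed
      then show "dT L T 1 (cochain1 L (\<lambda>x e. P x e + Q x e)) us =
          (dT L T 1 (cochain1 L P) + dT L T 1 (cochain1 L Q)) us" by simp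
    qed
    show "dT L T 1 (cochain1 L (\<lambda>x e. - P x e)) = - dT L T 1 (cochain1 L P)"
    proof
      fix us
      have "dT L T 1 (cochain1 L (\<lambda>x e. - P x e)) us = - dT L T 1 (cochain1 L P) us"
      proof (cases "?valid us")
        case True
        show ?thesis
          unfolding dT_cochain1[OF T P] dT_cochain1[OF T bundle_map_uminus[OF P]]
            if_P[OF True] app(2) alg.bracket11_minus_op[OF lin(1) lin(2)[OF P] nth_in[OF True]] ..
      next
        case False
        show ?thesis
          unfolding dT_cochain1[OF T P] dT_cochain1[OF T bundle_map_uminus[OF P]]
            if_not_P[OF False] by (rule minus_zero[symmetric])
      qed
      then show "dT L T 1 (cochain1 L (\<lambda>x e. - P x e)) us = (- dT L T 1 (cochain1 L P)) us" by simp
    qed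
  qed
  have add: "B + C \<in> coboundaries L T 2" "- B \<in> coboundaries L T 2"
    if BC: "B \<in> coboundaries L T 2" "C \<in> coboundaries L T 2" for B C
  proof -
    obtain P where P: "bundle_map M E A P" "B = dT L T 1 (cochain1 L P)"
      using BC(1) unfolding coboundaries_2 by (elim imageE CollectE)
    obtain Q where Q: "bundle_map M E A Q" "C = dT L T 1 (cochain1 L Q)"
      using BC(2) unfolding coboundaries_2 by (elim imageE CollectE)
    show "B + C \<in> coboundaries L T 2"
      unfolding coboundaries_2 P(2) Q(2) eq(1)[OF P(1) Q(1), symmetric]
      by (intro imageI CollectI bundle_map_plus P(1) Q(1))
    show "- B \<in> coboundaries L T 2"
      unfolding coboundaries_2 P(2) eq(2)[OF P(1) P(1), symmetric]
      by (intro imageI CollectI bundle_map_uminus P(1))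
  qed
  have zero: "0 \<in> coboundaries L T 2"
  proof -
    have "dT L T 1 (cochain1 L 0) \<in> coboundaries L T 2"
      unfolding coboundaries_2 by (intro imageI CollectI bundle_map_zero)
    \<comment> \<open>Zero is obtained as a coboundary plus its negative.\<close>
    from add(1)[OF this add(2)[OF this this]] show ?thesis by simp
  qed
  show ?thesis
  proof
    assume "coh_class L T 2 \<Theta> = coh_class L T 2 0"
    moreover have "\<Theta> + 0 \<in> coh_class L T 2 \<Theta>" unfolding coh_class_def using zero by blast
    ultimately have "\<Theta> + 0 \<in> coh_class L T 2 0" by simp
    then show "\<Theta> \<in> coboundaries L T 2" unfolding coh_class_def by auto
  next
    assume Th: "\<Theta> \<in> coboundaries L T 2"
    show "coh_class L T 2 \<Theta> = coh_class L T 2 0"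
      unfolding coh_class_def
    proof (intro subset_antisym subsetI; clarify)
      fix B assume B: "B \<in> coboundaries L T 2"
      show "\<exists>C. \<Theta> + B = 0 + C \<and> C \<in> coboundaries L T 2"
        using add(1)[OF Th B] by (intro exI[of _ "\<Theta> + B"]) simp
      show "\<exists>C. 0 + B = \<Theta> + C \<and> C \<in> coboundaries L T 2"
        using add(1)[OF add(2)[OF Th Th] B] by (intro exI[of _ "- \<Theta> + B"]) simp
    qed
  qed
qed

end

theorem theorem4p6:
  fixes L :: "('m::{t2_space,second_countable_topology}, 'b::euclidean_space,
               'a::real_vector, 'e::real_vector) lie_rep"
    and T :: "'m \<Rightarrow> 'e \<Rightarrow> 'a"
    and \<T> :: "nat \<Rightarrow> 'm \<Rightarrow> 'e \<Rightarrow> 'a"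
    and n :: nat
    and \<Theta> :: "('m \<Rightarrow> 'e) list \<Rightarrow> 'm \<Rightarrow> 'a"
  assumes "lie_rep_pair L"
    and "relative_rota_baxter L T"
    and "deformation L T n \<T>"
    and "\<Theta> = (1 / 2) *\<^sub>R (\<Sum>(i, j)\<in>{(i, j). i + j = n + 1 \<and> 1 \<le> i \<and> 1 \<le> j}.
                gbracket L 1 1 (cochain1 L (\<T> i)) (cochain1 L (\<T> j)))"
  shows "\<Theta> \<in> cochains L 2 \<and> dT L T 2 \<Theta> = 0 \<and>
    coh_class L T 2 \<Theta> \<in> cohomology L T 2 \<and>
    (extendable L T n \<T> \<longleftrightarrow> coh_class L T 2 \<Theta> = coh_class L T 2 0)"
proof -
  interpret lie_rep_bundles L using assms(1) by unfold_locales
  have T0: "\<T> 0 = T" and bm: "\<And>i. i \<le> n \<Longrightarrow> bundle_map M E A (\<T> i)"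
    and eqs: "\<And>m u v. m \<le> n \<Longrightarrow> u \<in> sections_E L \<Longrightarrow> v \<in> sections_E L \<Longrightarrow>
      (\<Sum>i\<le>m. alg.bracket11 (app_sect (\<T> i)) (app_sect (\<T> (m - i))) u v) = 0"
    using assms(3) unfolding deformation_iff by blast+
  have T: "bundle_map M E A T" using bm[of 0] T0 by simp
  \<comment> \<open>\<open>\<T>\<close> may take any values above \<open>n\<close>; truncation
    realises the convention \<open>\<T>\<^sub>n\<^sub>+\<^sub>1 = 0\<close>.\<close>
  define op where "op i = app_sect (trunc n \<T> i)" for i
  have lin: "alg.linear_op (op i)" for i
    using bm bundle_map_zero by (simp add: op_def trunc_def linear_op_app_sect)
  have op_low: "op i = app_sect (\<T> i)" if "i \<le> n" for i
    using that by (simp add: op_def trunc_def)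
  have op_low': "op (n + 1 - i) = app_sect (\<T> (n + 1 - i))" if "1 \<le> i" for i
    using that by (intro op_low) simp
  have op_top: "op (n + 1) = (\<lambda>u. 0)"
    by (simp add: op_def trunc_def app_sect_def fun_eq_iff)
  define B where "B u v = (1 / 2) *\<^sub>R (\<Sum>i\<in>{1..n}. alg.bracket11 (app_sect (\<T> i)) (app_sect (\<T> (n + 1 - i))) u v)" for u v
  have \<Theta>: "\<Theta> us = (if length us = 2 \<and> set us \<subseteq> sections_E L then B (us ! 0) (us ! 1) else 0)" for us
  proof -
    have "(\<Sum>(i, j)\<in>{(i, j). i + j = n + 1 \<and> 1 \<le> i \<and> 1 \<le> j}.
        gbracket L 1 1 (cochain1 L (\<T> i)) (cochain1 L (\<T> j))) =
      (\<Sum>i\<in>{1..n}. gbracket L 1 1 (cochain1 L (\<T> i)) (cochain1 L (\<T> (n + 1 - i))))"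
      by (rule sum.reindex_bij_witness[of _ "\<lambda>i. (i, n + 1 - i)" fst]) (auto, metis diff_add_inverse)
    then have "\<Theta> us = (1 / 2) *\<^sub>R
        (\<Sum>i\<in>{1..n}. gbracket L 1 1 (cochain1 L (\<T> i)) (cochain1 L (\<T> (n + 1 - i))) us)"
      unfolding assms(4) by (simp only: scaleR_fun_def sum_fun_apply)
    also have "(\<Sum>i\<in>{1..n}. gbracket L 1 1 (cochain1 L (\<T> i)) (cochain1 L (\<T> (n + 1 - i))) us) =
        (\<Sum>i\<in>{1..n}. if length us = 2 \<and> set us \<subseteq> sections_E L
          then alg.bracket11 (app_sect (\<T> i)) (app_sect (\<T> (n + 1 - i))) (us ! 0) (us ! 1) else 0)"
      by (intro sum.cong refl gbracket_cochain1 bm) auto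
    finally show ?thesis
      by (cases "length us = 2 \<and> set us \<subseteq> sections_E L")
        (simp_all only: B_def simp_thms if_True if_False sum.neutral_const scaleR_zero_right)
  qed
  \<comment> \<open>Both end terms pair \<open>op 0\<close> with \<open>op (n + 1)\<close>, which is
    zero. The sum over inner indices is therefore a full convolution of order \<open>n + 1\<close>,
    the form needed for the Jacobi argument.\<close>
  have B_op: "B u v = (1 / 2) *\<^sub>R (\<Sum>i\<le>n + 1. alg.bracket11 (op i) (op (n + 1 - i)) u v)"
    if "u \<in> sections_E L" "v \<in> sections_E L" for u v
  proof -
    have "(\<Sum>i\<in>{1..n}. alg.bracket11 (app_sect (\<T> i)) (app_sect (\<T> (n + 1 - i))) u v) =
        (\<Sum>i\<in>{1..n}. alg.bracket11 (op i) (op (n + 1 - i)) u v)"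
      by (rule sum.cong[OF refl]) (simp only: op_low op_low' atLeastAtMost_iff)
    also have "\<dots> = (\<Sum>i\<le>n + 1. alg.bracket11 (op i) (op (n + 1 - i)) u v)"
    proof (rule sum.mono_neutral_left)
      show "\<forall>i\<in>{..n + 1} - {1..n}. alg.bracket11 (op i) (op (n + 1 - i)) u v = 0"
      proof
        fix i assume "i \<in> {..n + 1} - {1..n}"
        then have "i = 0 \<or> i = n + 1" by auto
        then show "alg.bracket11 (op i) (op (n + 1 - i)) u v = 0"
          using op_top alg.bracket11_zero_op[OF lin[of 0] that] by auto
      qed
    qed auto
    finally show ?thesis by (simp only: B_def)
  qed
  have B_in: "B u v \<in> sections_A L" if "u \<in> sections_E L" "v \<in> sections_E L" for u v
    unfolding B_op[OF that] by (intro alg.closed_simps(5) alg.sum_closed alg.bracket11_closed lin that)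
  have closed: "alg.bracket12 (app_sect T) B u v w = 0"
    if uvw: "u \<in> sections_E L" "v \<in> sections_E L" "w \<in> sections_E L" for u v w
  proof -
    have "alg.bracket12 (op 0) B u v w =
        alg.bracket12 (op 0) (\<lambda>u v. (1 / 2) *\<^sub>R (\<Sum>i\<le>n + 1. alg.bracket11 (op i) (op (n + 1 - i)) u v)) u v w"
      by (rule alg.bracket12_cong[OF lin B_op uvw])
    also have "\<dots> = (1 / 2) *\<^sub>R alg.bracket12 (op 0) (\<lambda>u v. \<Sum>i\<le>n + 1. alg.bracket11 (op i) (op (n + 1 - i)) u v) u v w"
      by (rule alg.bracket12_scaleR[OF lin _ uvw]) (intro alg.sum_closed alg.bracket11_closed lin)
    also have "alg.bracket12 (op 0) (\<lambda>u v. \<Sum>i\<le>n + 1. alg.bracket11 (op i) (op (n + 1 - i)) u v) u v w = 0"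
    \<comment> \<open>Used at \<open>N = n + 1\<close>: the lower convolutions to be checked have
      order at most \<open>n\<close> and vanish for a deformation.\<close>
    proof (rule alg.bracket12_bracket11_sum_eq_0[OF lin _ uvw])
      fix m u v assume m: "m < n + 1" and uv: "u \<in> sections_E L" "v \<in> sections_E L"
      have "(\<Sum>i\<le>m. alg.bracket11 (op i) (op (m - i)) u v) =
          (\<Sum>i\<le>m. alg.bracket11 (app_sect (\<T> i)) (app_sect (\<T> (m - i))) u v)"
        using m by (intro sum.cong refl) (simp add: op_low)
      then show "(\<Sum>i\<le>m. alg.bracket11 (op i) (op (m - i)) u v) = 0" using eqs m uv by simp
    qed
    finally show ?thesis by (simp only: scaleR_zero_right op_low[OF le0] T0)
  qed
  have cochain: "\<Theta> \<in> cochains L 2"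
  proof (rule tensorial2_cochain[OF smooth_manifold vector_bundle_E vector_bundle_A _ \<Theta>])
    show "tensorial2 M E A B"
      unfolding B_def by (intro tensorial2_sum tensorial_bracket11 bm) auto
  qed
  have dT: "dT L T 2 \<Theta> = 0"
  proof
    fix us
    show "dT L T 2 \<Theta> us = 0 us"
    proof (cases "length us = 3 \<and> set us \<subseteq> sections_E L")
      case True
      then obtain u v w where us: "us = [u, v, w]" "u \<in> sections_E L" "v \<in> sections_E L" "w \<in> sections_E L"
        by (auto simp: length_Suc_conv numeral_3_eq_3)
      then show ?thesis
        using dT_2[OF T _ B_in us(2-4), of \<Theta>] closed[OF us(2-4)] by (simp add: \<Theta>)
    qed (auto simp: dT_def gbracket_def scaleR_fun_def)
  qed
  have "extendable L T n \<T> \<longleftrightarrow> \<Theta> \<in> coboundaries L T 2"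
  proof -
    have extension: "deformation L T (n + 1) (\<T>(n + 1 := S)) \<longleftrightarrow> \<Theta> = dT L T 1 (cochain1 L S)"
      if S: "bundle_map M E A S" for S
    proof -
      define U where "U = \<T>(n + 1 := S)"
      have low: "(\<Sum>i\<le>m. alg.bracket11 (app_sect (U i)) (app_sect (U (m - i))) u v) = 0"
        if "m \<le> n" "u \<in> sections_E L" "v \<in> sections_E L" for m u v
      proof -
        have "(\<Sum>i\<le>m. alg.bracket11 (app_sect (U i)) (app_sect (U (m - i))) u v) =
            (\<Sum>i\<le>m. alg.bracket11 (app_sect (\<T> i)) (app_sect (\<T> (m - i))) u v)"
          using that(1) by (intro sum.cong refl) (auto simp: U_def)
        then show ?thesis using eqs that by simp
      qed
      \<comment> \<open>The ends \<open>i = 0\<close> and \<open>i = n + 1\<close> both give the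
        bracket of \<open>T\<close> and \<open>S\<close>, by symmetry. For the remaining indices
        \<open>U\<close> agrees with \<open>\<T>\<close>, and the factor 1/2 in \<open>B\<close>
        turns their sum into twice \<open>B u v\<close>.\<close>
      have top: "(\<Sum>i\<le>n + 1. alg.bracket11 (app_sect (U i)) (app_sect (U (n + 1 - i))) u v) =
          2 *\<^sub>R (B u v + alg.bracket11 (app_sect T) (app_sect S) u v)"
        if uv: "u \<in> sections_E L" "v \<in> sections_E L" for u v
      proof -
        have "{..n + 1} = insert 0 (insert (n + 1) {1..n})" by auto
        then have "(\<Sum>i\<le>n + 1. alg.bracket11 (app_sect (U i)) (app_sect (U (n + 1 - i))) u v) =
            alg.bracket11 (app_sect T) (app_sect S) u v + (alg.bracket11 (app_sect S) (app_sect T) u v +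
            (\<Sum>i\<in>{1..n}. alg.bracket11 (app_sect (U i)) (app_sect (U (n + 1 - i))) u v))"
          by (simp add: U_def T0)
        also have "(\<Sum>i\<in>{1..n}. alg.bracket11 (app_sect (U i)) (app_sect (U (n + 1 - i))) u v) = 2 *\<^sub>R B u v"
        proof -
          have "(\<Sum>i\<in>{1..n}. alg.bracket11 (app_sect (U i)) (app_sect (U (n + 1 - i))) u v) =
              (\<Sum>i\<in>{1..n}. alg.bracket11 (app_sect (\<T> i)) (app_sect (\<T> (n + 1 - i))) u v)"
            by (intro sum.cong refl) (auto simp: U_def)
          then show ?thesis unfolding B_def by simp
        qed
        also have "alg.bracket11 (app_sect S) (app_sect T) u v = alg.bracket11 (app_sect T) (app_sect S) u v"
          by (rule alg.bracket11_sym[OF linear_op_app_sect[OF S] linear_op_app_sect[OF T] uv])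
        finally show ?thesis by (simp only: scaleR_2 add_ac)
      qed
      have "deformation L T (n + 1) U \<longleftrightarrow>
          (\<forall>u\<in>sections_E L. \<forall>v\<in>sections_E L. B u v + alg.bracket11 (app_sect T) (app_sect S) u v = 0)"
      proof -
        have "U 0 = T" "\<forall>i\<le>n + 1. bundle_map M E A (U i)"
          using T0 bm S by (auto simp: U_def)
        then show ?thesis
          unfolding deformation_iff using low top by (auto simp: le_Suc_eq)
      qed
      also have "\<dots> \<longleftrightarrow> (\<forall>u\<in>sections_E L. \<forall>v\<in>sections_E L. \<Theta> [u, v] = dT L T 1 (cochain1 L S) [u, v])"
      proof (intro ball_cong refl)
        fix u v assume uv: "u \<in> sections_E L" "v \<in> sections_E L"
        have d: "dT L T 1 (cochain1 L S) [u, v] = - alg.bracket11 (app_sect T) (app_sect S) u v"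
          unfolding dT_cochain1[OF T S] using uv by simp
        have B: "\<Theta> [u, v] = B u v"
          unfolding \<Theta> using uv by simp
        show "B u v + alg.bracket11 (app_sect T) (app_sect S) u v = 0 \<longleftrightarrow>
            \<Theta> [u, v] = dT L T 1 (cochain1 L S) [u, v]"
          unfolding d B by (rule eq_neg_iff_add_eq_0[symmetric])
      qed
      \<comment> \<open>Both sides take the default value 0 on lists that are not pairs of sections,
        so agreement on such pairs is equality of functions.\<close>
      also have "\<dots> \<longleftrightarrow> \<Theta> = dT L T 1 (cochain1 L S)"
      proof
        assume *: "\<forall>u\<in>sections_E L. \<forall>v\<in>sections_E L. \<Theta> [u, v] = dT L T 1 (cochain1 L S) [u, v]"
        show "\<Theta> = dT L T 1 (cochain1 L S)"
        proof
          fix us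
          show "\<Theta> us = dT L T 1 (cochain1 L S) us"
          proof (cases "length us = 2 \<and> set us \<subseteq> sections_E L")
            case True
            then obtain u v where "us = [u, v]" "u \<in> sections_E L" "v \<in> sections_E L"
              by (auto simp: length_Suc_conv numeral_2_eq_2)
            with * show ?thesis by blast
          next
            case False
            then show ?thesis by (simp only: \<Theta> dT_cochain1[OF T S] if_False)
          qed
        qed
      qed simp
      finally show ?thesis by (simp only: U_def)
    qed
    show ?thesis
      unfolding extendable_def coboundaries_2 using extension by blast
  qed
  with coh_class_eq_zero_iff[OF T] have
    "extendable L T n \<T> \<longleftrightarrow> coh_class L T 2 \<Theta> = coh_class L T 2 0" by simp
  moreover have "coh_class L T 2 \<Theta> \<in> cohomology L T 2"
    unfolding cohomology_def cocycles_def using cochain dT by blast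
  ultimately show ?thesis using cochain dT by blast
qed

end
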